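(* Let $K$ be an algebraically closed field and let $\Lambda$ be a basic local finite dimensional $K$-algebra with Jacobson radical $J$ satisfying $J^2=0$, say $\Lambda=KQ/\langle\text{all paths of length }2\rangle$, where $Q$ is the quiver with a single vertex and $r\ge 2$ distinct loops. Let $S$ be the unique simple left $\Lambda$-module and, for $d\ge 2$, let $u\in\mathbb N$ be minimal with respect to $r\cdot u\ge d-u$, i.e., $u=\lceil d/(r+1)\rceil$. Then the irreducible components of $\mathbf{Rep}_d(\Lambda)$ are precisely the closures $\overline{\mathbf{Rep}^T_d}$, where $T=S^t$ with $u\le t\le d-u$. Moreover, the modules in the irreducible components of $\mathbf{Rep}_d(\Lambda)$ are generically without simple direct summands.
   Context: For a positive integer $d$, $\mathbf{Rep}_d(\Lambda)$ is the affine variety of sequences $(A_1,\dots,A_r)$ with $A_i\in\operatorname{End}_K(K^d)$ and $A_iA_j=0$ for all $i,j$; its points correspond to the $d$-dimensional left $\Lambda$-modules ($A_i$ giving the action of the $i$-th loop). For a semisimple module $T=S^t$, $\mathbf{Rep}^T_d\subseteq\mathbf{Rep}_d(\Lambda)$ is the locally closed subvariety of points whose modules $M$ have top $M/JM\cong T$; closures are taken in $\mathbf{Rep}_d(\Lambda)$. The modules in an irreducible variety $\mathcal C$ are said to have a property generically if all modules corresponding to points of some dense open subset of $\mathcal C$ have the property. *)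

theory Defs
  imports
    "HOL-Algebra.QuotRing"
    "HOL-Algebra.Generated_Groups"
    "HOL-Algebra.Module"
    "HOL-Analysis.Abstract_Topology"
    "HOL-Computational_Algebra.Polynomial"
    "Jordan_Normal_Form.Matrix"
begin

text \<open>
  The loops of \<open>Q\<close> are \<open>0, \<dots>, r - 1\<close>, so the paths of \<open>Q\<close> are the words over \<open>{..<r}\<close>, and an
  element of \<open>KQ\<close> is its family of coefficients. The product is the linear extension of
  concatenation of words: a word \<open>w\<close> arises from the splittings \<open>w = take k w @ drop k w\<close>.
\<close>

definition path_algebra :: "nat \<Rightarrow> (nat list \<Rightarrow> 'k::field) ring" where
  "path_algebra r = \<lparr>
     carrier = {f. finite {w. f w \<noteq> 0} \<and> (\<forall>w. f w \<noteq> 0 \<longrightarrow> set w \<subseteq> {..<r})},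
     monoid.mult = (\<lambda>f g w. \<Sum>k\<le>length w. f (take k w) * g (drop k w)),
     one = (\<lambda>w. if w = [] then 1 else 0),
     zero = (\<lambda>w. 0),
     add = (\<lambda>f g w. f w + g w)\<rparr>"

definition path_elem :: "nat list \<Rightarrow> nat list \<Rightarrow> 'k::field" where
  "path_elem w = (\<lambda>v. if v = w then 1 else 0)"

definition rel_ideal :: "nat \<Rightarrow> (nat list \<Rightarrow> 'k::field) set" where
  "rel_ideal r = Idl\<^bsub>path_algebra r\<^esub> {path_elem w |w. length w = 2 \<and> set w \<subseteq> {..<r}}"

definition Lambda_alg :: "nat \<Rightarrow> (nat list \<Rightarrow> 'k::field) set ring" where
  "Lambda_alg r = path_algebra r Quot rel_ideal r"

text \<open>
  The loops annihilate each other, so \<^term>\<open>Lambda_alg r\<close> is commutative (\<open>Lambda_alg_cring\<close>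
  below). Hence its left modules are modules over a commutative ring, and its maximal left
  ideals, whose intersection is the Jacobson radical, are its maximal ideals.
\<close>

definition jacobson_radical :: "('a, 'm) ring_scheme \<Rightarrow> 'a set" where
  "jacobson_radical R = carrier R \<inter> \<Inter>{I. maximalideal I R}"

definition simple_module :: "('a, 'm) ring_scheme \<Rightarrow> ('a, 'b) module \<Rightarrow> bool" where
  "simple_module R M \<longleftrightarrow> module R M \<and> carrier M \<noteq> {\<zero>\<^bsub>M\<^esub>} \<and>
     (\<forall>N. submodule N R M \<longrightarrow> N = {\<zero>\<^bsub>M\<^esub>} \<or> N = carrier M)"

definition module_iso ::
    "('a, 'm) ring_scheme \<Rightarrow> ('a, 'b) module \<Rightarrow> ('a, 'c) module \<Rightarrow> bool" where
  "module_iso R M N \<longleftrightarrow> (\<exists>h \<in> iso (add_monoid M) (add_monoid N).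
     \<forall>a\<in>carrier R. \<forall>x\<in>carrier M. h (a \<odot>\<^bsub>M\<^esub> x) = a \<odot>\<^bsub>N\<^esub> h x)"

definition module_power :: "('a, 'b) module \<Rightarrow> nat \<Rightarrow> ('a, nat \<Rightarrow> 'b) module" where
  "module_power M t = \<lparr>
     carrier = {..<t} \<rightarrow>\<^sub>E carrier M,
     monoid.mult = undefined, one = undefined,
     zero = (\<lambda>i\<in>{..<t}. \<zero>\<^bsub>M\<^esub>),
     add = (\<lambda>x y. \<lambda>i\<in>{..<t}. x i \<oplus>\<^bsub>M\<^esub> y i),
     smult = (\<lambda>a x. \<lambda>i\<in>{..<t}. a \<odot>\<^bsub>M\<^esub> x i)\<rparr>"

definition quotient_module :: "('a, 'b) module \<Rightarrow> 'b set \<Rightarrow> ('a, 'b set) module" where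
  "quotient_module M N = \<lparr>
     carrier = a_rcosets\<^bsub>M\<^esub> N,
     monoid.mult = undefined, one = undefined,
     zero = N,
     add = set_add M,
     smult = (\<lambda>a X. \<Union>x\<in>X. N +>\<^bsub>M\<^esub> (a \<odot>\<^bsub>M\<^esub> x))\<rparr>"

definition ideal_smult :: "'a set \<Rightarrow> ('a, 'b) module \<Rightarrow> 'b set" where
  "ideal_smult I M = generate (add_monoid M) {a \<odot>\<^bsub>M\<^esub> x |a x. a \<in> I \<and> x \<in> carrier M}"

definition module_top :: "('a, 'm) ring_scheme \<Rightarrow> ('a, 'b) module \<Rightarrow> ('a, 'b set) module" where
  "module_top R M = quotient_module M (ideal_smult (jacobson_radical R) M)"

definition direct_summand :: "('a, 'm) ring_scheme \<Rightarrow> ('a, 'b) module \<Rightarrow> 'b set \<Rightarrow> bool" where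
  "direct_summand R M N \<longleftrightarrow> submodule N R M \<and>
     (\<exists>N'. submodule N' R M \<and> N <+>\<^bsub>M\<^esub> N' = carrier M \<and> N \<inter> N' = {\<zero>\<^bsub>M\<^esub>})"

definition has_simple_direct_summand :: "('a, 'm) ring_scheme \<Rightarrow> ('a, 'b) module \<Rightarrow> bool" where
  "has_simple_direct_summand R M \<longleftrightarrow>
     (\<exists>N. direct_summand R M N \<and> simple_module R (M\<lparr>carrier := N\<rparr>))"

definition Rep :: "nat \<Rightarrow> nat \<Rightarrow> 'k::field mat list set" where
  "Rep r d = {A. length A = r \<and> set A \<subseteq> carrier_mat d d \<and>
     (\<forall>i<r. \<forall>j<r. A ! i * A ! j = 0\<^sub>m d d)}"

text \<open>
  The path \<open>[i, j, \<dots>]\<close> acts as \<open>A ! i * A ! j * \<dots>\<close>. For \<open>A\<close> in \<^term>\<open>Rep r d\<close> the action of a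
  coset does not depend on the chosen representative (\<open>rep_module_module\<close> below).
\<close>

definition path_act :: "'k::field mat list \<Rightarrow> nat list \<Rightarrow> 'k vec \<Rightarrow> 'k vec" where
  "path_act A w v = foldr (\<lambda>i x. A ! i *\<^sub>v x) w v"

definition path_algebra_act ::
    "nat \<Rightarrow> 'k::field mat list \<Rightarrow> (nat list \<Rightarrow> 'k) \<Rightarrow> 'k vec \<Rightarrow> 'k vec" where
  "path_algebra_act d A f v = vec d (\<lambda>k. \<Sum>w | f w \<noteq> 0. f w * path_act A w v $ k)"

definition rep_module ::
    "nat \<Rightarrow> 'k::field mat list \<Rightarrow> ((nat list \<Rightarrow> 'k) set, 'k vec) module" where
  "rep_module d A = \<lparr>
     carrier = carrier_vec d,
     monoid.mult = undefined, one = undefined,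
     zero = 0\<^sub>v d,
     add = (+),
     smult = (\<lambda>X v. path_algebra_act d A (SOME f. f \<in> X) v)\<rparr>"

definition Rep_top ::
    "nat \<Rightarrow> nat \<Rightarrow> ((nat list \<Rightarrow> 'k::field) set, 'b) module \<Rightarrow> 'k mat list set" where
  "Rep_top r d T = {A \<in> Rep r d.
     module_iso (Lambda_alg r) (module_top (Lambda_alg r) (rep_module d A)) T}"

text \<open>Polynomial functions in the \<open>r * d\<^sup>2\<close> matrix entries of an \<open>r\<close>-tuple of \<open>d \<times> d\<close> matrices.\<close>

inductive_set poly_fun :: "nat \<Rightarrow> nat \<Rightarrow> ('k::field mat list \<Rightarrow> 'k) set" for r d :: nat where
  const: "(\<lambda>A. c) \<in> poly_fun r d"
| coord: "i < r \<Longrightarrow> p < d \<Longrightarrow> q < d \<Longrightarrow> (\<lambda>A. (A ! i) $$ (p, q)) \<in> poly_fun r d"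
| add: "f \<in> poly_fun r d \<Longrightarrow> g \<in> poly_fun r d \<Longrightarrow> (\<lambda>A. f A + g A) \<in> poly_fun r d"
| mult: "f \<in> poly_fun r d \<Longrightarrow> g \<in> poly_fun r d \<Longrightarrow> (\<lambda>A. f A * g A) \<in> poly_fun r d"

definition mat_tuples :: "nat \<Rightarrow> nat \<Rightarrow> 'k::field mat list set" where
  "mat_tuples r d = {A. length A = r \<and> set A \<subseteq> carrier_mat d d}"

definition zero_locus ::
    "nat \<Rightarrow> nat \<Rightarrow> ('k::field mat list \<Rightarrow> 'k) set \<Rightarrow> 'k mat list set" where
  "zero_locus r d F = {A \<in> mat_tuples r d. \<forall>f\<in>F. f A = 0}"

definition zariski :: "nat \<Rightarrow> nat \<Rightarrow> 'k::field mat list topology" where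
  "zariski r d = topology (\<lambda>U. \<exists>F \<subseteq> poly_fun r d. U = mat_tuples r d - zero_locus r d F)"

definition Rep_zariski :: "nat \<Rightarrow> nat \<Rightarrow> 'k::field mat list topology" where
  "Rep_zariski r d = subtopology (zariski r d) (Rep r d)"

definition irreducible_in :: "'a topology \<Rightarrow> 'a set \<Rightarrow> bool" where
  "irreducible_in X C \<longleftrightarrow> C \<subseteq> topspace X \<and> C \<noteq> {} \<and>
     (\<forall>F G. closedin X F \<and> closedin X G \<and> C \<subseteq> F \<union> G \<longrightarrow> C \<subseteq> F \<or> C \<subseteq> G)"

definition irreducible_component :: "'a topology \<Rightarrow> 'a set \<Rightarrow> bool" where
  "irreducible_component X C \<longleftrightarrow> irreducible_in X C \<and>
     (\<forall>D. irreducible_in X D \<and> C \<subseteq> D \<longrightarrow> D = C)"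

definition generically :: "'a topology \<Rightarrow> 'a set \<Rightarrow> ('a \<Rightarrow> bool) \<Rightarrow> bool" where
  "generically X C P \<longleftrightarrow> (\<exists>U. openin (subtopology X C) U \<and>
     (subtopology X C) closure_of U = C \<and> (\<forall>x\<in>U. P x))"

lemma istopology_zariski:
  "istopology (\<lambda>U. \<exists>F \<subseteq> poly_fun r d. U = mat_tuples r d - zero_locus r d F)"
  unfolding istopology_def
proof (intro conjI allI impI)
  fix S T :: "'k::field mat list set"
  assume "\<exists>F \<subseteq> poly_fun r d. S = mat_tuples r d - zero_locus r d F"
    and "\<exists>F \<subseteq> poly_fun r d. T = mat_tuples r d - zero_locus r d F"
  then obtain F G where F: "F \<subseteq> poly_fun r d" "S = mat_tuples r d - zero_locus r d F"
    and G: "G \<subseteq> poly_fun r d" "T = mat_tuples r d - zero_locus r d G" by blast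
  let ?H = "{(\<lambda>A. f A * g A) |f g. f \<in> F \<and> g \<in> G}"
  have "?H \<subseteq> poly_fun r d" using F(1) G(1) by (auto intro: poly_fun.mult)
  moreover have "S \<inter> T = mat_tuples r d - zero_locus r d ?H"
  proof (intro equalityI subsetI)
    fix A assume "A \<in> S \<inter> T"
    then obtain f g where "f \<in> F" "g \<in> G" "f A \<noteq> 0" "g A \<noteq> 0" and A: "A \<in> mat_tuples r d"
      unfolding F(2) G(2) zero_locus_def by auto
    then have fg: "(\<lambda>A. f A * g A) \<in> ?H" "f A * g A \<noteq> 0" by auto
    have "A \<notin> zero_locus r d ?H"
    proof
      assume "A \<in> zero_locus r d ?H"
      then have "\<forall>h\<in>?H. h A = 0" unfolding zero_locus_def by simp
      from bspec[OF this fg(1)] fg(2) show False by simp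
    qed
    with A show "A \<in> mat_tuples r d - zero_locus r d ?H" by (rule DiffI)
  next
    fix A assume A: "A \<in> mat_tuples r d - zero_locus r d ?H"
    then have "\<not> (\<forall>h\<in>?H. h A = 0)" unfolding zero_locus_def by simp
    then obtain f g where fg: "f \<in> F" "g \<in> G" "f A * g A \<noteq> 0" by auto
    then have "A \<notin> zero_locus r d F" "A \<notin> zero_locus r d G" unfolding zero_locus_def by auto
    then show "A \<in> S \<inter> T" using A unfolding F(2) G(2) by blast
  qed
  ultimately show "\<exists>F \<subseteq> poly_fun r d. S \<inter> T = mat_tuples r d - zero_locus r d F" by blast
next
  fix \<K> :: "'k::field mat list set set"
  assume "\<forall>K\<in>\<K>. \<exists>F \<subseteq> poly_fun r d. K = mat_tuples r d - zero_locus r d F"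
  then obtain F where F: "\<And>K. K \<in> \<K> \<Longrightarrow> F K \<subseteq> poly_fun r d \<and> K = mat_tuples r d - zero_locus r d (F K)"
    by metis
  let ?H = "\<Union>(F ` \<K>)"
  have "?H \<subseteq> poly_fun r d" using F by blast
  moreover have "\<Union>\<K> = mat_tuples r d - zero_locus r d ?H"
  proof (intro equalityI subsetI)
    fix A assume "A \<in> \<Union>\<K>"
    then obtain K where "K \<in> \<K>" "A \<in> K" by blast
    with F[of K] show "A \<in> mat_tuples r d - zero_locus r d ?H"
      unfolding zero_locus_def by blast
  next
    fix A assume "A \<in> mat_tuples r d - zero_locus r d ?H"
    then obtain K f where K: "K \<in> \<K>" "f \<in> F K" "f A \<noteq> 0" "A \<in> mat_tuples r d"
      unfolding zero_locus_def by blast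
    then have "A \<in> mat_tuples r d - zero_locus r d (F K)" unfolding zero_locus_def by blast
    with F[OF K(1)] K(1) show "A \<in> \<Union>\<K>" by blast
  qed
  ultimately show "\<exists>F \<subseteq> poly_fun r d. \<Union>\<K> = mat_tuples r d - zero_locus r d F" by blast
qed

lemma openin_zariski:
  "openin (zariski r d) U \<longleftrightarrow> (\<exists>F \<subseteq> poly_fun r d. U = mat_tuples r d - zero_locus r d F)"
  unfolding zariski_def by (simp add: topology_inverse'[OF istopology_zariski])

lemma topspace_zariski: "topspace (zariski r d) = mat_tuples r d"
proof -
  have "openin (zariski r d) (mat_tuples r d)"
    unfolding openin_zariski
    by (rule exI[of _ "{\<lambda>A. 1}"]) (auto simp: zero_locus_def intro: poly_fun.const)
  moreover have "U \<subseteq> mat_tuples r d" if "openin (zariski r d) U" for U :: "'a mat list set"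
    using that unfolding openin_zariski by blast
  ultimately show ?thesis
    by (intro equalityI openin_subset) (simp_all add: openin_topspace)
qed

lemma closedin_zariski:
  "closedin (zariski r d) C \<longleftrightarrow> (\<exists>F \<subseteq> poly_fun r d. C = zero_locus r d F)"
proof -
  have "zero_locus r d F \<subseteq> mat_tuples r d" for F :: "('k::field mat list \<Rightarrow> 'k) set"
    unfolding zero_locus_def by blast
  then have "C \<subseteq> mat_tuples r d \<and> mat_tuples r d - C = mat_tuples r d - zero_locus r d F \<longleftrightarrow>
      C = zero_locus r d F" for F
    by (metis Diff_Diff_Int Diff_subset inf.absorb_iff2)
  then show ?thesis
    unfolding closedin_def topspace_zariski openin_zariski by metis
qed

lemma topspace_Rep_zariski: "topspace (Rep_zariski r d) = Rep r d"
  unfolding Rep_zariski_def topspace_subtopology topspace_zariski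
  by (auto simp: Rep_def mat_tuples_def)

lemma least_u_eq_ceiling:
  "(LEAST u. int r * int u \<ge> int d - int u) = nat \<lceil>real d / real (r + 1)\<rceil>"
proof -
  have "(int r * int u \<ge> int d - int u) \<longleftrightarrow> nat \<lceil>real d / real (r + 1)\<rceil> \<le> u" for u
  proof -
    have "int r * int u + int u = int (u * (r + 1))" by (simp add: algebra_simps)
    then have "(int r * int u \<ge> int d - int u) \<longleftrightarrow> d \<le> u * (r + 1)" by linarith
    also have "\<dots> \<longleftrightarrow> real d \<le> real u * real (r + 1)"
      by (metis of_nat_le_iff of_nat_mult)
    also have "\<dots> \<longleftrightarrow> real d / real (r + 1) \<le> real u"
      by (subst pos_divide_le_eq) auto
    also have "\<dots> \<longleftrightarrow> nat \<lceil>real d / real (r + 1)\<rceil> \<le> u"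
      by (simp add: ceiling_le_iff nat_le_iff)
    finally show ?thesis .
  qed
  then show ?thesis by (simp add: Least_equality)
qed

lemma path_algebra_simps:
  "f \<in> carrier (path_algebra r) \<longleftrightarrow>
     finite {w. f w \<noteq> 0} \<and> (\<forall>w. f w \<noteq> 0 \<longrightarrow> set w \<subseteq> {..<r})"
  "f \<otimes>\<^bsub>path_algebra r\<^esub> g = (\<lambda>w. \<Sum>k\<le>length w. f (take k w) * g (drop k w))"
  "\<one>\<^bsub>path_algebra r\<^esub> = (\<lambda>w. if w = [] then 1 else 0)"
  "\<zero>\<^bsub>path_algebra r\<^esub> = (\<lambda>w. 0)"
  "f \<oplus>\<^bsub>path_algebra r\<^esub> g = (\<lambda>w. f w + g w)"
  by (simp_all add: path_algebra_def)

lemma path_algebra_mult_closed: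
  assumes "f \<in> carrier (path_algebra r)" "g \<in> carrier (path_algebra r)"
  shows "f \<otimes>\<^bsub>path_algebra r\<^esub> g \<in> carrier (path_algebra r)"
proof -
  let ?p = "\<lambda>w. \<Sum>k\<le>length w. f (take k w) * g (drop k w)"
  have split: "\<exists>u v. w = u @ v \<and> f u \<noteq> 0 \<and> g v \<noteq> 0" if "?p w \<noteq> 0" for w
  proof -
    from that obtain k where "f (take k w) * g (drop k w) \<noteq> 0"
      by (meson sum.not_neutral_contains_not_neutral)
    then show ?thesis by (intro exI[of _ "take k w"] exI[of _ "drop k w"]) auto
  qed
  have "{w. ?p w \<noteq> 0} \<subseteq> (\<lambda>(u, v). u @ v) ` ({u. f u \<noteq> 0} \<times> {v. g v \<noteq> 0})"
    using split by (force simp: image_iff)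
  then have "finite {w. ?p w \<noteq> 0}"
    by (rule finite_subset) (use assms in \<open>auto simp: path_algebra_simps\<close>)
  moreover have "set w \<subseteq> {..<r}" if "?p w \<noteq> 0" for w
  proof -
    obtain u v where "w = u @ v" "f u \<noteq> 0" "g v \<noteq> 0" using split \<open>?p w \<noteq> 0\<close> by blast
    moreover from this have "set u \<subseteq> {..<r}" "set v \<subseteq> {..<r}"
      using assms unfolding path_algebra_simps by blast+
    ultimately show ?thesis by simp
  qed
  ultimately show ?thesis unfolding path_algebra_simps by blast
qed

lemma triangle_sum:
  fixes F :: "nat \<Rightarrow> nat \<Rightarrow> 'a::comm_monoid_add"
  shows "(\<Sum>k\<le>n. \<Sum>j\<le>k. F j k) = (\<Sum>j\<le>n. \<Sum>m\<le>n - j. F j (j + m))"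
proof -
  have "(\<Sum>k\<le>n. \<Sum>j\<le>k. F j k) = (\<Sum>(k, j)\<in>(SIGMA k:{..n}. {..k}). F j k)"
    by (rule sum.Sigma) auto
  also have "\<dots> = (\<Sum>(j, m)\<in>(SIGMA j:{..n}. {..n - j}). F j (j + m))"
    by (rule sum.reindex_bij_witness[of _ "\<lambda>(j, m). (j + m, j)" "\<lambda>(k, j). (j, k - j)"]) auto
  also have "\<dots> = (\<Sum>j\<le>n. \<Sum>m\<le>n - j. F j (j + m))"
    by (rule sum.Sigma[symmetric]) auto
  finally show ?thesis .
qed

lemma path_algebra_mult_assoc:
  "(f \<otimes>\<^bsub>path_algebra r\<^esub> g) \<otimes>\<^bsub>path_algebra r\<^esub> h = f \<otimes>\<^bsub>path_algebra r\<^esub> (g \<otimes>\<^bsub>path_algebra r\<^esub> h)"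
proof
  fix w :: "nat list"
  let ?n = "length w"
  have "((f \<otimes>\<^bsub>path_algebra r\<^esub> g) \<otimes>\<^bsub>path_algebra r\<^esub> h) w =
      (\<Sum>k\<le>?n. \<Sum>j\<le>k. f (take j w) * g (drop j (take k w)) * h (drop k w))"
    unfolding path_algebra_simps
    by (intro sum.cong refl) (auto simp: sum_distrib_right min_def intro!: sum.cong)
  also have "\<dots> = (\<Sum>j\<le>?n. \<Sum>m\<le>?n - j.
      f (take j w) * g (drop j (take (j + m) w)) * h (drop (j + m) w))"
    by (rule triangle_sum)
  also have "\<dots> = (f \<otimes>\<^bsub>path_algebra r\<^esub> (g \<otimes>\<^bsub>path_algebra r\<^esub> h)) w"
    unfolding path_algebra_simps
    by (intro sum.cong refl)
       (auto simp: sum_distrib_left mult.assoc drop_take add.commute intro!: sum.cong)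
  finally show "((f \<otimes>\<^bsub>path_algebra r\<^esub> g) \<otimes>\<^bsub>path_algebra r\<^esub> h) w =
      (f \<otimes>\<^bsub>path_algebra r\<^esub> (g \<otimes>\<^bsub>path_algebra r\<^esub> h)) w" .
qed

lemma path_algebra_ring: "ring (path_algebra r :: (nat list \<Rightarrow> 'k::field) ring)"
proof (rule ringI)
  let ?R = "path_algebra r :: (nat list \<Rightarrow> 'k) ring"
  have add_closed: "f \<oplus>\<^bsub>?R\<^esub> g \<in> carrier ?R" if "f \<in> carrier ?R" "g \<in> carrier ?R" for f g
  proof -
    have "{w. f w + g w \<noteq> 0} \<subseteq> {w. f w \<noteq> 0} \<union> {w. g w \<noteq> 0}" by auto
    then have "finite {w. f w + g w \<noteq> 0}"
      by (rule finite_subset) (use that in \<open>auto simp: path_algebra_simps\<close>)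
    moreover have "set w \<subseteq> {..<r}" if "f w + g w \<noteq> 0" for w
      using that \<open>f \<in> carrier ?R\<close> \<open>g \<in> carrier ?R\<close> unfolding path_algebra_simps
      by (metis add.right_neutral)
    ultimately show ?thesis unfolding path_algebra_simps by blast
  qed
  show "abelian_group ?R"
  proof (rule abelian_groupI)
    fix f assume f: "f \<in> carrier ?R"
    show "\<exists>g\<in>carrier ?R. g \<oplus>\<^bsub>?R\<^esub> f = \<zero>\<^bsub>?R\<^esub>"
      by (rule bexI[of _ "\<lambda>w. - f w"]) (use f in \<open>auto simp: path_algebra_simps\<close>)
  qed (use add_closed in \<open>auto simp: path_algebra_simps(3-) algebra_simps\<close>,
       auto simp: path_algebra_simps)
  show "Group.monoid ?R"
  proof (rule monoidI)
    fix f assume f: "f \<in> carrier ?R"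
    have "(\<one>\<^bsub>?R\<^esub> \<otimes>\<^bsub>?R\<^esub> f) w = f w" for w
      unfolding path_algebra_simps
      by (subst sum.mono_neutral_right[of _ "{0}"]) (auto split: if_splits)
    then show "\<one>\<^bsub>?R\<^esub> \<otimes>\<^bsub>?R\<^esub> f = f" by blast
    have "(f \<otimes>\<^bsub>?R\<^esub> \<one>\<^bsub>?R\<^esub>) w = f w" for w
      unfolding path_algebra_simps
      by (subst sum.mono_neutral_right[of _ "{length w}"]) (auto split: if_splits)
    then show "f \<otimes>\<^bsub>?R\<^esub> \<one>\<^bsub>?R\<^esub> = f" by blast
  next
    show "\<one>\<^bsub>?R\<^esub> \<in> carrier ?R" by (auto simp: path_algebra_simps)
  qed (simp_all only: path_algebra_mult_closed path_algebra_mult_assoc)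
qed (simp_all add: path_algebra_simps(2,5) sum.distrib distrib_left distrib_right)

lemma path_elem_closed: "set w \<subseteq> {..<r} \<Longrightarrow> path_elem w \<in> carrier (path_algebra r)"
  unfolding path_algebra_simps path_elem_def by auto

lemma rel_ideal_ideal: "ideal (rel_ideal r) (path_algebra r :: (nat list \<Rightarrow> 'k::field) ring)"
  unfolding rel_ideal_def
  by (rule ring.genideal_ideal[OF path_algebra_ring]) (use path_elem_closed in blast)

lemma path_elem_mult:
  "(\<lambda>v. if v = w then c else 0) \<otimes>\<^bsub>path_algebra r\<^esub> path_elem w' =
     (\<lambda>v. if v = w @ w' then (c::'k::field) else 0)"
  "path_elem w' \<otimes>\<^bsub>path_algebra r\<^esub> (\<lambda>v. if v = w then c else 0) =
     (\<lambda>v. if v = w' @ w then c else 0)"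
proof -
  have split: "take k v = u \<and> drop k v = u' \<longleftrightarrow> k = length u \<and> v = u @ u'"
    if "k \<le> length v" for k and u u' v :: "nat list"
    using that by auto
  have "(\<Sum>k\<le>length v. (if take k v = w then c else 0) * path_elem w' (drop k v)) =
      (\<Sum>k\<le>length v. if k = length w then if v = w @ w' then c else 0 else 0)"
    (is "(\<Sum>k\<le>_. ?F k v) = (\<Sum>k\<le>_. ?G k v)") for v
  proof (rule sum.cong[OF refl])
    fix k assume "k \<in> {..length v}"
    then have k: "k \<le> length v" by simp
    have "?F k v = (if take k v = w \<and> drop k v = w' then c else 0)"
      by (simp add: path_elem_def)
    also have "\<dots> = ?G k v" unfolding split[OF k] by simp
    finally show "?F k v = ?G k v" .
  qed
  then show "(\<lambda>v. if v = w then c else 0) \<otimes>\<^bsub>path_algebra r\<^esub> path_elem w' =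
     (\<lambda>v. if v = w @ w' then c else 0)"
    unfolding path_algebra_simps by (simp add: fun_eq_iff)
  have "(\<Sum>k\<le>length v. path_elem w' (take k v) * (if drop k v = w then c else 0)) =
      (\<Sum>k\<le>length v. if k = length w' then if v = w' @ w then c else 0 else 0)"
    (is "(\<Sum>k\<le>_. ?F k v) = (\<Sum>k\<le>_. ?G k v)") for v
  proof (rule sum.cong[OF refl])
    fix k assume "k \<in> {..length v}"
    then have k: "k \<le> length v" by simp
    have "?F k v = (if take k v = w' \<and> drop k v = w then c else 0)"
      by (simp add: path_elem_def)
    also have "\<dots> = ?G k v" unfolding split[OF k] by simp
    finally show "?F k v = ?G k v" .
  qed
  then show "path_elem w' \<otimes>\<^bsub>path_algebra r\<^esub> (\<lambda>v. if v = w then c else 0) =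
     (\<lambda>v. if v = w' @ w then c else 0)"
    unfolding path_algebra_simps by (simp add: fun_eq_iff)
qed

lemma rel_ideal_eq:
  "rel_ideal r = {f \<in> carrier (path_algebra r). \<forall>w. length w \<le> 1 \<longrightarrow> f w = (0::'k::field)}"
    (is "?I = ?L")
proof
  let ?R = "path_algebra r :: (nat list \<Rightarrow> 'k) ring"
  interpret R: ring ?R by (rule path_algebra_ring)
  interpret I: ideal ?I ?R by (rule rel_ideal_ideal)
  have minus: "(\<ominus>\<^bsub>?R\<^esub> f) = (\<lambda>w. - f w)" if "f \<in> carrier ?R" for f
    by (rule R.minus_equality) (use that in \<open>auto simp: path_algebra_simps\<close>)
  have "ideal ?L ?R"
  proof (rule idealI[OF path_algebra_ring])
    show "subgroup ?L (add_monoid ?R)"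
    proof (rule group.subgroupI)
      show "group (add_monoid ?R)" by (rule R.add.is_group)
      show "?L \<noteq> {}"
        using R.zero_closed by (auto simp: path_algebra_simps(4) intro!: exI[of _ "\<lambda>w. 0"])
      fix f g assume f: "f \<in> ?L" and g: "g \<in> ?L"
      show "inv\<^bsub>add_monoid ?R\<^esub> f \<in> ?L"
        using f minus[of f] R.a_inv_closed[of f] by (auto simp: a_inv_def)
      show "f \<otimes>\<^bsub>add_monoid ?R\<^esub> g \<in> ?L"
        using f g R.a_closed[of f g] by (auto simp: path_algebra_simps(5))
    qed auto
    fix f g assume f: "f \<in> ?L" and g: "g \<in> carrier ?R"
    have le: "length w \<le> 1 \<Longrightarrow> length (take k w) \<le> 1 \<and> length (drop k w) \<le> 1"
      for k and w :: "nat list" by auto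
    show "g \<otimes>\<^bsub>?R\<^esub> f \<in> ?L"
      using f g R.m_closed[of g f] le by (auto simp: path_algebra_simps(2))
    show "f \<otimes>\<^bsub>?R\<^esub> g \<in> ?L"
      using f g R.m_closed[of f g] le by (auto simp: path_algebra_simps(2))
  qed
  moreover have "{path_elem w |w. length w = 2 \<and> set w \<subseteq> {..<r}} \<subseteq> ?L"
    by (auto simp: path_algebra_simps path_elem_def split: if_splits)
  ultimately show "?I \<subseteq> ?L" unfolding rel_ideal_def by (rule R.genideal_minimal)
  have gen: "path_elem w \<in> ?I" if "length w = 2" "set w \<subseteq> {..<r}" for w
    unfolding rel_ideal_def
    by (rule subsetD[OF R.genideal_self]) (use that in \<open>auto simp: path_algebra_simps path_elem_def\<close>)
  have monom: "(\<lambda>v. if v = w then c else 0) \<in> ?I" if "length w \<ge> 2" "set w \<subseteq> {..<r}" for w c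
  proof -
    have "set (drop 2 w) \<subseteq> {..<r}" "set (take 2 w) \<subseteq> {..<r}"
      using that(2) set_drop_subset set_take_subset by fast+
    then have "path_elem (take 2 w) \<otimes>\<^bsub>?R\<^esub> (\<lambda>v. if v = drop 2 w then c else 0) \<in> ?I"
      by (intro I.I_r_closed gen) (use that(1) in \<open>auto simp: path_algebra_simps\<close>)
    then show ?thesis by (simp add: path_elem_mult)
  qed
  have "f \<in> ?I" if "f \<in> ?L" for f
    using that
  proof (induction "card {w. f w \<noteq> 0}" arbitrary: f rule: less_induct)
    case less
    show ?case
    proof (cases "f = (\<lambda>w. 0)")
      case True
      then show ?thesis using I.zero_closed by (simp add: path_algebra_simps(4))
    next
      case False
      then obtain w where w: "f w \<noteq> 0" by blast
      let ?m = "\<lambda>v. if v = w then f w else 0"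
      let ?g = "\<lambda>v. if v = w then 0 else f v"
      have fin: "finite {w. f w \<noteq> 0}" using less.prems by (simp add: path_algebra_simps)
      have sub: "{v. ?g v \<noteq> 0} \<subset> {v. f v \<noteq> 0}" using w by auto
      have "?g \<in> ?L"
        using less.prems finite_subset[OF psubset_imp_subset[OF sub] fin]
        by (auto simp: path_algebra_simps)
      then have g: "?g \<in> ?I" by (rule less.hyps[OF psubset_card_mono[OF fin sub]])
      have "\<not> length w \<le> 1" using w less.prems by blast
      then have m: "?m \<in> ?I"
        by (intro monom) (use w less.prems in \<open>auto simp: path_algebra_simps\<close>)
      have "f = ?m \<oplus>\<^bsub>?R\<^esub> ?g" by (auto simp: path_algebra_simps)
      then show ?thesis using I.a_closed[OF m g] by simp
    qed
  qed
  then show "?L \<subseteq> ?I" by blast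
qed

lemma Lambda_alg_cring: "cring (Lambda_alg r :: (nat list \<Rightarrow> 'k::field) set ring)"
proof -
  let ?R = "path_algebra r :: (nat list \<Rightarrow> 'k) ring"
  interpret R: ring ?R by (rule path_algebra_ring)
  interpret I: ideal "rel_ideal r" ?R by (rule rel_ideal_ideal)
  interpret Q: ring "?R Quot rel_ideal r" by (rule I.quotient_is_ring)
  have comm: "rel_ideal r +>\<^bsub>?R\<^esub> (f \<otimes>\<^bsub>?R\<^esub> g) = rel_ideal r +>\<^bsub>?R\<^esub> (g \<otimes>\<^bsub>?R\<^esub> f)"
    if "f \<in> carrier ?R" "g \<in> carrier ?R" for f g
  proof -
    have eq: "(f \<otimes>\<^bsub>?R\<^esub> g) w = (g \<otimes>\<^bsub>?R\<^esub> f) w" if "length w \<le> 1" for w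
    proof (cases w)
      case (Cons i w')
      with that have "w = [i]" by simp
      then show ?thesis by (simp add: path_algebra_simps algebra_simps)
    qed (simp add: path_algebra_simps algebra_simps)
    let ?d = "(f \<otimes>\<^bsub>?R\<^esub> g) \<ominus>\<^bsub>?R\<^esub> (g \<otimes>\<^bsub>?R\<^esub> f)"
    have c: "f \<otimes>\<^bsub>?R\<^esub> g \<in> carrier ?R" "g \<otimes>\<^bsub>?R\<^esub> f \<in> carrier ?R" using that by auto
    have "?d \<oplus>\<^bsub>?R\<^esub> (g \<otimes>\<^bsub>?R\<^esub> f) = f \<otimes>\<^bsub>?R\<^esub> g"
      using c by (simp add: R.minus_eq R.a_assoc R.l_neg)
    then have "?d w + (g \<otimes>\<^bsub>?R\<^esub> f) w = (f \<otimes>\<^bsub>?R\<^esub> g) w" for w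
      by (simp add: path_algebra_simps(5) fun_eq_iff)
    then have "?d w = 0" if "length w \<le> 1" for w
      using eq[OF that] by (metis add_cancel_left_left)
    then have "?d \<in> rel_ideal r" unfolding rel_ideal_eq using c by auto
    then show ?thesis
      using R.quotient_eq_iff_same_a_r_cos[OF rel_ideal_ideal c] by simp
  qed
  show ?thesis unfolding Lambda_alg_def
  proof (rule cringI[OF Q.is_abelian_group _ Q.l_distr])
    show "comm_monoid (?R Quot rel_ideal r)"
      by (rule Q.monoid_comm_monoidI)
         (auto simp: FactRing_def A_RCOSETS_def' I.rcoset_mult_add comm)
  qed auto
qed

lemma mult_mat_vec_entry:
  assumes "B \<in> carrier_mat d d" "v \<in> carrier_vec d" "k < d"
  shows "(B *\<^sub>v v) $ k = (\<Sum>l<d. B $$ (k, l) * v $ l)"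
proof -
  have "(B *\<^sub>v v) $ k = (\<Sum>l = 0..<d. row B k $ l * v $ l)"
    using assms by (simp add: scalar_prod_def)
  also have "\<dots> = (\<Sum>l<d. B $$ (k, l) * v $ l)"
    using assms by (intro sum.cong) auto
  finally show ?thesis .
qed

lemma Rep_D:
  assumes "A \<in> Rep r d" "i < r"
  shows "A ! i \<in> carrier_mat d d"
  using assms unfolding Rep_def by (auto simp: set_conv_nth)

lemma path_act_closed:
  assumes "A \<in> Rep r d" "set w \<subseteq> {..<r}" "v \<in> carrier_vec d"
  shows "path_act A w v \<in> carrier_vec d"
  using assms(2)
proof (induction w)
  case (Cons i w)
  then have "path_act A w v \<in> carrier_vec d" "i < r" by auto
  then show ?case
    using Rep_D[OF assms(1), of i] unfolding path_act_def by simp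
qed (use assms in \<open>simp add: path_act_def\<close>)

lemma Rep_mult_zero:
  assumes "A \<in> Rep r d" "i < r" "j < r" "v \<in> carrier_vec d"
  shows "A ! i *\<^sub>v (A ! j *\<^sub>v v) = 0\<^sub>v d"
proof -
  have "A ! i *\<^sub>v (A ! j *\<^sub>v v) = (A ! i * A ! j) *\<^sub>v v"
    using Rep_D[OF assms(1)] assms(2-4) by (metis assoc_mult_mat_vec)
  also have "A ! i * A ! j = 0\<^sub>m d d" using assms unfolding Rep_def by blast
  finally show ?thesis using assms(4) by (intro eq_vecI) auto
qed

lemma path_act_long:
  assumes "A \<in> Rep r d" "set w \<subseteq> {..<r}" "v \<in> carrier_vec d" "length w \<ge> 2"
  shows "path_act A w v = 0\<^sub>v d"
proof -
  from assms(4) obtain i j w' where w: "w = i # j # w'"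
    by (metis One_nat_def Suc_1 Suc_le_length_iff)
  then show ?thesis
    using Rep_mult_zero[OF assms(1) _ _ path_act_closed[OF assms(1) _ assms(3)], of i j w'] assms(2)
    by (simp add: path_act_def)
qed

lemma path_algebra_act_eq:
  assumes "A \<in> Rep r d" "f \<in> carrier (path_algebra r)" "v \<in> carrier_vec d"
  shows "path_algebra_act d A f v =
    vec d (\<lambda>k. f [] * v $ k + (\<Sum>i<r. f [i] * (A ! i *\<^sub>v v) $ k))"
proof (rule eq_vecI)
  fix k assume "k < dim_vec (vec d (\<lambda>k. f [] * v $ k + (\<Sum>i<r. f [i] * (A ! i *\<^sub>v v) $ k)))"
  then have k: "k < d" by simp
  let ?F = "\<lambda>w. f w * path_act A w v $ k"
  let ?W = "insert [] ((\<lambda>i. [i]) ` {..<r})"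
  have supp: "finite {w. f w \<noteq> 0}" "\<And>w. f w \<noteq> 0 \<Longrightarrow> set w \<subseteq> {..<r}"
    using assms(2) by (auto simp: path_algebra_simps)
  have "?F w = 0" if "w \<notin> ?W" for w
  proof (cases "f w = 0")
    case False
    have "length w \<ge> 2"
    proof (rule ccontr)
      assume "\<not> 2 \<le> length w"
      then consider "w = []" | i where "w = [i]"
        by (cases w rule: remdups_adj.cases) auto
      then show False using that supp(2)[OF False] by cases auto
    qed
    then show ?thesis
      using path_act_long[OF assms(1) supp(2)[OF False] assms(3)] k by simp
  qed simp
  then have "sum ?F {w. f w \<noteq> 0} = sum ?F ?W"
    by (intro sum.mono_neutral_cong supp) auto
  also have "\<dots> = f [] * v $ k + (\<Sum>i<r. f [i] * (A ! i *\<^sub>v v) $ k)"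
    by (subst sum.insert, simp, force) (simp add: sum.reindex inj_on_def path_act_def)
  finally show "path_algebra_act d A f v $ k =
      vec d (\<lambda>k. f [] * v $ k + (\<Sum>i<r. f [i] * (A ! i *\<^sub>v v) $ k)) $ k"
    using k by (simp add: path_algebra_act_def)
qed (simp add: path_algebra_act_def)

lemma rep_module_smult:
  fixes A :: "'k::field mat list"
  assumes "A \<in> Rep r d" "f \<in> carrier (path_algebra r)" "v \<in> carrier_vec d"
  shows "(rel_ideal r +>\<^bsub>path_algebra r\<^esub> f) \<odot>\<^bsub>rep_module d A\<^esub> v = path_algebra_act d A f v"
proof -
  let ?R = "path_algebra r :: (nat list \<Rightarrow> 'k) ring"
  let ?X = "rel_ideal r +>\<^bsub>?R\<^esub> f"
  interpret R: ring ?R by (rule path_algebra_ring)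
  interpret I: ideal "rel_ideal r" ?R by (rule rel_ideal_ideal)
  define g where "g = (SOME g. g \<in> ?X)"
  have "g \<in> ?X"
    unfolding g_def by (rule someI[of "\<lambda>g. g \<in> ?X"]) (rule I.a_rcos_self[OF assms(2)])
  then obtain h where h: "h \<in> rel_ideal r" "g = h \<oplus>\<^bsub>?R\<^esub> f"
    unfolding a_r_coset_def' by blast
  have h0: "h \<in> carrier ?R" "\<And>w. length w \<le> 1 \<Longrightarrow> h w = 0"
    using h(1) unfolding rel_ideal_eq by blast+
  have "g w = h w + f w" for w unfolding h(2) path_algebra_simps ..
  then have g1: "g [] = f []" "g [i] = f [i]" for i using h0(2) by simp_all
  have g: "g \<in> carrier ?R" unfolding h(2) by (rule R.a_closed[OF h0(1) assms(2)])
  have "path_algebra_act d A g v = path_algebra_act d A f v"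
    unfolding path_algebra_act_eq[OF assms(1) g assms(3)] path_algebra_act_eq[OF assms] g1 ..
  then show ?thesis by (simp add: rep_module_def g_def)
qed

lemma rep_module_module:
  fixes A :: "'k::field mat list"
  assumes A: "A \<in> Rep r d"
  shows "module (Lambda_alg r) (rep_module d A)"
proof -
  let ?R = "path_algebra r :: (nat list \<Rightarrow> 'k) ring"
  let ?M = "rep_module d A"
  interpret R: ring ?R by (rule path_algebra_ring)
  interpret I: ideal "rel_ideal r" ?R by (rule rel_ideal_ideal)
  note smult = rep_module_smult[OF A]
  note act = path_algebra_act_eq[OF A]
  have rep: "\<exists>f\<in>carrier ?R. X = rel_ideal r +>\<^bsub>?R\<^esub> f" if "X \<in> carrier (Lambda_alg r)" for X
    using that by (auto simp: Lambda_alg_def FactRing_def A_RCOSETS_def')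
  have sum_coset: "(rel_ideal r +>\<^bsub>?R\<^esub> f) \<oplus>\<^bsub>Lambda_alg r\<^esub> (rel_ideal r +>\<^bsub>?R\<^esub> g) =
      rel_ideal r +>\<^bsub>?R\<^esub> (f \<oplus>\<^bsub>?R\<^esub> g)" if "f \<in> carrier ?R" "g \<in> carrier ?R" for f g
    using that by (simp add: Lambda_alg_def FactRing_def I.a_rcos_sum)
  have mult_coset: "(rel_ideal r +>\<^bsub>?R\<^esub> f) \<otimes>\<^bsub>Lambda_alg r\<^esub> (rel_ideal r +>\<^bsub>?R\<^esub> g) =
      rel_ideal r +>\<^bsub>?R\<^esub> (f \<otimes>\<^bsub>?R\<^esub> g)" if "f \<in> carrier ?R" "g \<in> carrier ?R" for f g
    using that by (simp add: Lambda_alg_def FactRing_def I.rcoset_mult_add)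
  have carr: "carrier ?M = carrier_vec d" and plus: "x \<oplus>\<^bsub>?M\<^esub> y = x + y" for x y
    by (simp_all add: rep_module_def)
  have act_closed: "path_algebra_act d A f v \<in> carrier_vec d" for f v
    by (simp add: path_algebra_act_def)
  have entry: "(A ! i *\<^sub>v v) $ k = (\<Sum>l<d. A ! i $$ (k, l) * v $ l)"
    if "i < r" "v \<in> carrier_vec d" "k < d" for i v k
    using mult_mat_vec_entry[OF Rep_D[OF A that(1)] that(2,3)] .
  show ?thesis
  proof (rule moduleI[OF Lambda_alg_cring])
    show "abelian_group ?M"
    proof (rule abelian_groupI)
      fix x assume "x \<in> carrier ?M"
      then show "\<exists>y\<in>carrier ?M. y \<oplus>\<^bsub>?M\<^esub> x = \<zero>\<^bsub>?M\<^esub>"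
        by (intro bexI[of _ "- x"]) (auto simp: rep_module_def)
    qed (auto simp: rep_module_def comm_add_vec[of _ d] assoc_add_vec[of _ d])
  next
    fix X :: "(nat list \<Rightarrow> 'k) set" and x assume "X \<in> carrier (Lambda_alg r)" "x \<in> carrier ?M"
    then show "X \<odot>\<^bsub>?M\<^esub> x \<in> carrier ?M" by (simp add: rep_module_def path_algebra_act_def)
  next
    fix X Y :: "(nat list \<Rightarrow> 'k) set" and x
    assume "X \<in> carrier (Lambda_alg r)" "Y \<in> carrier (Lambda_alg r)" and "x \<in> carrier ?M"
    then obtain f g where f: "f \<in> carrier ?R" "X = rel_ideal r +>\<^bsub>?R\<^esub> f"
      and g: "g \<in> carrier ?R" "Y = rel_ideal r +>\<^bsub>?R\<^esub> g" and x: "x \<in> carrier_vec d"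
      using rep carr by metis
    have "path_algebra_act d A (f \<oplus>\<^bsub>?R\<^esub> g) x = path_algebra_act d A f x + path_algebra_act d A g x"
      using f(1) g(1) x R.a_closed[OF f(1) g(1)]
      by (intro eq_vecI) (simp_all add: act path_algebra_simps(5) distrib_right sum.distrib)
    then show "(X \<oplus>\<^bsub>Lambda_alg r\<^esub> Y) \<odot>\<^bsub>?M\<^esub> x = X \<odot>\<^bsub>?M\<^esub> x \<oplus>\<^bsub>?M\<^esub> Y \<odot>\<^bsub>?M\<^esub> x"
      using f g x by (simp add: sum_coset smult plus)
  next
    fix X :: "(nat list \<Rightarrow> 'k) set" and x y
    assume "X \<in> carrier (Lambda_alg r)" "x \<in> carrier ?M" "y \<in> carrier ?M"
    then obtain f where f: "f \<in> carrier ?R" "X = rel_ideal r +>\<^bsub>?R\<^esub> f"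
      and x: "x \<in> carrier_vec d" and y: "y \<in> carrier_vec d"
      using rep carr by metis
    have "path_algebra_act d A f (x + y) = path_algebra_act d A f x + path_algebra_act d A f y"
    proof (rule eq_vecI)
      fix k assume "k < dim_vec (path_algebra_act d A f x + path_algebra_act d A f y)"
      then have k: "k < d" by (simp add: path_algebra_act_def)
      have "(A ! i *\<^sub>v (x + y)) $ k = (A ! i *\<^sub>v x) $ k + (A ! i *\<^sub>v y) $ k" if "i < r" for i
        using x y k that Rep_D[OF A that] by (simp add: mult_add_distrib_mat_vec)
      then show "path_algebra_act d A f (x + y) $ k =
          (path_algebra_act d A f x + path_algebra_act d A f y) $ k"
        using f(1) x y k by (simp add: act distrib_left sum.distrib)
    qed (simp add: path_algebra_act_def)
    then show "X \<odot>\<^bsub>?M\<^esub> (x \<oplus>\<^bsub>?M\<^esub> y) = X \<odot>\<^bsub>?M\<^esub> x \<oplus>\<^bsub>?M\<^esub> X \<odot>\<^bsub>?M\<^esub> y"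
      using f x y by (simp add: smult plus)
  next
    fix X Y :: "(nat list \<Rightarrow> 'k) set" and x
    assume "X \<in> carrier (Lambda_alg r)" "Y \<in> carrier (Lambda_alg r)" and "x \<in> carrier ?M"
    then obtain f g where f: "f \<in> carrier ?R" "X = rel_ideal r +>\<^bsub>?R\<^esub> f"
      and g: "g \<in> carrier ?R" "Y = rel_ideal r +>\<^bsub>?R\<^esub> g" and x: "x \<in> carrier_vec d"
      using rep carr by metis
    define y where "y = path_algebra_act d A g x"
    have y: "y \<in> carrier_vec d" by (simp add: y_def act_closed)
    have y_entry: "y $ k = g [] * x $ k + (\<Sum>j<r. g [j] * (A ! j *\<^sub>v x) $ k)" if "k < d" for k
      using that by (simp add: y_def act[OF g(1) x])
    have Ay: "(A ! i *\<^sub>v y) $ k = g [] * (A ! i *\<^sub>v x) $ k" if i: "i < r" and k: "k < d" for i k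
    proof -
      have z: "A ! j *\<^sub>v x \<in> carrier_vec d" if "j < r" for j
        using Rep_D[OF A that] x by simp
      have "(A ! i *\<^sub>v y) $ k =
          (\<Sum>l<d. A ! i $$ (k, l) * (g [] * x $ l + (\<Sum>j<r. g [j] * (A ! j *\<^sub>v x) $ l)))"
        unfolding entry[OF i y k] by (intro sum.cong refl) (simp add: y_entry)
      also have "\<dots> = g [] * (\<Sum>l<d. A ! i $$ (k, l) * x $ l) +
          (\<Sum>l<d. \<Sum>j<r. g [j] * (A ! i $$ (k, l) * (A ! j *\<^sub>v x) $ l))"
        by (simp add: distrib_left sum.distrib sum_distrib_left mult.left_commute)
      also have "(\<Sum>l<d. \<Sum>j<r. g [j] * (A ! i $$ (k, l) * (A ! j *\<^sub>v x) $ l)) =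
          (\<Sum>j<r. \<Sum>l<d. g [j] * (A ! i $$ (k, l) * (A ! j *\<^sub>v x) $ l))"
        by (rule sum.swap)
      also have "\<dots> = (\<Sum>j<r. g [j] * (A ! i *\<^sub>v (A ! j *\<^sub>v x)) $ k)"
        by (intro sum.cong refl) (simp add: entry[OF i z k] sum_distrib_left)
      also have "\<dots> = 0"
        by (intro sum.neutral ballI) (simp add: Rep_mult_zero[OF A i _ x] k)
      finally show ?thesis by (simp add: entry[OF i x k])
    qed
    have "path_algebra_act d A (f \<otimes>\<^bsub>?R\<^esub> g) x = path_algebra_act d A f y"
    proof (rule eq_vecI)
      fix k assume "k < dim_vec (path_algebra_act d A f y)"
      then have k: "k < d" by (simp add: path_algebra_act_def)
      have "path_algebra_act d A (f \<otimes>\<^bsub>?R\<^esub> g) x $ k =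
          f [] * g [] * x $ k + (\<Sum>i<r. (f [] * g [i] + f [i] * g []) * (A ! i *\<^sub>v x) $ k)"
        using k by (subst act[OF R.m_closed[OF f(1) g(1)] x]) (simp add: path_algebra_simps(2) add.commute)
      also have "\<dots> = f [] * (g [] * x $ k + (\<Sum>j<r. g [j] * (A ! j *\<^sub>v x) $ k)) +
          (\<Sum>i<r. f [i] * (g [] * (A ! i *\<^sub>v x) $ k))"
        by (simp add: distrib_left distrib_right sum.distrib sum_distrib_left mult.assoc)
      also have "\<dots> = path_algebra_act d A f y $ k"
        using k by (simp add: act[OF f(1) y] y_entry Ay)
      finally show "path_algebra_act d A (f \<otimes>\<^bsub>?R\<^esub> g) x $ k = path_algebra_act d A f y $ k" .
    qed (simp add: path_algebra_act_def)
    then show "(X \<otimes>\<^bsub>Lambda_alg r\<^esub> Y) \<odot>\<^bsub>?M\<^esub> x = X \<odot>\<^bsub>?M\<^esub> (Y \<odot>\<^bsub>?M\<^esub> x)"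
      using f g x y by (simp add: mult_coset smult y_def)
  next
    fix x assume "x \<in> carrier ?M"
    then have x: "x \<in> carrier_vec d" by (simp add: carr)
    have "\<one>\<^bsub>Lambda_alg r\<^esub> = rel_ideal r +>\<^bsub>?R\<^esub> \<one>\<^bsub>?R\<^esub>"
      by (simp add: Lambda_alg_def FactRing_def)
    moreover have "path_algebra_act d A \<one>\<^bsub>?R\<^esub> x = x"
      using x unfolding act[OF R.one_closed x] by (intro eq_vecI) (simp_all add: path_algebra_simps(3))
    ultimately show "\<one>\<^bsub>Lambda_alg r\<^esub> \<odot>\<^bsub>?M\<^esub> x = x"
      using x by (simp add: smult)
  qed
qed

end

theory Submission
  imports Defs "Jordan_Normal_Form.Determinant"
begin

text \<open>
  Write \<open>im A\<close> for the sum of the images of the \<open>A\<^sub>i\<close> (this is \<open>JM\<close>) and \<open>soc A\<close> for their common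
  kernel. Let \<open>Y\<^sub>m\<close> consist of those \<open>A\<close> for which some \<open>m\<close>-dimensional subspace \<open>W\<close> satisfies
  \<open>im A \<subseteq> W \<subseteq> soc A\<close>, that is, of the conjugates of strictly block upper triangular tuples. It is the
  image of an open part of an affine space under a polynomial map, hence irreducible. The modules
  with top \<open>S\<^sup>t\<close> lie in \<open>Y\<^sub>m\<close> for \<open>m = d - t\<close>, and for \<open>u \<le> t \<le> d - u\<close> they contain the nonempty open
  subset of \<open>Rep\<close> where \<open>im A = soc A\<close> has dimension \<open>m\<close>; there a simple summand \<open>N\<close> would
  lie in \<open>JM = JN'\<close>, inside its own complement \<open>N'\<close>. Since \<open>dim im \<le> m \<le> dim soc\<close> is a closed
  condition satisfied on \<open>Y\<^sub>m\<close>, the closures are pairwise incomparable. They cover \<open>Rep\<close> because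
  \<open>d - dim soc \<le> r dim soc\<close> and \<open>dim im \<le> r (d - dim im)\<close> leave room for a subspace \<open>W\<close> whose
  dimension lies between \<open>u\<close> and \<open>d - u\<close>.
\<close>

section \<open>Rank conditions\<close>

text \<open>Put V = K^d. Since im A lies in soc A, every \<open>A_i\<close> induces a map from V /
  soc to soc and one from V / im onto a part of im. Hence V / soc embeds into soc^r and (V / im)^r
  surjects onto im, which is the source of the two dimension inequalities. Both have the form d
  \<le> (r + 1) v, once for v = dim soc and once for v = d - dim im, and \<open>u\<close> is the
  least such v. Conversely, m \<le> r (d - m) and d - m \<le> r m are what r blocks of size m x (d -
  m) need in order to have rank m side by side and rank d - m when stacked; for m = d - t this is
  the range of \<open>t\<close>. Dimensions appear in two encodings. Ranks are bounded from below by
  non-vanishing determinants, so openness is immediate and a factorization through few coordinates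
  bounds them from above. Subspaces are preimages of coordinate subspaces under invertible matrices,
  so their dimension is the level of a flag. For irreducibility two parameters are joined by a line:
  two polynomials and det g, none of them zero on the line, are nonzero at a common point because K
  is infinite.\<close>

lemma det_mat_eq_0_left:
  fixes M :: "nat \<Rightarrow> nat \<Rightarrow> 'a::field"
  assumes "j < n" "y j \<noteq> 0" and "\<And>b. b < n \<Longrightarrow> (\<Sum>a<n. y a * M a b) = 0"
  shows "det (mat n n (\<lambda>(a, b). M a b)) = 0"
proof -
  let ?M = "mat n n (\<lambda>(a, b). M a b)"
  have "transpose_mat ?M *\<^sub>v vec n y = 0\<^sub>v n"
    using assms(3)
    by (intro eq_vecI) (auto simp: scalar_prod_def mult.commute atLeast0LessThan)
  moreover have "vec n y \<noteq> 0\<^sub>v n"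
    using assms(1,2) by (auto simp: vec_eq_iff)
  ultimately have "det (transpose_mat ?M) = 0"
    by (subst det_0_iff_vec_prod_zero_field[of _ n]) (auto intro!: exI[of _ "vec n y"])
  then show ?thesis by (simp add: det_transpose[of _ n])
qed

text \<open>Zero rows pad the coefficients to a singular square matrix. This count of equations
  against unknowns is behind all the dimension inequalities below.\<close>

lemma wide_kernel:
  fixes F :: "nat \<Rightarrow> nat \<Rightarrow> 'a::field"
  assumes "m < n"
  shows "\<exists>y. (\<exists>j<n. y j \<noteq> 0) \<and> (\<forall>i<m. (\<Sum>j<n. F i j * y j) = 0)"
proof -
  let ?A = "mat n n (\<lambda>(i, j). if i < m then F i j else 0)"
  \<comment> \<open>Row \<open>m\<close> is one of the padded rows because \<open>m < n\<close>, so
    the unit vector at \<open>m\<close> is a left kernel vector.\<close>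
  have "det ?A = 0"
    by (rule det_mat_eq_0_left[of m n "\<lambda>i. if i = m then 1 else 0"])
       (use assms in \<open>auto intro!: sum.neutral\<close>)
  then obtain v where v: "v \<in> carrier_vec n" "v \<noteq> 0\<^sub>v n" "?A *\<^sub>v v = 0\<^sub>v n"
    using det_0_iff_vec_prod_zero_field[of ?A n] by auto
  have "(\<Sum>j<n. F i j * v $ j) = 0" if "i < m" for i
    using arg_cong[OF v(3), of "\<lambda>w. w $ i"] that assms v(1)
    by (simp add: scalar_prod_def atLeast0LessThan)
  then show ?thesis
    using v(1,2) by (intro exI[of _ "\<lambda>j. v $ j"]) (auto simp: vec_eq_iff)
qed

text \<open>The factor \<open>X\<close> has more rows than columns, so some nonzero row vector kills
  it, and with it the product.\<close>

lemma det_mat_eq_0_factor: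
  fixes M :: "nat \<Rightarrow> nat \<Rightarrow> 'a::field"
  assumes "m < n" and M: "\<And>a b. a < n \<Longrightarrow> b < n \<Longrightarrow> M a b = (\<Sum>c<m. X a c * Z c b)"
  shows "det (mat n n (\<lambda>(a, b). M a b)) = 0"
proof -
  obtain y j where y: "j < n" "y j \<noteq> 0" "\<And>c. c < m \<Longrightarrow> (\<Sum>a<n. X a c * y a) = 0"
    using wide_kernel[OF assms(1), of "\<lambda>c a. X a c"] by auto
  show ?thesis
  proof (rule det_mat_eq_0_left[of j n y])
    fix b assume b: "b < n"
    have "(\<Sum>a<n. y a * M a b) = (\<Sum>a<n. \<Sum>c<m. (X a c * y a) * Z c b)"
      by (intro sum.cong refl) (simp add: M b sum_distrib_left algebra_simps)
    also have "\<dots> = (\<Sum>c<m. (\<Sum>a<n. X a c * y a) * Z c b)"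
      by (subst sum.swap) (simp add: sum_distrib_right)
    finally show "(\<Sum>a<n. y a * M a b) = 0" by (simp add: y(3))
  qed (use y in auto)
qed

text \<open>With \<open>P\<close> independent of \<open>i\<close> this is an entry of P
  [A_1 | ... | A_r] Q, where Q stacks the \<open>Q i\<close>; with \<open>Q\<close> independent of
  \<open>i\<close> the matrices are stacked instead and the \<open>P i\<close> form the row. The
  common form lets one polynomiality lemma and one evaluation lemma serve both ranks.\<close>

definition contraction ::
  "nat \<Rightarrow> nat \<Rightarrow> (nat \<Rightarrow> nat \<Rightarrow> nat \<Rightarrow> 'k::field) \<Rightarrow> (nat \<Rightarrow> nat \<Rightarrow> nat \<Rightarrow> 'k) \<Rightarrow>
     'k mat list \<Rightarrow> nat \<Rightarrow> nat \<Rightarrow> 'k" where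
  "contraction r d P Q A a b = (\<Sum>i<r. \<Sum>p<d. \<Sum>q<d. P i a p * A ! i $$ (p, q) * Q i q b)"

text \<open>
  Lower bounds for the ranks of \<open>[A\<^sub>1 | \<dots> | A\<^sub>r]\<close> and of the vertical stack of the \<open>A\<^sub>i\<close>,
  phrased through non-vanishing polynomials so that they are visibly Zariski open.
\<close>

definition hrank_ge :: "nat \<Rightarrow> nat \<Rightarrow> nat \<Rightarrow> 'k::field mat list \<Rightarrow> bool" where
  "hrank_ge r d n A \<longleftrightarrow>
     (\<exists>P Q. det (mat n n (\<lambda>(a, b). contraction r d (\<lambda>i. P) Q A a b)) \<noteq> 0)"

definition vrank_ge :: "nat \<Rightarrow> nat \<Rightarrow> nat \<Rightarrow> 'k::field mat list \<Rightarrow> bool" where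
  "vrank_ge r d n A \<longleftrightarrow>
     (\<exists>P Q. det (mat n n (\<lambda>(a, b). contraction r d P (\<lambda>i. Q) A a b)) \<noteq> 0)"

text \<open>The columns of all \<open>A_i\<close> lie in the span of the \<open>m\<close> columns of
  \<open>X\<close>, so every contraction matrix factors through K^m and is singular as soon as its
  size exceeds \<open>m\<close>. The computation moves the sum over \<open>c\<close> to the
  outside.\<close>

lemma hrank_ge_le:
  assumes "hrank_ge r d n A"
    and A: "\<And>i p q. i < r \<Longrightarrow> p < d \<Longrightarrow> q < d \<Longrightarrow> A ! i $$ (p, q) = (\<Sum>c<m. X p c * Z i c q)"
  shows "n \<le> m"
proof (rule ccontr)
  assume "\<not> n \<le> m"
  then have "m < n" by simp
  obtain P Q where "det (mat n n (\<lambda>(a, b). contraction r d (\<lambda>i. P) Q A a b)) \<noteq> 0"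
    using assms(1) unfolding hrank_ge_def by blast
  moreover have "contraction r d (\<lambda>i. P) Q A a b =
      (\<Sum>c<m. (\<Sum>p<d. P a p * X p c) * (\<Sum>i<r. \<Sum>q<d. Z i c q * Q i q b))" for a b
  proof -
    have "contraction r d (\<lambda>i. P) Q A a b =
        (\<Sum>i<r. \<Sum>p<d. \<Sum>q<d. \<Sum>c<m. P a p * X p c * (Z i c q * Q i q b))"
      unfolding contraction_def
      by (intro sum.cong refl) (simp add: A sum_distrib_left sum_distrib_right mult.assoc)
    also have "\<dots> = (\<Sum>i<r. \<Sum>p<d. \<Sum>c<m. \<Sum>q<d. P a p * X p c * (Z i c q * Q i q b))"
      by (intro sum.cong refl sum.swap)
    also have "\<dots> = (\<Sum>i<r. \<Sum>c<m. \<Sum>p<d. \<Sum>q<d. P a p * X p c * (Z i c q * Q i q b))"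
      by (intro sum.cong refl sum.swap)
    also have "\<dots> = (\<Sum>c<m. \<Sum>i<r. (\<Sum>p<d. P a p * X p c) * (\<Sum>q<d. Z i c q * Q i q b))"
      by (subst sum.swap) (simp add: sum_product)
    finally show ?thesis by (simp add: sum_distrib_left)
  qed
  ultimately show False
    using det_mat_eq_0_factor[OF \<open>m < n\<close>, of "contraction r d (\<lambda>i. P) Q A"
      "\<lambda>a c. \<Sum>p<d. P a p * X p c" "\<lambda>c b. \<Sum>i<r. \<Sum>q<d. Z i c q * Q i q b"] by blast
qed

text \<open>Dual to \<open>hrank_ge_le\<close>: now the rows of all \<open>A_i\<close> lie in the
  span of the \<open>m\<close> rows of \<open>Z\<close>.\<close>

lemma vrank_ge_le:
  assumes "vrank_ge r d n A"
    and A: "\<And>i p q. i < r \<Longrightarrow> p < d \<Longrightarrow> q < d \<Longrightarrow> A ! i $$ (p, q) = (\<Sum>c<m. X i p c * Z c q)"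
  shows "n \<le> m"
proof (rule ccontr)
  assume "\<not> n \<le> m"
  then have "m < n" by simp
  obtain P Q where "det (mat n n (\<lambda>(a, b). contraction r d P (\<lambda>i. Q) A a b)) \<noteq> 0"
    using assms(1) unfolding vrank_ge_def by blast
  moreover have "contraction r d P (\<lambda>i. Q) A a b =
      (\<Sum>c<m. (\<Sum>i<r. \<Sum>p<d. P i a p * X i p c) * (\<Sum>q<d. Z c q * Q q b))" for a b
  proof -
    have "contraction r d P (\<lambda>i. Q) A a b =
        (\<Sum>i<r. \<Sum>p<d. \<Sum>q<d. \<Sum>c<m. P i a p * X i p c * (Z c q * Q q b))"
      unfolding contraction_def
      by (intro sum.cong refl) (simp add: A sum_distrib_left sum_distrib_right mult.assoc)
    also have "\<dots> = (\<Sum>i<r. \<Sum>p<d. \<Sum>c<m. \<Sum>q<d. P i a p * X i p c * (Z c q * Q q b))"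
      by (intro sum.cong refl sum.swap)
    also have "\<dots> = (\<Sum>i<r. \<Sum>c<m. \<Sum>p<d. \<Sum>q<d. P i a p * X i p c * (Z c q * Q q b))"
      by (intro sum.cong refl sum.swap)
    also have "\<dots> = (\<Sum>c<m. \<Sum>i<r. (\<Sum>p<d. P i a p * X i p c) * (\<Sum>q<d. Z c q * Q q b))"
      by (subst sum.swap) (simp add: sum_product)
    finally show ?thesis by (simp add: sum_distrib_right)
  qed
  ultimately show False
    using det_mat_eq_0_factor[OF \<open>m < n\<close>, of "contraction r d P (\<lambda>i. Q) A"
      "\<lambda>a c. \<Sum>i<r. \<Sum>p<d. P i a p * X i p c" "\<lambda>c b. \<Sum>q<d. Z c q * Q q b"] by blast
qed

section \<open>Changes of basis and flags of subspaces\<close>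

definition inv_pair :: "nat \<Rightarrow> 'k::field mat \<Rightarrow> 'k mat \<Rightarrow> bool" where
  "inv_pair d g h \<longleftrightarrow>
     g \<in> carrier_mat d d \<and> h \<in> carrier_mat d d \<and> g * h = 1\<^sub>m d \<and> h * g = 1\<^sub>m d"

lemma inv_pair_mult_vec:
  assumes "inv_pair d g h" "v \<in> carrier_vec d"
  shows "g *\<^sub>v (h *\<^sub>v v) = v" "h *\<^sub>v (g *\<^sub>v v) = v"
proof -
  have gh: "g \<in> carrier_mat d d" "h \<in> carrier_mat d d" "g * h = 1\<^sub>m d" "h * g = 1\<^sub>m d"
    using assms(1) unfolding inv_pair_def by auto
  show "g *\<^sub>v (h *\<^sub>v v) = v"
    using assoc_mult_mat_vec[OF gh(1,2) assms(2)] gh(3) assms(2) by simp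
  show "h *\<^sub>v (g *\<^sub>v v) = v"
    using assoc_mult_mat_vec[OF gh(2,1) assms(2)] gh(4) assms(2) by simp
qed

lemma inv_pair_closed:
  assumes "inv_pair d g h" "v \<in> carrier_vec d"
  shows "g *\<^sub>v v \<in> carrier_vec d" "h *\<^sub>v v \<in> carrier_vec d"
  using assms unfolding inv_pair_def by auto

lemma inv_pair_one: "inv_pair d (1\<^sub>m d) (1\<^sub>m d)"
  unfolding inv_pair_def by simp

lemma inv_pair_mult:
  assumes "inv_pair d g h" "inv_pair d g' h'"
  shows "inv_pair d (g' * g) (h * h')"
proof -
  have c: "g \<in> carrier_mat d d" "h \<in> carrier_mat d d" "g' \<in> carrier_mat d d" "h' \<in> carrier_mat d d"
    and e: "g * h = 1\<^sub>m d" "h * g = 1\<^sub>m d" "g' * h' = 1\<^sub>m d" "h' * g' = 1\<^sub>m d"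
    using assms unfolding inv_pair_def by auto
  have "g' * g * (h * h') = g' * (g * h) * h'"
    using c by (simp add: assoc_mult_mat[of _ d d _ d _ d])
  also have "\<dots> = 1\<^sub>m d" using c by (simp add: e)
  finally have 1: "g' * g * (h * h') = 1\<^sub>m d" .
  have "h * h' * (g' * g) = h * (h' * g') * g"
    using c by (simp add: assoc_mult_mat[of _ d d _ d _ d])
  also have "\<dots> = 1\<^sub>m d" using c by (simp add: e)
  finally show ?thesis using 1 c unfolding inv_pair_def by auto
qed

lemma inv_pair_exists:
  assumes "g \<in> carrier_mat d d" "det g \<noteq> 0"
  obtains h where "inv_pair d g h"
proof -
  have "(1 / det g) \<cdot>\<^sub>m (det g \<cdot>\<^sub>m 1\<^sub>m d) = 1\<^sub>m d"
    using assms(2) by (intro eq_matI) auto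
  then have "g * ((1 / det g) \<cdot>\<^sub>m adj_mat g) = 1\<^sub>m d" "((1 / det g) \<cdot>\<^sub>m adj_mat g) * g = 1\<^sub>m d"
    using adj_mat[OF assms(1)] assms(1)
    by (auto simp: mult_smult_distrib[of _ d d _ d] mult_smult_assoc_mat[of _ d d _ d])
  then show ?thesis
    using adj_mat(1)[OF assms(1)] assms(1)
    by (intro that[of "(1 / det g) \<cdot>\<^sub>m adj_mat g"]) (auto simp: inv_pair_def)
qed

text \<open>The preimage under \<open>g\<close> of the span of the first \<open>m\<close> unit
  vectors. For invertible \<open>g\<close> and \<open>m \<le> d\<close> it has dimension
  \<open>m\<close>, so a subspace of known dimension is handled without choosing a basis of
  it.\<close>

definition flag_space :: "nat \<Rightarrow> 'k::field mat \<Rightarrow> nat \<Rightarrow> 'k vec set" where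
  "flag_space d g m = {v \<in> carrier_vec d. \<forall>k. m \<le> k \<and> k < d \<longrightarrow> (g *\<^sub>v v) $ k = 0}"

definition vec_subspace :: "nat \<Rightarrow> 'k::field vec set \<Rightarrow> bool" where
  "vec_subspace d W \<longleftrightarrow> W \<subseteq> carrier_vec d \<and> 0\<^sub>v d \<in> W \<and>
     (\<forall>v\<in>W. \<forall>w\<in>W. v + w \<in> W) \<and> (\<forall>c. \<forall>v\<in>W. c \<cdot>\<^sub>v v \<in> W)"

lemma flag_space_mono: "m \<le> n \<Longrightarrow> flag_space d g m \<subseteq> flag_space d g n"
  unfolding flag_space_def by auto

text \<open>Exchange step for \<open>extend_flag\<close>. Fixing the vectors supported below
  \<open>m\<close> keeps the lower levels of a flag unchanged; it is recorded for the inverse as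
  well because equality of flags needs both inclusions.\<close>

lemma move_vector:
  fixes w :: "'k::field vec"
  assumes "w \<in> carrier_vec d" "m \<le> k" "k < d" "w $ k \<noteq> 0"
  obtains h N where "inv_pair d h N" "h *\<^sub>v w = unit_vec d m"
    "\<And>e. e \<in> carrier_vec d \<Longrightarrow> (\<And>j. m \<le> j \<Longrightarrow> j < d \<Longrightarrow> e $ j = 0) \<Longrightarrow> h *\<^sub>v e = e"
    "\<And>e. e \<in> carrier_vec d \<Longrightarrow> (\<And>j. m \<le> j \<Longrightarrow> j < d \<Longrightarrow> e $ j = 0) \<Longrightarrow> N *\<^sub>v e = e"
proof -
  define \<tau> where "\<tau> p = (if p = m then k else if p = k then m else p)" for p
  \<comment> \<open>Column \<open>m\<close> of \<open>N\<close> is \<open>w\<close>, every other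
    column \<open>j\<close> is the unit vector at \<open>\<tau> j\<close>. Among the latter only the
    unit vector at \<open>k\<close> is missing, and \<open>w $ k\<close> is nonzero, so
    \<open>N\<close> is invertible.\<close>
  define N where "N = mat d d (\<lambda>(p, j). if j = m then w $ p else if j = \<tau> p then 1 else 0)"
  have N: "N \<in> carrier_mat d d" by (simp add: N_def)
  have \<tau>: "\<tau> p < d" if "p < d" for p using that assms by (auto simp: \<tau>_def)
  have Nx: "(N *\<^sub>v x) $ p = w $ p * x $ m + (if \<tau> p = m then 0 else x $ \<tau> p)"
    if "x \<in> carrier_vec d" "p < d" for x p
  proof -
    have m: "m < d" using assms by simp
    have "(N *\<^sub>v x) $ p = (\<Sum>j<d. (if j = m then w $ p * x $ m else 0) +
        (if j = \<tau> p then if \<tau> p = m then 0 else x $ \<tau> p else 0))"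
      unfolding mult_mat_vec_entry[OF N that]
      by (intro sum.cong refl) (use that in \<open>auto simp: N_def\<close>)
    also have "\<dots> = w $ p * x $ m + (if \<tau> p = m then 0 else x $ \<tau> p)"
      unfolding sum.distrib using m \<tau>[OF that(2)] by simp
    finally show ?thesis .
  qed
  have "det N \<noteq> 0"
  proof
    assume "det N = 0"
    then obtain x where x: "x \<in> carrier_vec d" "x \<noteq> 0\<^sub>v d" "N *\<^sub>v x = 0\<^sub>v d"
      using det_0_iff_vec_prod_zero_field[OF N] by auto
    have eq: "w $ p * x $ m + (if \<tau> p = m then 0 else x $ \<tau> p) = 0" if "p < d" for p
      using Nx[OF x(1) that] x(3) that by simp
    \<comment> \<open>Row \<open>k\<close> reads \<open>w $ k * x $ m = 0\<close>; with
      \<open>x $ m = 0\<close> the other rows return the remaining coordinates.\<close>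
    have "\<tau> k = m" by (simp add: \<tau>_def)
    then have xm: "x $ m = 0" using eq[OF assms(3)] assms by simp
    have "x $ j = 0" if "j < d" for j
    proof (cases "j = m")
      case False
      have "\<tau> (\<tau> j) = j" by (auto simp: \<tau>_def)
      with eq[OF \<tau>[OF that]] xm False show ?thesis by simp
    qed (use xm in simp)
    then have "x = 0\<^sub>v d" using x(1) by (intro eq_vecI) auto
    with x(2) show False by simp
  qed
  then obtain h where h: "inv_pair d N h" using inv_pair_exists[OF N] by blast
  then have hN: "inv_pair d h N" by (auto simp: inv_pair_def)
  have Ne: "N *\<^sub>v e = e" if e: "e \<in> carrier_vec d" "\<And>j. m \<le> j \<Longrightarrow> j < d \<Longrightarrow> e $ j = 0" for e
  proof (rule eq_vecI)
    fix p assume "p < dim_vec e"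
    then have p: "p < d" using e(1) by simp
    have "e $ m = 0" "e $ k = 0" using e(2) assms by auto
    then show "(N *\<^sub>v e) $ p = e $ p"
      unfolding Nx[OF e(1) p] by (auto simp: \<tau>_def)
  qed (use e N in auto)
  have "N *\<^sub>v unit_vec d m = w"
    using assms by (intro eq_vecI) (auto simp: N_def)
  then have "h *\<^sub>v w = unit_vec d m"
    using inv_pair_mult_vec(1)[OF hN, of "unit_vec d m"] by simp
  moreover have "h *\<^sub>v e = e" if "e \<in> carrier_vec d" "\<And>j. m \<le> j \<Longrightarrow> j < d \<Longrightarrow> e $ j = 0" for e
    using inv_pair_mult_vec(1)[OF hN that(1)] Ne[OF that] by simp
  ultimately show ?thesis using that hN Ne by blast
qed

text \<open>As long as level \<open>m\<close> is smaller than \<open>W\<close>, a vector of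
  \<open>W\<close> outside it is moved to the unit vector at \<open>m\<close>, which raises the
  level by one. Levels up to \<open>m\<close> survive, so that a flag adapted to one subspace can be
  extended to a larger one with a single \<open>g\<close> for both.\<close>

lemma extend_flag:
  fixes W :: "'k::field vec set"
  assumes W: "vec_subspace d W" and "inv_pair d g h" "m \<le> d" "flag_space d g m \<subseteq> W"
  shows "\<exists>g' h' m'. m \<le> m' \<and> m' \<le> d \<and> inv_pair d g' h' \<and>
    (\<forall>j\<le>m. flag_space d g' j = flag_space d g j) \<and> flag_space d g' m' = W"
  using assms(2-)
proof (induction "d - m" arbitrary: g h m rule: less_induct)
  case less
  show ?case
  proof (cases "flag_space d g m = W")
    case True
    then show ?thesis using less.prems by blast
  next
    case False
    then obtain v k where v: "v \<in> W" "m \<le> k" "k < d" "(g *\<^sub>v v) $ k \<noteq> 0"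
      using less.prems W unfolding flag_space_def vec_subspace_def by blast
    have vc: "v \<in> carrier_vec d" using v(1) W unfolding vec_subspace_def by blast
    note gh = less.prems(1)
    obtain l N where l: "inv_pair d l N" "l *\<^sub>v (g *\<^sub>v v) = unit_vec d m"
      and le: "\<And>e. e \<in> carrier_vec d \<Longrightarrow> (\<And>j. m \<le> j \<Longrightarrow> j < d \<Longrightarrow> e $ j = 0) \<Longrightarrow> l *\<^sub>v e = e"
      and Ne: "\<And>e. e \<in> carrier_vec d \<Longrightarrow> (\<And>j. m \<le> j \<Longrightarrow> j < d \<Longrightarrow> e $ j = 0) \<Longrightarrow> N *\<^sub>v e = e"
      using move_vector[OF inv_pair_closed(1)[OF gh vc] v(2-4)] by blast
    define g' where "g' = l * g"
    define h' where "h' = h * N"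
    have pair: "inv_pair d g' h'" unfolding g'_def h'_def by (rule inv_pair_mult[OF gh l(1)])
    have g': "g' *\<^sub>v x = l *\<^sub>v (g *\<^sub>v x)" if "x \<in> carrier_vec d" for x
      using that gh l(1) unfolding g'_def inv_pair_def by (simp add: assoc_mult_mat_vec[of _ d d _ d])
    have same: "flag_space d g' n = flag_space d g n" if n: "n \<le> m" for n
    proof -
      have "l *\<^sub>v (g *\<^sub>v x) = g *\<^sub>v x" if "x \<in> flag_space d g n" for x
        using that inv_pair_closed[OF gh] n unfolding flag_space_def by (intro le) auto
      moreover have "g *\<^sub>v x = l *\<^sub>v (g *\<^sub>v x)" if x: "x \<in> flag_space d g' n" for x
      proof -
        have xc: "x \<in> carrier_vec d" using x unfolding flag_space_def by simp
        have "N *\<^sub>v (l *\<^sub>v (g *\<^sub>v x)) = l *\<^sub>v (g *\<^sub>v x)"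
          using x n g'[OF xc] inv_pair_closed[OF l(1)] inv_pair_closed[OF gh xc]
          unfolding flag_space_def by (intro Ne) auto
        then show ?thesis
          using inv_pair_mult_vec(2)[OF l(1) inv_pair_closed(1)[OF gh xc]] by simp
      qed
      ultimately show ?thesis
        using g' unfolding flag_space_def by (intro equalityI subsetI) (simp_all, metis)
    qed
    have sub: "flag_space d g' (Suc m) \<subseteq> W"
    proof
      fix x assume x: "x \<in> flag_space d g' (Suc m)"
      then have xc: "x \<in> carrier_vec d" unfolding flag_space_def by simp
      define c where "c = (g' *\<^sub>v x) $ m"
      \<comment> \<open>Subtracting \<open>c\<close> times \<open>v\<close> removes coordinate
        \<open>m\<close>, so \<open>y\<close> falls into the old level \<open>m\<close>, which lies
        in \<open>W\<close>.\<close>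
      define y where "y = x + (- c) \<cdot>\<^sub>v v"
      have yc: "y \<in> carrier_vec d" using xc vc by (simp add: y_def)
      have "g' \<in> carrier_mat d d" using pair by (simp add: inv_pair_def)
      then have "g' *\<^sub>v y = g' *\<^sub>v x + (- c) \<cdot>\<^sub>v unit_vec d m"
        using xc vc g'[OF vc] l(2)
        by (simp add: y_def mult_add_distrib_mat_vec[of _ d d] mult_mat_vec[of _ d d])
      then have "(g' *\<^sub>v y) $ j = 0" if "m \<le> j" "j < d" for j
        using that x inv_pair_closed[OF pair xc]
        by (cases "j = m") (auto simp: flag_space_def c_def)
      then have "y \<in> flag_space d g' m" using yc by (auto simp: flag_space_def)
      then have "y \<in> W" using same[of m] less.prems(3) by blast
      moreover have "x = y + c \<cdot>\<^sub>v v" using xc vc by (intro eq_vecI) (auto simp: y_def)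
      ultimately show "x \<in> W" using W v(1) unfolding vec_subspace_def by blast
    qed
    have "d - Suc m < d - m" "Suc m \<le> d" using v by auto
    from less.hyps[OF this(1) pair this(2) sub] obtain g2 h2 m2 where
      *: "Suc m \<le> m2" "m2 \<le> d" "inv_pair d g2 h2"
      "\<forall>j\<le>Suc m. flag_space d g2 j = flag_space d g' j" "flag_space d g2 m2 = W" by blast
    have "\<forall>j\<le>m. flag_space d g2 j = flag_space d g j" using *(4) same by simp
    then show ?thesis using * by (metis Suc_leD)
  qed
qed

section \<open>Flags adapted to image and socle\<close>

definition lin_image :: "nat \<Rightarrow> nat \<Rightarrow> 'k::field mat list \<Rightarrow> 'k vec set" where
  "lin_image r d A = {vec d (\<lambda>k. \<Sum>i<r. (A ! i *\<^sub>v x i) $ k) |x. \<forall>i<r. x i \<in> carrier_vec d}"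

definition lin_socle :: "nat \<Rightarrow> nat \<Rightarrow> 'k::field mat list \<Rightarrow> 'k vec set" where
  "lin_socle r d A = {v \<in> carrier_vec d. \<forall>i<r. A ! i *\<^sub>v v = 0\<^sub>v d}"

lemma mult_mat_vec_sum:
  assumes "B \<in> carrier_mat d d" "\<And>i. i < r \<Longrightarrow> y i \<in> carrier_vec d" "k < d"
  shows "(B *\<^sub>v vec d (\<lambda>k. \<Sum>i<r. y i $ k)) $ k = (\<Sum>i<r. (B *\<^sub>v y i) $ k)"
proof -
  have "(B *\<^sub>v vec d (\<lambda>k. \<Sum>i<r. y i $ k)) $ k = (\<Sum>l<d. B $$ (k, l) * (\<Sum>i<r. y i $ l))"
    by (subst mult_mat_vec_entry[OF assms(1) _ assms(3)]) auto
  also have "\<dots> = (\<Sum>i<r. \<Sum>l<d. B $$ (k, l) * y i $ l)"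
    by (subst sum.swap) (simp add: sum_distrib_left)
  also have "\<dots> = (\<Sum>i<r. (B *\<^sub>v y i) $ k)"
    by (intro sum.cong refl) (simp add: mult_mat_vec_entry[OF assms(1) assms(2) assms(3)])
  finally show ?thesis .
qed

lemma mat_tuples_D: "A \<in> mat_tuples r d \<Longrightarrow> i < r \<Longrightarrow> A ! i \<in> carrier_mat d d"
  unfolding mat_tuples_def by (auto simp: set_conv_nth)

lemma Rep_subset_mat_tuples: "Rep r d \<subseteq> mat_tuples r d"
  unfolding Rep_def mat_tuples_def by blast

lemma vec_subspace_lin_image:
  assumes "A \<in> mat_tuples r d"
  shows "vec_subspace d (lin_image r d A)"
  unfolding vec_subspace_def
proof (intro conjI allI ballI)
  note A = mat_tuples_D[OF assms]
  show "lin_image r d A \<subseteq> carrier_vec d" by (auto simp: lin_image_def)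
  have "(A ! i *\<^sub>v 0\<^sub>v d) $ k = 0" if "i < r" "k < d" for i k
    using A[OF that(1)] that(2) by simp
  then show "0\<^sub>v d \<in> lin_image r d A"
    unfolding lin_image_def
    by (intro CollectI exI[of _ "\<lambda>i. 0\<^sub>v d"] conjI eq_vecI) auto
  fix v assume "v \<in> lin_image r d A"
  then obtain x where x: "\<And>i. i < r \<Longrightarrow> x i \<in> carrier_vec d" "v = vec d (\<lambda>k. \<Sum>i<r. (A ! i *\<^sub>v x i) $ k)"
    unfolding lin_image_def by blast
  have s: "(A ! i *\<^sub>v (c \<cdot>\<^sub>v x i)) $ k = c * (A ! i *\<^sub>v x i) $ k" if "i < r" "k < d" for i k c
    using A[OF that(1)] x(1)[OF that(1)] that(2) by (simp add: mult_mat_vec[of _ d d])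
  show "c \<cdot>\<^sub>v v \<in> lin_image r d A" for c
    unfolding lin_image_def using x s
    by (intro CollectI exI[of _ "\<lambda>i. c \<cdot>\<^sub>v x i"] conjI eq_vecI) (auto simp: sum_distrib_left)
  fix w assume "w \<in> lin_image r d A"
  then obtain y where y: "\<And>i. i < r \<Longrightarrow> y i \<in> carrier_vec d" "w = vec d (\<lambda>k. \<Sum>i<r. (A ! i *\<^sub>v y i) $ k)"
    unfolding lin_image_def by blast
  have t: "(A ! i *\<^sub>v (x i + y i)) $ k = (A ! i *\<^sub>v x i) $ k + (A ! i *\<^sub>v y i) $ k"
    if "i < r" "k < d" for i k
    using A[OF that(1)] x(1)[OF that(1)] y(1)[OF that(1)] that(2)
    by (simp add: mult_add_distrib_mat_vec[of _ d d])
  show "v + w \<in> lin_image r d A"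
    unfolding lin_image_def using x y t
    by (intro CollectI exI[of _ "\<lambda>i. x i + y i"] conjI eq_vecI) (auto simp: sum.distrib)
qed

lemma vec_subspace_lin_socle:
  assumes "A \<in> mat_tuples r d"
  shows "vec_subspace d (lin_socle r d A)"
  unfolding vec_subspace_def lin_socle_def
  using mat_tuples_D[OF assms] carrier_matD(1)[OF mat_tuples_D[OF assms]]
  by (auto simp: mult_add_distrib_mat_vec[of _ d d] mult_mat_vec[of _ d d] intro!: eq_vecI) 

lemma mult_in_lin_image:
  assumes "A \<in> mat_tuples r d" "i < r" "v \<in> carrier_vec d"
  shows "A ! i *\<^sub>v v \<in> lin_image r d A"
proof -
  have "(A ! j *\<^sub>v (if j = i then v else 0\<^sub>v d)) $ k = (if j = i then (A ! i *\<^sub>v v) $ k else 0)"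
    if "j < r" "k < d" for j k
    using mat_tuples_D[OF assms(1) that(1)] that by auto
  then show ?thesis
    unfolding lin_image_def using assms mat_tuples_D[OF assms(1,2)]
    by (intro CollectI exI[of _ "\<lambda>j. if j = i then v else 0\<^sub>v d"] conjI eq_vecI) auto
qed

lemma lin_image_subset_socle:
  assumes "A \<in> Rep r d"
  shows "lin_image r d A \<subseteq> lin_socle r d A"
proof
  fix v assume "v \<in> lin_image r d A"
  then obtain x where x: "\<And>i. i < r \<Longrightarrow> x i \<in> carrier_vec d" "v = vec d (\<lambda>k. \<Sum>i<r. (A ! i *\<^sub>v x i) $ k)"
    unfolding lin_image_def by blast
  have "A ! j *\<^sub>v v = 0\<^sub>v d" if j: "j < r" for j
  proof (rule eq_vecI)
    fix k assume "k < dim_vec (0\<^sub>v d :: 'a vec)"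
    then have k: "k < d" by simp
    have "(A ! j *\<^sub>v v) $ k = (\<Sum>i<r. (A ! j *\<^sub>v (A ! i *\<^sub>v x i)) $ k)"
      unfolding x(2)
      by (rule mult_mat_vec_sum[OF Rep_D[OF assms j] _ k]) (use Rep_D[OF assms] x(1) in \<open>auto intro: mult_mat_vec_carrier\<close>)
    also have "\<dots> = 0"
      using Rep_mult_zero[OF assms j] x(1) k by (intro sum.neutral) auto
    finally show "(A ! j *\<^sub>v v) $ k = 0\<^sub>v d $ k" using k by simp
  qed (use Rep_D[OF assms j] in simp)
  then show "v \<in> lin_socle r d A" using x(2) by (simp add: lin_socle_def)
qed

text \<open>The flag is extended twice, from 0 to the image and from there to the socle; the second
  extension leaves level \<open>\<rho>\<close> intact.\<close>

lemma Rep_normal_form: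
  assumes "A \<in> Rep r d"
  obtains g h \<rho> \<sigma> where "inv_pair d g h" "\<rho> \<le> \<sigma>" "\<sigma> \<le> d"
    "lin_image r d A = flag_space d g \<rho>" "lin_socle r d A = flag_space d g \<sigma>"
proof -
  have A: "A \<in> mat_tuples r d" using assms Rep_subset_mat_tuples by blast
  have "flag_space d (1\<^sub>m d) 0 \<subseteq> {0\<^sub>v d}"
    unfolding flag_space_def by (auto intro!: eq_vecI)
  then have "flag_space d (1\<^sub>m d) 0 \<subseteq> lin_image r d A"
    using vec_subspace_lin_image[OF A] unfolding vec_subspace_def by blast
  from extend_flag[OF vec_subspace_lin_image[OF A] inv_pair_one le0 this]
  obtain g1 h1 \<rho> where 1: "\<rho> \<le> d" "inv_pair d g1 h1" "flag_space d g1 \<rho> = lin_image r d A"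
    by blast
  then have "flag_space d g1 \<rho> \<subseteq> lin_socle r d A" using lin_image_subset_socle[OF assms] by simp
  from extend_flag[OF vec_subspace_lin_socle[OF A] 1(2,1) this] 1(3) show ?thesis
    using that by (metis order_refl)
qed

text \<open>The set \<open>Y_m\<close> of the overview, with \<open>W = flag_space d g m\<close>. In
  a basis adapted to \<open>W\<close> the two inclusions become vanishing conditions on
  entries.\<close>

definition block_rep :: "nat \<Rightarrow> nat \<Rightarrow> nat \<Rightarrow> 'k::field mat list set" where
  "block_rep r d m = {A \<in> mat_tuples r d. \<exists>g h. inv_pair d g h \<and>
     (\<forall>i<r. \<forall>p<d. \<forall>q<d. \<not> (p < m \<and> m \<le> q) \<longrightarrow> (g * A ! i * h) $$ (p, q) = 0)}"

lemma conj_mult_vec: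
  assumes "inv_pair d g h" "B \<in> carrier_mat d d" "v \<in> carrier_vec d"
  shows "g * B * h *\<^sub>v v = g *\<^sub>v (B *\<^sub>v (h *\<^sub>v v))"
proof -
  have c: "g \<in> carrier_mat d d" "h \<in> carrier_mat d d"
    using assms(1) unfolding inv_pair_def by auto
  have "g * B * h *\<^sub>v v = g * B *\<^sub>v (h *\<^sub>v v)"
    by (rule assoc_mult_mat_vec[of _ d d _ d]) (use c assms in auto)
  also have "\<dots> = g *\<^sub>v (B *\<^sub>v (h *\<^sub>v v))"
    by (rule assoc_mult_mat_vec[of _ d d _ d]) (use c assms in auto)
  finally show ?thesis .
qed

lemma conj_mult_conj:
  assumes "inv_pair d g h" "B \<in> carrier_mat d d"
  shows "h * (g * B * h) * g = B"
proof -
  have c: "g \<in> carrier_mat d d" "h \<in> carrier_mat d d" and e: "h * g = 1\<^sub>m d"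
    using assms(1) unfolding inv_pair_def by auto
  have "h * (g * B * h) * g = (h * g) * B * (h * g)"
    using c assms(2) by (simp add: assoc_mult_mat[of _ d d _ d _ d])
  then show ?thesis using e assms(2) by simp
qed

text \<open>A column \<open>q < m\<close> vanishes because \<open>h\<close> maps the unit vector at
  \<open>q\<close> into the flag space, hence into the socle. A row \<open>p \<ge> m\<close>
  vanishes because the image lies in the flag space.\<close>

lemma conj_entry_zero:
  assumes A: "A \<in> mat_tuples r d" and gh: "inv_pair d g h"
    and im: "lin_image r d A \<subseteq> flag_space d g m" and soc: "flag_space d g m \<subseteq> lin_socle r d A"
    and ipq: "i < r" "p < d" "q < d" "\<not> (p < m \<and> m \<le> q)"
  shows "(g * A ! i * h) $$ (p, q) = 0"
proof -
  have gc: "g \<in> carrier_mat d d" "h \<in> carrier_mat d d" using gh by (auto simp: inv_pair_def)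
  have "(g * A ! i * h) $$ (p, q) = (g * A ! i * h *\<^sub>v unit_vec d q) $ p"
    using ipq gc mat_tuples_D[OF A ipq(1)] by simp
  also have "\<dots> = (g *\<^sub>v (A ! i *\<^sub>v (h *\<^sub>v unit_vec d q))) $ p"
    by (subst conj_mult_vec[OF gh mat_tuples_D[OF A ipq(1)]]) auto
  also have "\<dots> = 0"
  proof (cases "p < m")
    case True
    have "h *\<^sub>v unit_vec d q \<in> flag_space d g m"
      using True ipq gc inv_pair_mult_vec(1)[OF gh, of "unit_vec d q"]
      by (auto simp: flag_space_def simp del: index_mult_mat_vec)
    then have "A ! i *\<^sub>v (h *\<^sub>v unit_vec d q) = 0\<^sub>v d"
      using soc ipq(1) by (auto simp: lin_socle_def)
    then show ?thesis using gc ipq(2) by simp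
  next
    case False
    have "A ! i *\<^sub>v (h *\<^sub>v unit_vec d q) \<in> flag_space d g m"
      using mult_in_lin_image[OF A ipq(1)] im gc by auto
    then show ?thesis using False ipq(2) by (auto simp: flag_space_def)
  qed
  finally show ?thesis .
qed

lemma block_repI:
  assumes "A \<in> mat_tuples r d" "inv_pair d g h"
    "lin_image r d A \<subseteq> flag_space d g m" "flag_space d g m \<subseteq> lin_socle r d A"
  shows "A \<in> block_rep r d m"
  unfolding block_rep_def using conj_entry_zero[OF assms] assms(1,2) by blast

text \<open>In a product of two conjugated matrices, an inner index below \<open>m\<close> hits a
  zero column of the left factor and any other one a zero row of the right factor.\<close>

lemma block_rep_subset_Rep: "block_rep r d m \<subseteq> Rep r d"
proof
  fix A :: "'a mat list" assume "A \<in> block_rep r d m"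
  then obtain g h where A: "A \<in> mat_tuples r d" and gh: "inv_pair d g h"
    and z: "\<And>i p q. i < r \<Longrightarrow> p < d \<Longrightarrow> q < d \<Longrightarrow> \<not> (p < m \<and> m \<le> q) \<Longrightarrow> (g * A ! i * h) $$ (p, q) = 0"
    unfolding block_rep_def by blast
  have gc: "g \<in> carrier_mat d d" "h \<in> carrier_mat d d" "g * h = 1\<^sub>m d"
    using gh by (auto simp: inv_pair_def)
  have "A ! i * A ! j = 0\<^sub>m d d" if ij: "i < r" "j < r" for i j
  proof -
    define C where "C i = g * A ! i * h" for i
    have C: "C i \<in> carrier_mat d d" "C j \<in> carrier_mat d d"
      using gc mat_tuples_D[OF A] ij by (auto simp: C_def)
    have "(C i * C j) $$ (p, q) = 0" if "p < d" "q < d" for p q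
    proof -
      have "(C i * C j) $$ (p, q) = (\<Sum>l<d. C i $$ (p, l) * C j $$ (l, q))"
        using C that by (simp add: scalar_prod_def atLeast0LessThan)
      also have "\<dots> = 0"
      proof (rule sum.neutral, rule ballI)
        fix l assume "l \<in> {..<d}"
        then show "C i $$ (p, l) * C j $$ (l, q) = 0"
          using z[OF ij(1) that(1), of l] z[OF ij(2) _ that(2), of l]
          by (cases "l < m") (auto simp: C_def)
      qed
      finally show ?thesis .
    qed
    then have 0: "C i * C j = 0\<^sub>m d d" using C by (intro eq_matI) auto
    have "A ! i * A ! j = (h * C i * g) * (h * C j * g)"
      using conj_mult_conj[OF gh mat_tuples_D[OF A]] ij by (simp add: C_def)
    also have "\<dots> = h * (C i * ((g * h) * C j)) * g"
      using gc(1,2) C by (simp add: assoc_mult_mat[of _ d d _ d _ d])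
    also have "\<dots> = 0\<^sub>m d d" using gc C 0 by simp
    finally show ?thesis .
  qed
  then show "A \<in> Rep r d" using A unfolding Rep_def mat_tuples_def by blast
qed

lemma mat_mult_entry:
  assumes "B \<in> carrier_mat d d" "C \<in> carrier_mat d d" "p < d" "q < d"
  shows "(B * C) $$ (p, q) = (\<Sum>c<d. B $$ (p, c) * C $$ (c, q))"
  using assms by (simp add: scalar_prod_def atLeast0LessThan)

text \<open>With \<open>C_i = g A_i h\<close> one has \<open>A_i = h (C_i g)\<close>. Rows of
  \<open>C_i\<close> from \<open>m\<close> on vanish, so only the first \<open>m\<close> columns of
  \<open>h\<close> contribute, and they are common to all \<open>i\<close>.\<close>

lemma block_rep_hrank:
  assumes "A \<in> block_rep r d m" "hrank_ge r d n A" "m \<le> d"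
  shows "n \<le> m"
proof -
  obtain g h where A: "A \<in> mat_tuples r d" and gh: "inv_pair d g h"
    and z: "\<And>i p q. i < r \<Longrightarrow> p < d \<Longrightarrow> q < d \<Longrightarrow> \<not> (p < m \<and> m \<le> q) \<Longrightarrow> (g * A ! i * h) $$ (p, q) = 0"
    using assms(1) unfolding block_rep_def by blast
  have gc: "g \<in> carrier_mat d d" "h \<in> carrier_mat d d"
    using gh by (auto simp: inv_pair_def)
  show ?thesis
  proof (rule hrank_ge_le[OF assms(2), where X = "\<lambda>p c. h $$ (p, c)" and Z = "\<lambda>i c q. (g * A ! i * h * g) $$ (c, q)"])
    fix i p q assume ipq: "i < r" "p < d" "q < d"
    note Ai = mat_tuples_D[OF A ipq(1)]
    have "A ! i $$ (p, q) = (h * (g * A ! i * h * g)) $$ (p, q)"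
      using conj_mult_conj[OF gh Ai] gc Ai by (simp add: assoc_mult_mat[of _ d d _ d _ d])
    also have "\<dots> = (\<Sum>c<d. h $$ (p, c) * (g * A ! i * h * g) $$ (c, q))"
      by (rule mat_mult_entry) (use gc Ai ipq in auto)
    also have "\<dots> = (\<Sum>c<m. h $$ (p, c) * (g * A ! i * h * g) $$ (c, q))"
    proof (rule sum.mono_neutral_right)
      have "(g * A ! i * h * g) $$ (c, q) = 0" if "c < d" "m \<le> c" for c
      proof -
        have "(g * A ! i * h * g) $$ (c, q) = (\<Sum>l<d. (g * A ! i * h) $$ (c, l) * g $$ (l, q))"
          by (rule mat_mult_entry) (use gc Ai ipq that in auto)
        also have "\<dots> = 0" using z[OF ipq(1) that(1)] that by (intro sum.neutral) auto
        finally show ?thesis .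
      qed
      then show "\<forall>c\<in>{..<d} - {..<m}. h $$ (p, c) * (g * A ! i * h * g) $$ (c, q) = 0" by auto
    qed (use assms(3) in auto)
    finally show "A ! i $$ (p, q) = (\<Sum>c<m. h $$ (p, c) * (g * A ! i * h * g) $$ (c, q))" .
  qed
qed

text \<open>Here \<open>A_i = (h C_i) g\<close> with \<open>C_i = g A_i h\<close>. Columns of
  \<open>C_i\<close> below \<open>m\<close> vanish, so only the last \<open>d - m\<close> rows of
  \<open>g\<close> contribute.\<close>

lemma block_rep_vrank:
  assumes "A \<in> block_rep r d m" "vrank_ge r d n A" "m \<le> d"
  shows "n \<le> d - m"
proof -
  obtain g h where A: "A \<in> mat_tuples r d" and gh: "inv_pair d g h"
    and z: "\<And>i p q. i < r \<Longrightarrow> p < d \<Longrightarrow> q < d \<Longrightarrow> \<not> (p < m \<and> m \<le> q) \<Longrightarrow> (g * A ! i * h) $$ (p, q) = 0"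
    using assms(1) unfolding block_rep_def by blast
  have gc: "g \<in> carrier_mat d d" "h \<in> carrier_mat d d"
    using gh by (auto simp: inv_pair_def)
  show ?thesis
  proof (rule vrank_ge_le[OF assms(2), where X = "\<lambda>i p c. (h * (g * A ! i * h)) $$ (p, m + c)"
        and Z = "\<lambda>c q. g $$ (m + c, q)"])
    fix i p q assume ipq: "i < r" "p < d" "q < d"
    note Ai = mat_tuples_D[OF A ipq(1)]
    let ?D = "h * (g * A ! i * h)"
    have "A ! i $$ (p, q) = (?D * g) $$ (p, q)"
      using conj_mult_conj[OF gh Ai] by simp
    also have "\<dots> = (\<Sum>c<d. ?D $$ (p, c) * g $$ (c, q))"
      by (rule mat_mult_entry) (use gc Ai ipq in auto)
    also have "\<dots> = (\<Sum>c\<in>{m..<d}. ?D $$ (p, c) * g $$ (c, q))"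
    proof (rule sum.mono_neutral_right)
      have "?D $$ (p, c) = 0" if "c < d" "c < m" for c
      proof -
        have "?D $$ (p, c) = (\<Sum>l<d. h $$ (p, l) * (g * A ! i * h) $$ (l, c))"
          by (rule mat_mult_entry) (use gc Ai ipq that in auto)
        also have "\<dots> = 0" using z[OF ipq(1) _ that(1)] that by (intro sum.neutral) auto
        finally show ?thesis .
      qed
      then show "\<forall>c\<in>{..<d} - {m..<d}. ?D $$ (p, c) * g $$ (c, q) = 0" by auto
    qed auto
    also have "\<dots> = (\<Sum>c<d - m. ?D $$ (p, m + c) * g $$ (m + c, q))"
      by (rule sum.reindex_bij_witness[of _ "\<lambda>c. m + c" "\<lambda>c. c - m"]) auto
    finally show "A ! i $$ (p, q) = (\<Sum>c<d - m. ?D $$ (p, m + c) * g $$ (m + c, q))" .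
  qed
qed

section \<open>Dimension bounds\<close>

text \<open>In the adapted basis the \<open>A_i\<close> are given by \<open>\<sigma>\<close> x
  \<open>(d - \<sigma>)\<close> blocks. If their stack had fewer rows than columns, a kernel vector
  \<open>y\<close> would yield a socle vector with a nonzero coordinate beyond
  \<open>\<sigma>\<close>.\<close>

lemma socle_codim_le:
  assumes A: "A \<in> Rep r d" and gh: "inv_pair d g h" and "\<rho> \<le> \<sigma>" "\<sigma> \<le> d"
    and im: "lin_image r d A = flag_space d g \<rho>" and soc: "lin_socle r d A = flag_space d g \<sigma>"
  shows "d - \<sigma> \<le> r * \<sigma>"
proof (rule ccontr)
  assume "\<not> d - \<sigma> \<le> r * \<sigma>"
  then have "r * \<sigma> < d - \<sigma>" by simp
  have T: "A \<in> mat_tuples r d" using A Rep_subset_mat_tuples by blast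
  have gc: "g \<in> carrier_mat d d" "h \<in> carrier_mat d d" using gh by (auto simp: inv_pair_def)
  define C where "C i = g * A ! i * h" for i
  have Cc: "C i \<in> carrier_mat d d" if "i < r" for i
    using gc mat_tuples_D[OF T that] by (simp add: C_def)
  have z: "C i $$ (p, q) = 0" if "i < r" "p < d" "q < d" "\<not> (p < \<sigma> \<and> \<sigma> \<le> q)" for i p q
    unfolding C_def
    by (rule conj_entry_zero[OF T gh _ _ that]) (use im soc lin_image_subset_socle[OF A] in auto)
  \<comment> \<open>The number \<open>c = i * \<sigma> + p\<close> codes row \<open>p\<close> of
    block \<open>i\<close>, so one system of \<open>r * \<sigma>\<close> equations covers all
    blocks.\<close>
  obtain y where y: "\<exists>j<d - \<sigma>. y j \<noteq> 0"
    and y0: "\<And>c. c < r * \<sigma> \<Longrightarrow> (\<Sum>j<d - \<sigma>. C (c div \<sigma>) $$ (c mod \<sigma>, \<sigma> + j) * y j) = 0"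
    using wide_kernel[OF \<open>r * \<sigma> < d - \<sigma>\<close>, of "\<lambda>c j. C (c div \<sigma>) $$ (c mod \<sigma>, \<sigma> + j)"] by auto
  define y' where "y' = vec d (\<lambda>k. if k < \<sigma> then 0 else y (k - \<sigma>))"
  have y'c: "y' \<in> carrier_vec d" by (simp add: y'_def)
  have hy: "h *\<^sub>v y' \<in> carrier_vec d" using gc y'c by auto
  have "A ! i *\<^sub>v (h *\<^sub>v y') = 0\<^sub>v d" if i: "i < r" for i
  proof -
    have Cy: "C i *\<^sub>v y' = 0\<^sub>v d"
    proof (rule eq_vecI)
      fix p assume "p < dim_vec (0\<^sub>v d :: 'a vec)"
      then have p: "p < d" by simp
      have "(C i *\<^sub>v y') $ p = (\<Sum>q<d. C i $$ (p, q) * y' $ q)"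
        by (rule mult_mat_vec_entry[OF Cc[OF i] y'c p])
      also have "\<dots> = (\<Sum>q\<in>{\<sigma>..<d}. C i $$ (p, q) * y (q - \<sigma>))"
        by (rule sum.mono_neutral_cong_right) (auto simp: y'_def)
      also have "\<dots> = (\<Sum>j<d - \<sigma>. C i $$ (p, \<sigma> + j) * y j)"
        by (rule sum.reindex_bij_witness[of _ "\<lambda>c. \<sigma> + c" "\<lambda>c. c - \<sigma>"]) auto
      also have "\<dots> = 0"
      proof (cases "p < \<sigma>")
        case True
        have "i * \<sigma> + p < Suc i * \<sigma>" using True by simp
        also have "\<dots> \<le> r * \<sigma>" using i by (intro mult_le_mono1) simp
        finally have "i * \<sigma> + p < r * \<sigma>" .
        from y0[OF this] True show ?thesis by simp
      qed (use z[OF i p] in \<open>auto intro!: sum.neutral\<close>)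
      finally show "(C i *\<^sub>v y') $ p = 0\<^sub>v d $ p" using p by simp
    qed (use Cc[OF i] in simp)
    then have "g *\<^sub>v (A ! i *\<^sub>v (h *\<^sub>v y')) = 0\<^sub>v d"
      using conj_mult_vec[OF gh mat_tuples_D[OF T i] y'c] by (simp add: C_def)
    then have "h *\<^sub>v 0\<^sub>v d = A ! i *\<^sub>v (h *\<^sub>v y')"
      using inv_pair_mult_vec(2)[OF gh mult_mat_vec_carrier[OF mat_tuples_D[OF T i] hy]] by simp
    moreover have "h *\<^sub>v 0\<^sub>v d = 0\<^sub>v d" using gc by (intro eq_vecI) auto
    ultimately show ?thesis by simp
  qed
  then have "h *\<^sub>v y' \<in> flag_space d g \<sigma>"
    using soc hy unfolding lin_socle_def by blast
  then have "y' $ k = 0" if "\<sigma> \<le> k" "k < d" for k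
    using that inv_pair_mult_vec(1)[OF gh y'c] unfolding flag_space_def by auto
  then have "y j = 0" if "j < d - \<sigma>" for j
    using that assms(4) by (force simp: y'_def dest: spec[of _ "\<sigma> + j"])
  with y show False by blast
qed

text \<open>Dual to \<open>socle_codim_le\<close>: with more rows than columns, the blocks placed
  side by side have a nonzero left kernel vector \<open>y\<close>. As a functional it vanishes on
  the image, yet the image contains all vectors supported below \<open>\<rho>\<close> in the adapted
  basis.\<close>

lemma image_dim_le:
  assumes A: "A \<in> Rep r d" and gh: "inv_pair d g h" and "\<rho> \<le> d"
    and im: "lin_image r d A = flag_space d g \<rho>"
  shows "\<rho> \<le> r * (d - \<rho>)"
proof (rule ccontr)
  assume "\<not> \<rho> \<le> r * (d - \<rho>)"
  then have "r * (d - \<rho>) < \<rho>" by simp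
  have T: "A \<in> mat_tuples r d" using A Rep_subset_mat_tuples by blast
  have gc: "g \<in> carrier_mat d d" "h \<in> carrier_mat d d" using gh by (auto simp: inv_pair_def)
  define C where "C i = g * A ! i * h" for i
  have Cc: "C i \<in> carrier_mat d d" if "i < r" for i
    using gc mat_tuples_D[OF T that] by (simp add: C_def)
  have z: "C i $$ (p, q) = 0" if "i < r" "p < d" "q < d" "\<not> (p < \<rho> \<and> \<rho> \<le> q)" for i p q
    unfolding C_def
    by (rule conj_entry_zero[OF T gh _ _ that]) (use im lin_image_subset_socle[OF A] in auto)
  let ?n = "d - \<rho>"
  \<comment> \<open>The number \<open>c = i * (d - \<rho>) + l\<close> codes column
    \<open>\<rho> + l\<close> of block \<open>i\<close>.\<close>
  obtain y p0 where p0: "p0 < \<rho>" "y p0 \<noteq> 0"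
    and y0: "\<And>c. c < r * ?n \<Longrightarrow> (\<Sum>p<\<rho>. C (c div ?n) $$ (p, \<rho> + c mod ?n) * y p) = 0"
    using wide_kernel[OF \<open>r * ?n < \<rho>\<close>, of "\<lambda>c p. C (c div ?n) $$ (p, \<rho> + c mod ?n)"] by auto
  have ann: "(\<Sum>p<\<rho>. y p * C i $$ (p, q)) = 0" if i: "i < r" and q: "q < d" for i q
  proof (cases "\<rho> \<le> q")
    case True
    then have "i * ?n + (q - \<rho>) < Suc i * ?n" using q by simp
    also have "\<dots> \<le> r * ?n" using i by (intro mult_le_mono1) simp
    finally have "i * ?n + (q - \<rho>) < r * ?n" .
    moreover have "(i * ?n + l) div ?n = i" "(i * ?n + l) mod ?n = l" if "l < ?n" for l
      using that by auto
    then have "(i * ?n + (q - \<rho>)) div ?n = i" "(i * ?n + (q - \<rho>)) mod ?n = q - \<rho>"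
      using True q by (simp_all only: diff_less_mono)
    ultimately have "(\<Sum>p<\<rho>. C i $$ (p, \<rho> + (q - \<rho>)) * y p) = 0" using y0 by metis
    then show ?thesis using True by (simp add: mult.commute)
  qed (use z i q \<open>\<rho> \<le> d\<close> in \<open>auto intro!: sum.neutral\<close>)
  have "h *\<^sub>v unit_vec d p0 \<in> lin_image r d A"
    using im inv_pair_mult_vec(1)[OF gh, of "unit_vec d p0"] gc p0
    by (auto simp: flag_space_def simp del: index_mult_mat_vec)
  then obtain x where x: "\<And>i. i < r \<Longrightarrow> x i \<in> carrier_vec d"
    "h *\<^sub>v unit_vec d p0 = vec d (\<lambda>k. \<Sum>i<r. (A ! i *\<^sub>v x i) $ k)"
    unfolding lin_image_def by blast
  have gx: "g *\<^sub>v x i \<in> carrier_vec d" if "i < r" for i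
    using gc x(1)[OF that] by auto
  have e: "unit_vec d p0 $ p = (\<Sum>i<r. \<Sum>q<d. C i $$ (p, q) * (g *\<^sub>v x i) $ q)" if p: "p < d" for p
  proof -
    have "unit_vec d p0 $ p = (g *\<^sub>v vec d (\<lambda>k. \<Sum>i<r. (A ! i *\<^sub>v x i) $ k)) $ p"
      using inv_pair_mult_vec(1)[OF gh, of "unit_vec d p0"] x(2) by simp
    also have "\<dots> = (\<Sum>i<r. (g *\<^sub>v (A ! i *\<^sub>v x i)) $ p)"
      by (rule mult_mat_vec_sum[OF gc(1) _ p])
         (use mat_tuples_D[OF T] x(1) in \<open>auto intro: mult_mat_vec_carrier\<close>)
    also have "\<dots> = (\<Sum>i<r. (C i *\<^sub>v (g *\<^sub>v x i)) $ p)"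
      using conj_mult_vec[OF gh mat_tuples_D[OF T] gx] inv_pair_mult_vec(2)[OF gh x(1)]
      by (intro sum.cong refl) (simp add: C_def)
    also have "\<dots> = (\<Sum>i<r. \<Sum>q<d. C i $$ (p, q) * (g *\<^sub>v x i) $ q)"
      by (intro sum.cong refl mult_mat_vec_entry[OF Cc gx p]) auto
    finally show ?thesis .
  qed
  \<comment> \<open>The functional \<open>y\<close> is evaluated at the unit vector at
    \<open>p0\<close>, once directly and once through its presentation as an element of the
    image.\<close>
  have "y p0 = (\<Sum>p<\<rho>. y p * unit_vec d p0 $ p)"
    using p0 \<open>\<rho> \<le> d\<close> by (subst sum.remove[of _ p0]) (auto intro!: sum.neutral)
  also have "\<dots> = (\<Sum>p<\<rho>. \<Sum>i<r. \<Sum>q<d. y p * C i $$ (p, q) * (g *\<^sub>v x i) $ q)"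
    using \<open>\<rho> \<le> d\<close> by (intro sum.cong refl) (simp only: e lessThan_iff sum_distrib_left mult.assoc)
  also have "\<dots> = (\<Sum>i<r. \<Sum>p<\<rho>. \<Sum>q<d. y p * C i $$ (p, q) * (g *\<^sub>v x i) $ q)"
    by (rule sum.swap)
  also have "\<dots> = (\<Sum>i<r. \<Sum>q<d. \<Sum>p<\<rho>. y p * C i $$ (p, q) * (g *\<^sub>v x i) $ q)"
    by (intro sum.cong refl sum.swap)
  also have "\<dots> = (\<Sum>i<r. \<Sum>q<d. (\<Sum>p<\<rho>. y p * C i $$ (p, q)) * (g *\<^sub>v x i) $ q)"
    by (simp only: sum_distrib_right)
  also have "\<dots> = 0" by (intro sum.neutral ballI) (simp add: ann)
  finally show False using p0 by simp
qed

lemma Rep_covered_by_block_reps: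
  assumes A: "A \<in> Rep r d" and u: "\<And>v. d \<le> (r + 1) * v \<Longrightarrow> u \<le> v" "u \<le> d - u"
  shows "\<exists>m. u \<le> m \<and> m \<le> d - u \<and> A \<in> block_rep r d m"
proof -
  obtain g h \<rho> \<sigma> where gh: "inv_pair d g h" "\<rho> \<le> \<sigma>" "\<sigma> \<le> d"
    "lin_image r d A = flag_space d g \<rho>" "lin_socle r d A = flag_space d g \<sigma>"
    using Rep_normal_form[OF A] by blast
  have "d - \<sigma> \<le> r * \<sigma>" by (rule socle_codim_le[OF A gh])
  then have "u \<le> \<sigma>" using gh(3) by (intro u(1)) simp
  have "\<rho> \<le> r * (d - \<rho>)" by (rule image_dim_le[OF A gh(1) _ gh(4)]) (use gh in simp)
  then have "u \<le> d - \<rho>" using gh(2,3) by (intro u(1)) simp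
  \<comment> \<open>At least \<open>\<rho>\<close> and at most \<open>\<sigma>\<close>, so that
    level \<open>?m\<close> lies between image and socle; also at most \<open>d - u\<close>, since
    both \<open>\<rho>\<close> and \<open>u\<close> are.\<close>
  let ?m = "max \<rho> u"
  have "A \<in> block_rep r d ?m"
    unfolding gh(4,5)[symmetric]
    using gh(2) \<open>u \<le> \<sigma>\<close> subsetD[OF Rep_subset_mat_tuples A]
    by (intro block_repI[OF _ gh(1)]) (simp_all add: gh(4,5) flag_space_mono)
  moreover have "?m \<le> d - u" using u(2) \<open>u \<le> d - \<rho>\<close> gh(2,3) by auto
  ultimately show ?thesis by (intro exI[of _ ?m]) simp
qed

text \<open>Image and socle are both admissible choices of \<open>W\<close>, so \<open>A\<close>
  lies in the block sets for \<open>\<rho>\<close> and for \<open>\<sigma>\<close>. The rank bounds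
  give \<open>m \<le> \<rho>\<close> and \<open>\<sigma> \<le> m\<close>, and
  \<open>\<rho> \<le> \<sigma>\<close> forces equality.\<close>

lemma rank_conditions_normal_form:
  assumes A: "A \<in> Rep r d" and "m \<le> d" "hrank_ge r d m A" "vrank_ge r d (d - m) A"
  obtains g h where "inv_pair d g h" "lin_image r d A = flag_space d g m"
    "lin_socle r d A = flag_space d g m"
proof -
  obtain g h \<rho> \<sigma> where gh: "inv_pair d g h" "\<rho> \<le> \<sigma>" "\<sigma> \<le> d"
    "lin_image r d A = flag_space d g \<rho>" "lin_socle r d A = flag_space d g \<sigma>"
    using Rep_normal_form[OF A] by blast
  have T: "A \<in> mat_tuples r d" using A Rep_subset_mat_tuples by blast
  have "A \<in> block_rep r d \<rho>" "A \<in> block_rep r d \<sigma>"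
    using gh(2) by (simp_all add: block_repI[OF T gh(1)] gh(4,5) flag_space_mono)
  then have "m \<le> \<rho>" "d - m \<le> d - \<sigma>"
    using block_rep_hrank block_rep_vrank assms(3,4) gh(2,3) by (metis le_trans)+
  then have "\<rho> = m" "\<sigma> = m" using gh(2,3) assms(2) by auto
  then show ?thesis using that gh by blast
qed

section \<open>Existence of tuples of full rank\<close>

lemma contraction_delta:
  assumes "i0 < r" "p0 < d" "q0 < d"
    and "\<And>i p q. P i a p * Q i q b = (if i = i0 \<and> p = p0 \<and> q = q0 then 1 else 0)"
  shows "contraction r d P Q A a b = A ! i0 $$ (p0, q0)"
proof -
  have "contraction r d P Q A a b = (\<Sum>i<r. \<Sum>p<d. \<Sum>q<d.
      (if q = q0 then if p = p0 then if i = i0 then A ! i0 $$ (p0, q0) else 0 else 0 else 0))"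
    unfolding contraction_def
  proof (intro sum.cong refl)
    fix i p q
    have "P i a p * A ! i $$ (p, q) * Q i q b = (P i a p * Q i q b) * A ! i $$ (p, q)"
      by (simp only: ac_simps)
    also have "\<dots> =
      (if q = q0 then if p = p0 then if i = i0 then A ! i0 $$ (p0, q0) else 0 else 0 else 0)"
      unfolding assms(4) by simp
    finally show "P i a p * A ! i $$ (p, q) * Q i q b =
      (if q = q0 then if p = p0 then if i = i0 then A ! i0 $$ (p0, q0) else 0 else 0 else 0)" .
  qed
  then show ?thesis using assms(1-3) by simp
qed

lemma det_mat_delta:
  assumes "\<And>a b. a < n \<Longrightarrow> b < n \<Longrightarrow> M a b = (if a = b then 1 else 0)"
  shows "det (mat n n (\<lambda>(a, b). M a b)) = (1 :: 'a::field)"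
proof -
  have "mat n n (\<lambda>(a, b). M a b) = 1\<^sub>m n" by (intro eq_matI) (auto simp: assms)
  then show ?thesis by simp
qed

text \<open>An identity minor of [A_1 | ... | A_r] in its first \<open>n\<close> rows certifies the
  rank; its columns are named by pairs of a matrix index \<open>ib b\<close> and a column index
  \<open>qb b\<close>. The coefficients select exactly this minor.\<close>

lemma hrank_geI:
  assumes "\<And>b. b < n \<Longrightarrow> ib b < r \<and> qb b < d" "n \<le> d"
    and "\<And>a b. a < n \<Longrightarrow> b < n \<Longrightarrow> A ! ib b $$ (a, qb b) = (if a = b then 1 else 0)"
  shows "hrank_ge r d n (A :: 'k::field mat list)"
proof -
  let ?P = "\<lambda>a p. if p = a then 1 else 0 :: 'k"
  let ?Q = "\<lambda>i q b. if i = ib b \<and> q = qb b then 1 else 0 :: 'k"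
  have "contraction r d (\<lambda>i. ?P) ?Q A a b = (if a = b then 1 else 0)" if "a < n" "b < n" for a b
    using contraction_delta[of "ib b" r a d "qb b" "\<lambda>i. ?P" a ?Q b A] assms that by auto
  then have "det (mat n n (\<lambda>(a, b). contraction r d (\<lambda>i. ?P) ?Q A a b)) = 1"
    by (rule det_mat_delta)
  then show ?thesis unfolding hrank_ge_def by (metis zero_neq_one)
qed

lemma vrank_geI:
  assumes "\<And>a. a < n \<Longrightarrow> ia a < r \<and> pa a < d" "m + n \<le> d"
    and "\<And>a b. a < n \<Longrightarrow> b < n \<Longrightarrow> A ! ia a $$ (pa a, m + b) = (if a = b then 1 else 0)"
  shows "vrank_ge r d n (A :: 'k::field mat list)"
proof -
  let ?P = "\<lambda>i a p. if i = ia a \<and> p = pa a then 1 else 0 :: 'k"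
  let ?Q = "\<lambda>q b. if q = m + b then 1 else 0 :: 'k"
  have "contraction r d ?P (\<lambda>i. ?Q) A a b = (if a = b then 1 else 0)" if "a < n" "b < n" for a b
    using contraction_delta[of "ia a" r "pa a" d "m + b" ?P a "\<lambda>i. ?Q" b A] assms that by auto
  then have "det (mat n n (\<lambda>(a, b). contraction r d ?P (\<lambda>i. ?Q) A a b)) = 1"
    by (rule det_mat_delta)
  then show ?thesis unfolding vrank_ge_def by (metis zero_neq_one)
qed

text \<open>The two inequalities allow 0/1 blocks of size \<open>m\<close> x \<open>(d - m)\<close>
  for which the larger of the two sizes is covered by distributing unit vectors over the
  \<open>r\<close> blocks and the smaller one already by block 0.\<close>

lemma block_rep_full_rank_exists:
  assumes "0 < r" "m \<le> d" "m \<le> r * (d - m)" "d - m \<le> r * m"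
  shows "\<exists>A :: 'k::field mat list. A \<in> block_rep r d m \<and> hrank_ge r d m A \<and> vrank_ge r d (d - m) A"
proof -
  define n where "n = d - m"
  have d: "d = m + n" using assms(2) by (simp add: n_def)
  \<comment> \<open>If \<open>m \<le> n\<close>, row \<open>p\<close> of block \<open>i\<close> is
    the unit row at \<open>i * m + p\<close>, or zero once this exceeds the block: stacking gives
    all \<open>n\<close> unit rows, and block 0 contains the identity of size \<open>m\<close>.
    Otherwise the same is done with columns.\<close>
  define E where "E i p q = (if m \<le> n then q = m + (i * m + p) else p = i * n + (q - m))" for i p q
  define A :: "'k mat list" where
    "A = map (\<lambda>i. mat d d (\<lambda>(p, q). if p < m \<and> m \<le> q \<and> E i p q then 1 else 0)) [0..<r]"
  have Ai: "A ! i $$ (p, q) = (if p < m \<and> m \<le> q \<and> E i p q then 1 else 0)"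
    if "i < r" "p < d" "q < d" for i p q
    using that by (simp add: A_def)
  have T: "A \<in> mat_tuples r d" by (auto simp: mat_tuples_def A_def)
  have "1\<^sub>m d * A ! i * 1\<^sub>m d = A ! i" if "i < r" for i
    using mat_tuples_D[OF T that] by simp
  then have block: "A \<in> block_rep r d m"
    unfolding block_rep_def
    by (intro CollectI conjI T exI[of _ "1\<^sub>m d"] inv_pair_one allI impI) (auto simp: Ai)
  have divmod: "c div k < r \<and> c mod k < k" if "c < r * k" for c k
    using that by (cases "k = 0") (auto simp: less_mult_imp_div_less)
  show ?thesis
  proof (cases "m \<le> n")
    case True
    have E: "E i p q \<longleftrightarrow> q = m + (i * m + p)" for i p q using True by (simp add: E_def)
    have "hrank_ge r d m A"
    proof (rule hrank_geI[where ib = "\<lambda>b. 0" and qb = "\<lambda>b. m + b"])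
      fix a b assume "a < m" "b < m"
      then show "A ! 0 $$ (a, m + b) = (if a = b then 1 else 0)"
        using True assms(1) d by (subst Ai) (auto simp: E)
    qed (use True assms(1) d in auto)
    moreover have "vrank_ge r d n A"
    proof (rule vrank_geI[where ia = "\<lambda>a. a div m" and pa = "\<lambda>a. a mod m" and m = m])
      have "a div m < r \<and> a mod m < m" if "a < n" for a
        using that assms(4) n_def by (intro divmod) simp
      note dm = this
      show "a div m < r \<and> a mod m < d" if "a < n" for a using dm[OF that] d by simp
      fix a b assume ab: "a < n" "b < n"
      show "A ! (a div m) $$ (a mod m, m + b) = (if a = b then 1 else 0)"
        using dm[OF ab(1)] ab d by (subst Ai) (auto simp: E)
    qed (use d in simp)
    ultimately show ?thesis using block n_def by blast
  next
    case False
    have E: "E i p q \<longleftrightarrow> p = i * n + (q - m)" for i p q using False by (simp add: E_def)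
    have "hrank_ge r d m A"
    proof (rule hrank_geI[where ib = "\<lambda>b. b div n" and qb = "\<lambda>b. m + b mod n"])
      have "b div n < r \<and> b mod n < n" if "b < m" for b
        using that assms(3) n_def by (intro divmod) simp
      note dm = this
      show "b div n < r \<and> m + b mod n < d" if "b < m" for b using dm[OF that] d by simp
      fix a b assume ab: "a < m" "b < m"
      show "A ! (b div n) $$ (a, m + b mod n) = (if a = b then 1 else 0)"
        using dm[OF ab(2)] ab d by (subst Ai) (auto simp: E)
    qed (use d in simp)
    moreover have "vrank_ge r d n A"
    proof (rule vrank_geI[where ia = "\<lambda>a. 0" and pa = "\<lambda>a. a" and m = m])
      fix a b assume "a < n" "b < n"
      then show "A ! 0 $$ (a, m + b) = (if a = b then 1 else 0)"
        using False assms(1) d by (subst Ai) (auto simp: E)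
    qed (use False assms(1) d in auto)
    ultimately show ?thesis using block n_def by blast
  qed
qed

section \<open>The ring and its simple module\<close>

definition lam_class :: "nat \<Rightarrow> (nat list \<Rightarrow> 'k::field) \<Rightarrow> (nat list \<Rightarrow> 'k) set" where
  "lam_class r f = rel_ideal r +>\<^bsub>path_algebra r\<^esub> f"

text \<open>The algebra homomorphism from Lambda to K that kills the loops. The chosen
  representative does not matter, since elements of \<open>rel_ideal\<close> vanish at the empty
  path.\<close>

definition augmentation :: "(nat list \<Rightarrow> 'k::field) set \<Rightarrow> 'k" where
  "augmentation X = (SOME f. f \<in> X) []"

definition scalar_elem :: "'k::field \<Rightarrow> nat list \<Rightarrow> 'k" where
  "scalar_elem c = (\<lambda>w. if w = [] then c else 0)"

lemma scalar_elem_closed: "scalar_elem c \<in> carrier (path_algebra r)"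
  by (simp add: path_algebra_simps scalar_elem_def)

lemma carrier_Lambda: "carrier (Lambda_alg r) = lam_class r ` carrier (path_algebra r)"
  by (auto simp: Lambda_alg_def FactRing_def A_RCOSETS_def' lam_class_def)

lemma carrier_LambdaE:
  assumes "X \<in> carrier (Lambda_alg r)"
  obtains f where "f \<in> carrier (path_algebra r)" "X = lam_class r f"
  using assms unfolding carrier_Lambda by blast

lemma lam_class_closed: "f \<in> carrier (path_algebra r) \<Longrightarrow> lam_class r f \<in> carrier (Lambda_alg r)"
  unfolding carrier_Lambda by blast

text \<open>By \<open>rel_ideal_eq\<close> the ideal consists of all combinations of paths of length
  at least 2, so the vertex and the loops form a basis of Lambda.\<close>

lemma lam_class_eqI:
  fixes f g :: "nat list \<Rightarrow> 'k::field"
  assumes "f \<in> carrier (path_algebra r)" "g \<in> carrier (path_algebra r)"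
    and "\<And>w. length w \<le> 1 \<Longrightarrow> f w = g w"
  shows "lam_class r f = lam_class r g"
proof -
  let ?R = "path_algebra r :: (nat list \<Rightarrow> 'k) ring"
  interpret R: ring ?R by (rule path_algebra_ring)
  let ?d = "f \<ominus>\<^bsub>?R\<^esub> g"
  have "?d \<oplus>\<^bsub>?R\<^esub> g = f"
    using assms by (simp add: R.minus_eq R.a_assoc R.l_neg)
  then have "?d w + g w = f w" for w
    by (simp add: path_algebra_simps(5) fun_eq_iff)
  then have "?d w = 0" if "length w \<le> 1" for w
    using assms(3)[OF that] by (metis add_cancel_left_left)
  then have "?d \<in> rel_ideal r" unfolding rel_ideal_eq using assms by auto
  then show ?thesis
    unfolding lam_class_def using R.quotient_eq_iff_same_a_r_cos[OF rel_ideal_ideal assms(1,2)] by simp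
qed

lemma augmentation_lam_class:
  fixes f :: "nat list \<Rightarrow> 'k::field"
  assumes "f \<in> carrier (path_algebra r)"
  shows "augmentation (lam_class r f) = f []"
proof -
  let ?R = "path_algebra r :: (nat list \<Rightarrow> 'k) ring"
  let ?X = "lam_class r f"
  interpret R: ring ?R by (rule path_algebra_ring)
  interpret I: ideal "rel_ideal r" ?R by (rule rel_ideal_ideal)
  define g where "g = (SOME g. g \<in> ?X)"
  have "g \<in> ?X"
    unfolding g_def lam_class_def
    by (rule someI[of "\<lambda>g. g \<in> rel_ideal r +>\<^bsub>?R\<^esub> f"]) (rule I.a_rcos_self[OF assms])
  then obtain h where h: "h \<in> rel_ideal r" "g = h \<oplus>\<^bsub>?R\<^esub> f"
    unfolding a_r_coset_def' lam_class_def by blast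
  have "h [] = 0" using h(1) unfolding rel_ideal_eq by simp
  then have "g [] = f []" unfolding h(2) path_algebra_simps by simp
  then show ?thesis by (simp add: augmentation_def g_def)
qed

lemma augmentation_scalar: "augmentation (lam_class r (scalar_elem c)) = c"
  by (subst augmentation_lam_class[OF scalar_elem_closed]) (simp add: scalar_elem_def)

lemma lam_class_add:
  assumes "f \<in> carrier (path_algebra r)" "g \<in> carrier (path_algebra r)"
  shows "lam_class r f \<oplus>\<^bsub>Lambda_alg r\<^esub> lam_class r g = lam_class r (f \<oplus>\<^bsub>path_algebra r\<^esub> g)"
proof -
  interpret I: ideal "rel_ideal r" "path_algebra r" by (rule rel_ideal_ideal)
  show ?thesis using assms by (simp add: lam_class_def Lambda_alg_def FactRing_def I.a_rcos_sum)
qed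

lemma lam_class_mult:
  assumes "f \<in> carrier (path_algebra r)" "g \<in> carrier (path_algebra r)"
  shows "lam_class r f \<otimes>\<^bsub>Lambda_alg r\<^esub> lam_class r g = lam_class r (f \<otimes>\<^bsub>path_algebra r\<^esub> g)"
proof -
  interpret I: ideal "rel_ideal r" "path_algebra r" by (rule rel_ideal_ideal)
  show ?thesis using assms by (simp add: lam_class_def Lambda_alg_def FactRing_def I.rcoset_mult_add)
qed

lemma lam_class_one: "lam_class r \<one>\<^bsub>path_algebra r\<^esub> = \<one>\<^bsub>Lambda_alg r\<^esub>"
  by (simp add: lam_class_def Lambda_alg_def FactRing_def)

lemma lam_class_zero: "lam_class r \<zero>\<^bsub>path_algebra r\<^esub> = \<zero>\<^bsub>Lambda_alg r\<^esub>"
proof -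
  interpret R: ring "path_algebra r" by (rule path_algebra_ring)
  interpret I: ideal "rel_ideal r" "path_algebra r" by (rule rel_ideal_ideal)
  have "rel_ideal r +>\<^bsub>path_algebra r\<^esub> \<zero>\<^bsub>path_algebra r\<^esub> = rel_ideal r"
    by (rule R.a_coset_join2[OF R.zero_closed I.a_subgroup I.zero_closed])
  then show ?thesis by (simp add: lam_class_def Lambda_alg_def FactRing_def)
qed

lemma augmentation_hom:
  fixes X Y :: "(nat list \<Rightarrow> 'k::field) set"
  assumes "X \<in> carrier (Lambda_alg r)" "Y \<in> carrier (Lambda_alg r)"
  shows "augmentation (X \<oplus>\<^bsub>Lambda_alg r\<^esub> Y) = augmentation X + augmentation Y"
    "augmentation (X \<otimes>\<^bsub>Lambda_alg r\<^esub> Y) = augmentation X * augmentation Y"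
    "augmentation \<one>\<^bsub>Lambda_alg r\<^esub> = (1 :: 'k)" "augmentation \<zero>\<^bsub>Lambda_alg r\<^esub> = (0 :: 'k)"
proof -
  interpret R: ring "path_algebra r :: (nat list \<Rightarrow> 'k) ring" by (rule path_algebra_ring)
  obtain f g where f: "f \<in> carrier (path_algebra r)" "X = lam_class r f"
    and g: "g \<in> carrier (path_algebra r)" "Y = lam_class r g"
    using assms by (metis carrier_LambdaE)
  show "augmentation (X \<oplus>\<^bsub>Lambda_alg r\<^esub> Y) = augmentation X + augmentation Y"
    using f g by (simp add: lam_class_add augmentation_lam_class) (simp add: path_algebra_simps(5))
  show "augmentation (X \<otimes>\<^bsub>Lambda_alg r\<^esub> Y) = augmentation X * augmentation Y"
    using f g by (simp add: lam_class_mult augmentation_lam_class) (simp add: path_algebra_simps(2))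
  show "augmentation \<one>\<^bsub>Lambda_alg r\<^esub> = (1 :: 'k)"
    unfolding lam_class_one[symmetric]
    by (subst augmentation_lam_class) (simp_all, simp add: path_algebra_simps(3))
  show "augmentation \<zero>\<^bsub>Lambda_alg r\<^esub> = (0 :: 'k)"
    unfolding lam_class_zero[symmetric]
    by (subst augmentation_lam_class) (simp_all, simp add: path_algebra_simps(4))
qed

text \<open>This is J^2 = 0, once \<open>jacobson_radical_Lambda\<close> has identified J with the
  kernel of the augmentation: each word of length at most 1 in a product has an empty
  factor.\<close>

lemma aug_zero_mult:
  fixes X Y :: "(nat list \<Rightarrow> 'k::field) set"
  assumes "X \<in> carrier (Lambda_alg r)" "Y \<in> carrier (Lambda_alg r)"
    and "augmentation X = 0" "augmentation Y = 0"
  shows "X \<otimes>\<^bsub>Lambda_alg r\<^esub> Y = \<zero>\<^bsub>Lambda_alg r\<^esub>"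
proof -
  interpret R: ring "path_algebra r :: (nat list \<Rightarrow> 'k) ring" by (rule path_algebra_ring)
  obtain f g where f: "f \<in> carrier (path_algebra r)" "X = lam_class r f"
    and g: "g \<in> carrier (path_algebra r)" "Y = lam_class r g"
    using assms(1,2) by (metis carrier_LambdaE)
  have 0: "f [] = 0" "g [] = 0" using assms f g by (simp_all add: augmentation_lam_class)
  have "(f \<otimes>\<^bsub>path_algebra r\<^esub> g) w = \<zero>\<^bsub>path_algebra r\<^esub> w" if "length w \<le> 1" for w
  proof (cases w)
    case (Cons i w')
    with that have "w = [i]" by simp
    then show ?thesis by (simp add: path_algebra_simps 0)
  qed (simp add: path_algebra_simps 0)
  then have "lam_class r (f \<otimes>\<^bsub>path_algebra r\<^esub> g) = lam_class r \<zero>\<^bsub>path_algebra r\<^esub>"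
    using f g by (intro lam_class_eqI) auto
  then show ?thesis using f g by (simp add: lam_class_mult lam_class_zero)
qed

text \<open>The kernel of the augmentation is maximal because the quotient is K. It lies in every
  maximal ideal because such an ideal is prime and the elements of the kernel have square
  zero.\<close>

lemma jacobson_radical_Lambda:
  "jacobson_radical (Lambda_alg r) =
     {X \<in> carrier (Lambda_alg r). augmentation X = (0 :: 'k::field)}" (is "_ = ?J")
proof -
  let ?L = "Lambda_alg r :: (nat list \<Rightarrow> 'k) set ring"
  interpret L: cring ?L by (rule Lambda_alg_cring)
  note aug = augmentation_hom[of _ r]
  have minus: "augmentation (\<ominus>\<^bsub>?L\<^esub> X) = - augmentation X" if "X \<in> carrier ?L" for X
    using aug(1)[OF that L.a_inv_closed[OF that]] aug(4)[OF that that] L.r_neg[OF that]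
    by (simp add: eq_neg_iff_add_eq_0 add.commute)
  have ideal: "ideal ?J ?L"
  proof (rule idealI[OF L.ring_axioms])
    show "subgroup ?J (add_monoid ?L)"
    proof (rule group.subgroupI)
      show "group (add_monoid ?L)" by (rule L.add.is_group)
      show "?J \<noteq> {}" using aug(4)[OF L.zero_closed L.zero_closed] L.zero_closed by blast
      fix X assume "X \<in> ?J"
      then show "inv\<^bsub>add_monoid ?L\<^esub> X \<in> ?J"
        using minus[of X] L.a_inv_closed[of X] by (auto simp: a_inv_def)
    qed (auto simp: aug)
  qed (auto simp: aug)
  have max: "maximalideal ?J ?L"
  proof (rule maximalidealI[OF ideal])
    show "carrier ?L \<noteq> ?J" using aug(3)[OF L.zero_closed L.zero_closed] L.one_closed by force
    fix J assume J: "ideal J ?L" "?J \<subseteq> J" "J \<subseteq> carrier ?L"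
    interpret J: ideal J ?L by (rule J(1))
    show "J = ?J \<or> J = carrier ?L"
    proof (cases "J \<subseteq> ?J")
      case False
      then obtain X where X: "X \<in> J" "augmentation X \<noteq> 0" using J(3) by blast
      \<comment> \<open>\<open>X\<close> is scaled to augmentation 1; then \<open>1 - Y\<close> is
        in the kernel and \<open>1\<close> in the ideal.\<close>
      define Y where "Y = lam_class r (scalar_elem (1 / augmentation X)) \<otimes>\<^bsub>?L\<^esub> X"
      have sc: "lam_class r (scalar_elem c) \<in> carrier ?L" for c
        by (rule lam_class_closed[OF scalar_elem_closed])
      have Y: "Y \<in> J" "augmentation Y = 1"
        using X J(3) J.I_l_closed[OF X(1) sc]
        by (auto simp: Y_def aug(2)[OF sc] augmentation_scalar)
      then have Yc: "Y \<in> carrier ?L" using J(3) by blast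
      have "augmentation (\<one>\<^bsub>?L\<^esub> \<oplus>\<^bsub>?L\<^esub> \<ominus>\<^bsub>?L\<^esub> Y) = 0"
        using Yc Y(2) by (simp add: aug(1) minus aug(3)[OF Yc Yc])
      then have "\<one>\<^bsub>?L\<^esub> \<oplus>\<^bsub>?L\<^esub> \<ominus>\<^bsub>?L\<^esub> Y \<in> J" using J(2) Yc by auto
      then have "(\<one>\<^bsub>?L\<^esub> \<oplus>\<^bsub>?L\<^esub> \<ominus>\<^bsub>?L\<^esub> Y) \<oplus>\<^bsub>?L\<^esub> Y \<in> J" using Y(1) by (rule J.a_closed)
      then have "\<one>\<^bsub>?L\<^esub> \<in> J" using Yc by (simp add: L.a_assoc L.l_neg)
      then show ?thesis using J.one_imp_carrier by blast
    qed (use J(2) in blast)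
  qed
  have "?J \<subseteq> I" if "maximalideal I ?L" for I
  proof
    fix X assume X: "X \<in> ?J"
    interpret I: primeideal I ?L using that by (rule L.maximalideal_prime)
    have "X \<otimes>\<^bsub>?L\<^esub> X \<in> I" using X aug_zero_mult[of X r X] I.zero_closed by simp
    then show "X \<in> I" using X I.I_prime by blast
  qed
  then show ?thesis unfolding jacobson_radical_def using max by blast
qed

text \<open>The radical annihilates \<open>S\<close>, so Lambda acts through the augmentation. The
  K-multiples of a nonzero \<open>x\<close> then form a nonzero submodule, hence all of
  \<open>S\<close>: it is K with coordinate map \<open>c\<close>, where
  \<open>c a = a x\<close>.\<close>

lemma simple_module_coordinates:
  fixes S :: "((nat list \<Rightarrow> 'k::field) set, 's) module"
  assumes "simple_module (Lambda_alg r) S"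
  obtains c :: "'k \<Rightarrow> 's" where "bij_betw c UNIV (carrier S)"
    "\<And>a b. c (a + b) = c a \<oplus>\<^bsub>S\<^esub> c b"
    "\<And>X a. X \<in> carrier (Lambda_alg r) \<Longrightarrow> X \<odot>\<^bsub>S\<^esub> c a = c (augmentation X * a)"
proof -
  let ?L = "Lambda_alg r :: (nat list \<Rightarrow> 'k) set ring"
  interpret S: module ?L S using assms by (simp add: simple_module_def)
  interpret R: ring "path_algebra r :: (nat list \<Rightarrow> 'k) ring" by (rule path_algebra_ring)
  have nz: "carrier S \<noteq> {\<zero>\<^bsub>S\<^esub>}" and simple: "\<And>N. submodule N ?L S \<Longrightarrow> N = {\<zero>\<^bsub>S\<^esub>} \<or> N = carrier S"
    using assms by (auto simp: simple_module_def)
  define N where "N = {s \<in> carrier S. \<forall>X\<in>carrier ?L. augmentation X = 0 \<longrightarrow> X \<odot>\<^bsub>S\<^esub> s = \<zero>\<^bsub>S\<^esub>}"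
  have "submodule N ?L S"
  proof (rule S.submoduleI)
    fix X s assume X: "X \<in> carrier ?L" and s: "s \<in> N"
    have "Y \<odot>\<^bsub>S\<^esub> (X \<odot>\<^bsub>S\<^esub> s) = \<zero>\<^bsub>S\<^esub>" if Y: "Y \<in> carrier ?L" "augmentation Y = 0" for Y
    proof -
      have "Y \<odot>\<^bsub>S\<^esub> (X \<odot>\<^bsub>S\<^esub> s) = X \<odot>\<^bsub>S\<^esub> (Y \<odot>\<^bsub>S\<^esub> s)"
        using X Y s S.smult_assoc1[of X Y s] S.smult_assoc1[of Y X s] S.m_comm[of X Y]
        by (simp add: N_def)
      moreover have "Y \<odot>\<^bsub>S\<^esub> s = \<zero>\<^bsub>S\<^esub>" using Y s by (simp add: N_def)
      ultimately show ?thesis using X by (metis S.smult_r_null)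
    qed
    then show "X \<odot>\<^bsub>S\<^esub> s \<in> N" using X s by (simp add: N_def)
  qed (auto simp: N_def S.smult_r_distr S.smult_r_minus)
  then have "N = carrier S"
  proof (rule disjE[OF simple])
    \<comment> \<open>\<open>N\<close> is the part of \<open>S\<close> killed by the radical. For
      any \<open>x\<close> the elements of J x lie in \<open>N\<close>, by J^2 = 0; if
      \<open>N\<close> is zero, then \<open>x\<close> itself lies in \<open>N\<close>.\<close>
    assume N0: "N = {\<zero>\<^bsub>S\<^esub>}"
    obtain x where x: "x \<in> carrier S" "x \<noteq> \<zero>\<^bsub>S\<^esub>" using nz S.zero_closed by blast
    have "X \<odot>\<^bsub>S\<^esub> x \<in> N" if "X \<in> carrier ?L" "augmentation X = 0" for X
      using that x by (auto simp: N_def S.smult_assoc1[symmetric] aug_zero_mult[of _ r])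
    then have "X \<odot>\<^bsub>S\<^esub> x = \<zero>\<^bsub>S\<^esub>" if "X \<in> carrier ?L" "augmentation X = 0" for X
      using N0 that by blast
    then have "x \<in> N" using x(1) by (simp add: N_def)
    then show ?thesis using N0 x by simp
  qed
  then have ann: "X \<odot>\<^bsub>S\<^esub> s = \<zero>\<^bsub>S\<^esub>" if "X \<in> carrier ?L" "augmentation X = 0" "s \<in> carrier S" for X s
    using that unfolding N_def by blast
  obtain x where x: "x \<in> carrier S" "x \<noteq> \<zero>\<^bsub>S\<^esub>" using nz S.zero_closed by blast
  let ?k = "\<lambda>a. lam_class r (scalar_elem a)"
  define c where "c a = ?k a \<odot>\<^bsub>S\<^esub> x" for a
  have k: "?k a \<in> carrier ?L" for a by (rule lam_class_closed[OF scalar_elem_closed])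
  have k_add: "?k (a + b) = ?k a \<oplus>\<^bsub>?L\<^esub> ?k b" for a b
    by (subst lam_class_add[OF scalar_elem_closed scalar_elem_closed], rule arg_cong[where f = "lam_class r"])
       (auto simp: path_algebra_simps scalar_elem_def)
  have c_add: "c (a + b) = c a \<oplus>\<^bsub>S\<^esub> c b" for a b
    unfolding c_def k_add using k x by (simp add: S.smult_l_distr)
  have c_smult: "X \<odot>\<^bsub>S\<^esub> c a = c (augmentation X * a)" if X: "X \<in> carrier ?L" for X a
  proof -
    \<comment> \<open>\<open>?D\<close> measures the difference between \<open>X\<close> and its
      augmentation on the multiple \<open>a\<close> of \<open>x\<close>; it has augmentation 0 and
      so kills \<open>x\<close>.\<close>
    let ?D = "(X \<otimes>\<^bsub>?L\<^esub> ?k a) \<ominus>\<^bsub>?L\<^esub> ?k (augmentation X * a)"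
    have D: "X \<otimes>\<^bsub>?L\<^esub> ?k a = ?D \<oplus>\<^bsub>?L\<^esub> ?k (augmentation X * a)"
      using X k by (simp add: S.R.minus_eq S.R.a_assoc S.R.l_neg)
    have Dc: "?D \<in> carrier ?L" using X k by simp
    have "augmentation (X \<otimes>\<^bsub>?L\<^esub> ?k a) = augmentation ?D + augmentation (?k (augmentation X * a))"
      using arg_cong[OF D, of augmentation] unfolding augmentation_hom(1)[OF Dc k] .
    then have "augmentation ?D = 0"
      using augmentation_hom(2)[OF X k]
      by (simp add: augmentation_scalar)
    then have "?D \<odot>\<^bsub>S\<^esub> x = \<zero>\<^bsub>S\<^esub>" using ann Dc x by blast
    then have "(X \<otimes>\<^bsub>?L\<^esub> ?k a) \<odot>\<^bsub>S\<^esub> x = ?k (augmentation X * a) \<odot>\<^bsub>S\<^esub> x"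
      using Dc k x by (subst D) (simp add: S.smult_l_distr)
    then show ?thesis using X k x by (simp add: c_def S.smult_assoc1)
  qed
  have k1: "?k 1 = \<one>\<^bsub>?L\<^esub>"
    unfolding lam_class_one[symmetric] by (rule arg_cong[where f = "lam_class r"])
      (auto simp: path_algebra_simps scalar_elem_def)
  have c1: "c 1 = x" using x by (simp add: c_def k1)
  have c0: "c 0 = \<zero>\<^bsub>S\<^esub>"
  proof -
    have "c 0 \<oplus>\<^bsub>S\<^esub> c 0 = c 0" using c_add[of 0 0] by simp
    moreover have "c 0 \<in> carrier S" using k x by (simp add: c_def)
    ultimately show ?thesis by (metis S.M.add.l_cancel_one)
  qed
  have c_minus: "\<ominus>\<^bsub>S\<^esub> c a = c (- a)" for a
  proof -
    have "c a \<oplus>\<^bsub>S\<^esub> c (- a) = \<zero>\<^bsub>S\<^esub>" using c_add[of a "- a"] c0 by simp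
    moreover have "c b \<in> carrier S" for b using k x by (simp add: c_def)
    ultimately show ?thesis by (metis S.M.minus_equality S.M.a_comm)
  qed
  have c0_iff: "a = 0" if "c a = \<zero>\<^bsub>S\<^esub>" for a
  proof (rule ccontr)
    assume "a \<noteq> 0"
    then have "?k (1 / a) \<odot>\<^bsub>S\<^esub> c a = x" using c_smult[OF k] c1 by (simp add: augmentation_scalar)
    then show False using that k x by simp
  qed
  have "submodule (range c) ?L S"
    by (rule S.submoduleI)
       (use k x c0 c_minus c_add[symmetric] c_smult in \<open>auto simp: c_def[symmetric]\<close>,
        auto simp: c_def k x, metis c0 rangeI)
  then have "range c = carrier S"
    using simple c1 x by (metis rangeI singletonD)
  moreover have "inj c"
  proof (rule injI)
    fix a b assume "c a = c b"
    have "c b \<in> carrier S" using k x by (simp add: c_def)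
    have "c (a + - b) = c b \<oplus>\<^bsub>S\<^esub> c (- b)" using c_add \<open>c a = c b\<close> by metis
    also have "\<dots> = \<zero>\<^bsub>S\<^esub>" using c_add[of b "- b"] c0 by simp
    finally show "a = b" using c0_iff by fastforce
  qed
  ultimately have "bij_betw c UNIV (carrier S)" by (simp add: bij_betw_def)
  then show ?thesis using that c_add c_smult by blast
qed

section \<open>The radical of a representation\<close>

lemma rep_module_simps:
  "carrier (rep_module d A) = carrier_vec d"
  "x \<oplus>\<^bsub>rep_module d A\<^esub> y = x + y"
  "\<zero>\<^bsub>rep_module d A\<^esub> = 0\<^sub>v d"
  by (simp_all add: rep_module_def)

text \<open>An element of Lambda is its augmentation plus a combination of loops, and loops map into
  the image.\<close>

lemma rep_module_smult_decomp:
  fixes A :: "'k::field mat list"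
  assumes A: "A \<in> Rep r d" and "X \<in> carrier (Lambda_alg r)" and v: "v \<in> carrier_vec d"
  obtains w where "w \<in> lin_image r d A" "X \<odot>\<^bsub>rep_module d A\<^esub> v = augmentation X \<cdot>\<^sub>v v + w"
proof -
  obtain f where f: "f \<in> carrier (path_algebra r)" "X = lam_class r f"
    using assms(2) by (rule carrier_LambdaE)
  define w where "w = vec d (\<lambda>k. \<Sum>i<r. (A ! i *\<^sub>v (f [i] \<cdot>\<^sub>v v)) $ k)"
  have e: "(A ! i *\<^sub>v (f [i] \<cdot>\<^sub>v v)) $ k = f [i] * (A ! i *\<^sub>v v) $ k" if "i < r" "k < d" for i k
    using Rep_D[OF A that(1)] v that(2) by (simp add: mult_mat_vec[of _ d d])
  have "w \<in> lin_image r d A"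
    unfolding w_def lin_image_def using v
    by (intro CollectI exI[of _ "\<lambda>i. f [i] \<cdot>\<^sub>v v"]) simp
  moreover have "X \<odot>\<^bsub>rep_module d A\<^esub> v = augmentation X \<cdot>\<^sub>v v + w"
    unfolding f(2) augmentation_lam_class[OF f(1)]
      rep_module_smult[OF A f(1) v, folded lam_class_def] path_algebra_act_eq[OF A f(1) v]
    using v by (intro eq_vecI) (auto simp: w_def e)
  ultimately show ?thesis using that by blast
qed

lemma loop_class:
  assumes "i < r"
  shows "lam_class r (path_elem [i]) \<in> carrier (Lambda_alg r)"
    and "augmentation (lam_class r (path_elem [i]) :: (nat list \<Rightarrow> 'k::field) set) = 0"
proof -
  have c: "path_elem [i] \<in> carrier (path_algebra r)" using assms by (intro path_elem_closed) simp
  then show "lam_class r (path_elem [i]) \<in> carrier (Lambda_alg r)" by (rule lam_class_closed)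
  show "augmentation (lam_class r (path_elem [i]) :: (nat list \<Rightarrow> 'k) set) = 0"
    by (subst augmentation_lam_class) (use assms in \<open>auto intro!: path_elem_closed, simp add: path_elem_def\<close>)
qed

lemma loop_smult:
  fixes A :: "'k::field mat list"
  assumes A: "A \<in> Rep r d" and i: "i < r" and v: "v \<in> carrier_vec d"
  shows "lam_class r (path_elem [i]) \<odot>\<^bsub>rep_module d A\<^esub> v = A ! i *\<^sub>v v"
proof -
  have c: "path_elem [i] \<in> carrier (path_algebra r)" using i by (intro path_elem_closed) simp
  have "(\<Sum>j<r. path_elem [i] [j] * (A ! j *\<^sub>v v) $ k) = (A ! i *\<^sub>v v) $ k" for k
  proof -
    have "(\<Sum>j<r. path_elem [i] [j] * (A ! j *\<^sub>v v) $ k) =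
        (\<Sum>j<r. if j = i then (A ! i *\<^sub>v v) $ k else 0)"
      by (intro sum.cong refl) (simp add: path_elem_def)
    then show ?thesis using i by simp
  qed
  then show ?thesis
    unfolding lam_class_def rep_module_smult[OF A c v] path_algebra_act_eq[OF A c v]
    using Rep_D[OF A i] by (intro eq_vecI) (simp_all, simp add: path_elem_def)
qed

lemma vec_sum_closed:
  fixes r :: nat
  assumes "0\<^sub>v d \<in> W" "\<And>v w. v \<in> W \<Longrightarrow> w \<in> W \<Longrightarrow> v + w \<in> W" "W \<subseteq> carrier_vec d"
    and "\<And>i. i < r \<Longrightarrow> y i \<in> W"
  shows "vec d (\<lambda>k. \<Sum>i<r. y i $ k) \<in> W"
  using assms(4)
proof (induction r)
  case 0
  have "vec d (\<lambda>k. \<Sum>i<0::nat. y i $ k) = 0\<^sub>v d" by (intro eq_vecI) auto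
  then show ?case using assms(1) by simp
next
  case (Suc r)
  have "y r \<in> carrier_vec d" using Suc.prems assms(3) by blast
  then have "vec d (\<lambda>k. \<Sum>i<Suc r. y i $ k) = vec d (\<lambda>k. \<Sum>i<r. y i $ k) + y r"
    by (intro eq_vecI) auto
  then show ?case using Suc assms(2) by simp
qed

lemma lin_image_submodule:
  fixes A :: "'k::field mat list"
  assumes A: "A \<in> Rep r d"
  shows "submodule (lin_image r d A) (Lambda_alg r) (rep_module d A)"
proof -
  interpret M: module "Lambda_alg r" "rep_module d A" by (rule rep_module_module[OF A])
  have W: "vec_subspace d (lin_image r d A)"
    using vec_subspace_lin_image Rep_subset_mat_tuples A by blast
  show ?thesis
  proof (rule M.submoduleI)
    fix v assume v: "v \<in> lin_image r d A"
    then have vc: "v \<in> carrier_vec d" using W by (auto simp: vec_subspace_def)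
    have "\<ominus>\<^bsub>rep_module d A\<^esub> v = - 1 \<cdot>\<^sub>v v"
      by (rule M.M.minus_equality) (use vc in \<open>auto simp: rep_module_simps\<close>)
    then show "\<ominus>\<^bsub>rep_module d A\<^esub> v \<in> lin_image r d A" using W v by (auto simp: vec_subspace_def)
    fix X :: "(nat list \<Rightarrow> 'k) set" assume "X \<in> carrier (Lambda_alg r)"
    then show "X \<odot>\<^bsub>rep_module d A\<^esub> v \<in> lin_image r d A"
      using rep_module_smult_decomp[OF A _ vc] W v unfolding vec_subspace_def by metis
  qed (use W in \<open>auto simp: vec_subspace_def rep_module_simps\<close>)
qed

text \<open>Elements of augmentation 0 act by the remainder \<open>w\<close> of
  \<open>rep_module_smult_decomp\<close> alone. Conversely each \<open>A_i v\<close> is the action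
  of a loop, a radical element, and the image consists of sums of such vectors.\<close>

lemma radical_smult_rep_module:
  fixes A :: "'k::field mat list"
  assumes A: "A \<in> Rep r d"
  shows "ideal_smult (jacobson_radical (Lambda_alg r)) (rep_module d A) = lin_image r d A"
proof
  let ?M = "rep_module d A"
  interpret M: module "Lambda_alg r" ?M by (rule rep_module_module[OF A])
  interpret I: submodule "lin_image r d A" "Lambda_alg r" ?M by (rule lin_image_submodule[OF A])
  let ?K = "{X \<odot>\<^bsub>?M\<^esub> x |X x. X \<in> jacobson_radical (Lambda_alg r) \<and> x \<in> carrier ?M}"
  have "?K \<subseteq> lin_image r d A"
  proof clarify
    fix X :: "(nat list \<Rightarrow> 'k) set" and x assume X: "X \<in> jacobson_radical (Lambda_alg r)" and "x \<in> carrier ?M"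
    then have x: "x \<in> carrier_vec d" by (simp add: rep_module_simps)
    from X have X: "X \<in> carrier (Lambda_alg r)" "augmentation X = 0"
      by (auto simp: jacobson_radical_Lambda)
    obtain w where "w \<in> lin_image r d A" "X \<odot>\<^bsub>?M\<^esub> x = augmentation X \<cdot>\<^sub>v x + w"
      using rep_module_smult_decomp[OF A X(1) x] by blast
    moreover have "w \<in> carrier_vec d" using calculation(1) by (auto simp: lin_image_def)
    moreover from this have "0 \<cdot>\<^sub>v x + w = w" using x by (intro eq_vecI) auto
    ultimately show "X \<odot>\<^bsub>?M\<^esub> x \<in> lin_image r d A" using X(2) by simp
  qed
  then show "ideal_smult (jacobson_radical (Lambda_alg r)) ?M \<subseteq> lin_image r d A"
    unfolding ideal_smult_def
    by (intro group.generate_subgroup_incl[OF M.M.a_group]) (simp_all add: I.subgroup_axioms)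
  have KM: "?K \<subseteq> carrier ?M" by (auto simp: jacobson_radical_Lambda)
  let ?G = "generate (add_monoid ?M) ?K"
  have gen: "A ! i *\<^sub>v v \<in> ?G" if "i < r" "v \<in> carrier_vec d" for i v
  proof (rule generate.incl)
    show "A ! i *\<^sub>v v \<in> ?K"
      using loop_smult[OF A that] loop_class[OF that(1)] that(2)
      by (auto simp: jacobson_radical_Lambda rep_module_simps intro!: exI[of _ "lam_class r (path_elem [i])"] exI[of _ v])
  qed
  have zero: "0\<^sub>v d \<in> ?G" using generate.one[of "add_monoid ?M" ?K] by (simp add: rep_module_simps)
  have add: "v + w \<in> ?G" if "v \<in> ?G" "w \<in> ?G" for v w
    using generate.eng[OF that] by (simp add: rep_module_simps)
  have sub: "?G \<subseteq> carrier_vec d"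
    using group.generate_incl[OF M.M.a_group, of ?K] KM by (simp add: rep_module_simps)
  show "lin_image r d A \<subseteq> ideal_smult (jacobson_radical (Lambda_alg r)) ?M"
    unfolding ideal_smult_def lin_image_def
    using vec_sum_closed[OF zero add sub] gen by fastforce
qed

text \<open>The intersection of a simple summand \<open>N\<close> with the socle is 0 or
  \<open>N\<close>. If it is 0, each \<open>A_i v\<close> with \<open>v\<close> in \<open>N\<close>
  lies in it, because image and socle agree, and is therefore 0. In both cases \<open>N\<close> lies
  in the socle, hence in the image.\<close>

lemma no_simple_direct_summand:
  fixes A :: "'k::field mat list"
  assumes A: "A \<in> Rep r d" and eq: "lin_image r d A = lin_socle r d A"
  shows "\<not> has_simple_direct_summand (Lambda_alg r) (rep_module d A)"
proof
  let ?M = "rep_module d A"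
  interpret M: module "Lambda_alg r" ?M by (rule rep_module_module[OF A])
  assume "has_simple_direct_summand (Lambda_alg r) ?M"
  then obtain N N' where N: "submodule N (Lambda_alg r) ?M" and N': "submodule N' (Lambda_alg r) ?M"
    and dec: "N <+>\<^bsub>?M\<^esub> N' = carrier ?M" "N \<inter> N' = {\<zero>\<^bsub>?M\<^esub>}"
    and simple: "simple_module (Lambda_alg r) (?M\<lparr>carrier := N\<rparr>)"
    unfolding has_simple_direct_summand_def direct_summand_def by blast
  interpret N: submodule N "Lambda_alg r" ?M by (rule N)
  interpret N': submodule N' "Lambda_alg r" ?M by (rule N')
  interpret S: module "Lambda_alg r" "?M\<lparr>carrier := N\<rparr>" using simple by (simp add: simple_module_def)
  have T: "A \<in> mat_tuples r d" using A Rep_subset_mat_tuples by blast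
  have soc: "vec_subspace d (lin_socle r d A)" by (rule vec_subspace_lin_socle[OF T])
  have NM: "N \<subseteq> carrier_vec d" "N' \<subseteq> carrier_vec d"
    using N.subset N'.subset by (auto simp: rep_module_simps)
  have AN: "A ! i *\<^sub>v v \<in> N" if "v \<in> N" "i < r" for v i
    using N.smult_closed[OF loop_class(1)[OF that(2)] that(1)] loop_smult[OF A that(2)] that(1) NM by auto
  have AN': "A ! i *\<^sub>v v \<in> N'" if "v \<in> N'" "i < r" for v i
    using N'.smult_closed[OF loop_class(1)[OF that(2)] that(1)] loop_smult[OF A that(2)] that(1) NM by auto
  have Nadd: "v + w \<in> N" if "v \<in> N" "w \<in> N" for v w
    using N.m_closed[of v w] that by (simp add: rep_module_simps)
  have N'add: "v + w \<in> N'" if "v \<in> N'" "w \<in> N'" for v w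
    using N'.m_closed[of v w] that by (simp add: rep_module_simps)
  have zN: "0\<^sub>v d \<in> N" "0\<^sub>v d \<in> N'" using dec(2) by (auto simp: rep_module_simps)
  have sub: "submodule (N \<inter> lin_socle r d A) (Lambda_alg r) (?M\<lparr>carrier := N\<rparr>)"
  proof (rule S.submoduleI)
    fix v assume v: "v \<in> N \<inter> lin_socle r d A"
    then have vc: "v \<in> carrier_vec d" using NM by blast
    have "\<ominus>\<^bsub>?M\<^esub> v = - 1 \<cdot>\<^sub>v v"
      by (rule M.M.minus_equality) (use vc in \<open>auto simp: rep_module_simps\<close>)
    then have mN: "- 1 \<cdot>\<^sub>v v \<in> N" using v M.submoduleE(3)[OF N, of v] by simp
    have "\<ominus>\<^bsub>?M\<lparr>carrier := N\<rparr>\<^esub> v = - 1 \<cdot>\<^sub>v v"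
      by (rule S.M.minus_equality) (use vc v mN in \<open>auto simp: rep_module_simps\<close>)
    then show "\<ominus>\<^bsub>?M\<lparr>carrier := N\<rparr>\<^esub> v \<in> N \<inter> lin_socle r d A"
      using mN v soc by (auto simp: vec_subspace_def)
    fix X :: "(nat list \<Rightarrow> 'k) set" assume X: "X \<in> carrier (Lambda_alg r)"
    obtain w where w: "w \<in> lin_image r d A" "X \<odot>\<^bsub>?M\<^esub> v = augmentation X \<cdot>\<^sub>v v + w"
      using rep_module_smult_decomp[OF A X vc] by blast
    then have "X \<odot>\<^bsub>?M\<^esub> v \<in> lin_socle r d A" using soc v eq by (auto simp: vec_subspace_def)
    then show "X \<odot>\<^bsub>?M\<lparr>carrier := N\<rparr>\<^esub> v \<in> N \<inter> lin_socle r d A"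
      using N.smult_closed[OF X, of v] v by simp
  qed (use soc zN Nadd in \<open>auto simp: rep_module_simps vec_subspace_def\<close>)
  have "N \<inter> lin_socle r d A = {0\<^sub>v d} \<or> N \<inter> lin_socle r d A = N"
    using simple sub unfolding simple_module_def by (fastforce simp: rep_module_simps)
  then have "N \<subseteq> lin_socle r d A"
  proof
    assume 0: "N \<inter> lin_socle r d A = {0\<^sub>v d}"
    show ?thesis
    proof
      fix v assume v: "v \<in> N"
      then have vc: "v \<in> carrier_vec d" using NM by blast
      have "A ! i *\<^sub>v v \<in> N \<inter> lin_socle r d A" if "i < r" for i
        using AN[OF v that] mult_in_lin_image[OF T that vc] eq by simp
      then show "v \<in> lin_socle r d A" using 0 vc by (auto simp: lin_socle_def)
    qed
  qed blast
  have "N \<subseteq> N'"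
  proof
    fix v assume v: "v \<in> N"
    then have "v \<in> lin_image r d A" using \<open>N \<subseteq> lin_socle r d A\<close> eq by blast
    then obtain x where x: "\<And>i. i < r \<Longrightarrow> x i \<in> carrier_vec d" "v = vec d (\<lambda>k. \<Sum>i<r. (A ! i *\<^sub>v x i) $ k)"
      unfolding lin_image_def by blast
    have "\<exists>a b. a \<in> N \<and> b \<in> N' \<and> x i = a + b" if "i < r" for i
    proof -
      have "x i \<in> N <+>\<^bsub>?M\<^esub> N'" using x(1)[OF that] dec(1) by (simp add: rep_module_simps)
      then show ?thesis by (auto simp: set_add_def' rep_module_simps)
    qed
    \<comment> \<open>Only the components \<open>b i\<close> in \<open>N'\<close> contribute to
      \<open>v\<close>: the \<open>a i\<close> lie in the socle and are killed by
      \<open>A_i\<close>.\<close>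
    then obtain a b where ab: "\<And>i. i < r \<Longrightarrow> a i \<in> N \<and> b i \<in> N' \<and> x i = a i + b i" by metis
    have "A ! i *\<^sub>v x i \<in> N'" if i: "i < r" for i
    proof -
      have "A ! i *\<^sub>v x i = A ! i *\<^sub>v a i + A ! i *\<^sub>v b i"
        using ab[OF i] subsetD[OF NM(1), of "a i"] subsetD[OF NM(2), of "b i"] mat_tuples_D[OF T i]
        by (simp add: mult_add_distrib_mat_vec[of _ d d])
      also have "A ! i *\<^sub>v a i = 0\<^sub>v d"
        using ab[OF i] \<open>N \<subseteq> lin_socle r d A\<close> i by (auto simp: lin_socle_def)
      finally show ?thesis using N'add zN(2) AN' ab[OF i] i by simp
    qed
    then show "v \<in> N'" unfolding x(2) by (intro vec_sum_closed zN N'add NM)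
  qed
  then have "N = {\<zero>\<^bsub>?M\<^esub>}" using dec(2) by blast
  then show False using simple by (simp add: simple_module_def)
qed

section \<open>The top of a representation\<close>

lemma module_power_simps:
  "carrier (module_power S t) = {..<t} \<rightarrow>\<^sub>E carrier S"
  "x \<oplus>\<^bsub>module_power S t\<^esub> y = (\<lambda>i\<in>{..<t}. x i \<oplus>\<^bsub>S\<^esub> y i)"
  "X \<odot>\<^bsub>module_power S t\<^esub> x = (\<lambda>i\<in>{..<t}. X \<odot>\<^bsub>S\<^esub> x i)"
  by (simp_all add: module_power_def)

definition simple_coordinates ::
    "nat \<Rightarrow> ((nat list \<Rightarrow> 'k::field) set, 's) module \<Rightarrow> ('k \<Rightarrow> 's) \<Rightarrow> bool" where
  "simple_coordinates r S c \<longleftrightarrow> bij_betw c UNIV (carrier S) \<and> (\<forall>a b. c (a + b) = c a \<oplus>\<^bsub>S\<^esub> c b) \<and>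
     (\<forall>X\<in>carrier (Lambda_alg r). \<forall>a. X \<odot>\<^bsub>S\<^esub> c a = c (augmentation X * a))"

text \<open>In the coordinates \<open>c\<close> the composite isomorphism from \<open>S^a\<close> to
  \<open>S^b\<close> is multiplication by a \<open>b\<close> x \<open>a\<close> matrix
  \<open>H\<close>, which is not injective for \<open>b < a\<close>. Closure of \<open>P\<close>
  under its operations is what makes the inverse of \<open>f\<close> compatible with them.\<close>

lemma module_iso_module_power_le:
  fixes S :: "((nat list \<Rightarrow> 'k::field) set, 's) module" and P :: "((nat list \<Rightarrow> 'k) set, 'p) module"
  assumes c: "simple_coordinates r S c"
    and add: "\<And>x y. x \<in> carrier P \<Longrightarrow> y \<in> carrier P \<Longrightarrow> x \<oplus>\<^bsub>P\<^esub> y \<in> carrier P"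
    and smult: "\<And>X x. X \<in> carrier (Lambda_alg r) \<Longrightarrow> x \<in> carrier P \<Longrightarrow> X \<odot>\<^bsub>P\<^esub> x \<in> carrier P"
    and "module_iso (Lambda_alg r) P (module_power S a)"
    and "module_iso (Lambda_alg r) P (module_power S b)"
  shows "a \<le> b"
proof (rule ccontr)
  assume "\<not> a \<le> b"
  then have "b < a" by simp
  have cb: "bij_betw c UNIV (carrier S)" and c_add: "\<And>a b. c (a + b) = c a \<oplus>\<^bsub>S\<^esub> c b"
    and c_smult: "\<And>X a. X \<in> carrier (Lambda_alg r) \<Longrightarrow> X \<odot>\<^bsub>S\<^esub> c a = c (augmentation X * a)"
    using c unfolding simple_coordinates_def by auto
  have cc: "c x \<in> carrier S" for x using cb by (auto simp: bij_betw_def)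
  let ?Sa = "module_power S a" and ?Sb = "module_power S b"
  obtain f where f: "bij_betw f (carrier P) (carrier ?Sa)"
    "\<And>x y. x \<in> carrier P \<Longrightarrow> y \<in> carrier P \<Longrightarrow> f (x \<oplus>\<^bsub>P\<^esub> y) = f x \<oplus>\<^bsub>?Sa\<^esub> f y"
    "\<And>X x. X \<in> carrier (Lambda_alg r) \<Longrightarrow> x \<in> carrier P \<Longrightarrow> f (X \<odot>\<^bsub>P\<^esub> x) = X \<odot>\<^bsub>?Sa\<^esub> f x"
    using assms(4) unfolding module_iso_def iso_def hom_def by auto
  obtain h where h: "bij_betw h (carrier P) (carrier ?Sb)"
    "\<And>x y. x \<in> carrier P \<Longrightarrow> y \<in> carrier P \<Longrightarrow> h (x \<oplus>\<^bsub>P\<^esub> y) = h x \<oplus>\<^bsub>?Sb\<^esub> h y"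
    "\<And>X x. X \<in> carrier (Lambda_alg r) \<Longrightarrow> x \<in> carrier P \<Longrightarrow> h (X \<odot>\<^bsub>P\<^esub> x) = X \<odot>\<^bsub>?Sb\<^esub> h x"
    using assms(5) unfolding module_iso_def iso_def hom_def by auto
  define G where "G = inv_into (carrier P) f"
  have G: "G x \<in> carrier P" "f (G x) = x" if "x \<in> carrier ?Sa" for x
    using that f(1) by (auto simp: G_def bij_betw_def inv_into_into f_inv_into_f)
  have Gf: "G (f p) = p" if "p \<in> carrier P" for p
    using that f(1) unfolding G_def by (simp add: bij_betw_inv_into_left)
  define k where "k x = h (G x)" for x
  have kc: "k x \<in> carrier ?Sb" if "x \<in> carrier ?Sa" for x
    using G(1)[OF that] h(1) by (auto simp: k_def bij_betw_def)
  have k_add: "k (x \<oplus>\<^bsub>?Sa\<^esub> y) = k x \<oplus>\<^bsub>?Sb\<^esub> k y" if "x \<in> carrier ?Sa" "y \<in> carrier ?Sa" for x y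
    using Gf[OF add[OF G(1)[OF that(1)] G(1)[OF that(2)]]] f(2)[OF G(1)[OF that(1)] G(1)[OF that(2)]]
      h(2)[OF G(1)[OF that(1)] G(1)[OF that(2)]] G(2) that by (simp add: k_def)
  have k_smult: "k (X \<odot>\<^bsub>?Sa\<^esub> x) = X \<odot>\<^bsub>?Sb\<^esub> k x" if "X \<in> carrier (Lambda_alg r)" "x \<in> carrier ?Sa" for X x
    using Gf[OF smult[OF that(1) G(1)[OF that(2)]]] f(3)[OF that(1) G(1)[OF that(2)]]
      h(3)[OF that(1) G(1)[OF that(2)]] G(2) that by (simp add: k_def)
  have k_inj: "x = y" if "x \<in> carrier ?Sa" "y \<in> carrier ?Sa" "k x = k y" for x y
  proof -
    have "G x = G y"
      using that(3) h(1) G(1)[OF that(1)] G(1)[OF that(2)]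
      by (auto simp: k_def bij_betw_def dest: inj_onD)
    then have "f (G x) = f (G y)" by simp
    then show ?thesis using G(2) that by simp
  qed
  define emb where "emb v = (\<lambda>j\<in>{..<a}. c (v j))" for v
  have ec: "emb v \<in> carrier ?Sa" for v by (auto simp: emb_def module_power_simps cc)
  let ?s = "\<lambda>x. lam_class r (scalar_elem x)"
  have s: "?s x \<in> carrier (Lambda_alg r)" for x by (rule lam_class_closed[OF scalar_elem_closed])
  \<comment> \<open>Column \<open>j\<close> of \<open>H\<close> is the image of the
    \<open>j\<close>-th unit vector, read in the coordinates \<open>c\<close>.\<close>
  define H where "H i j = inv_into UNIV c (k (emb (\<lambda>l. if l = j then 1 else 0)) i)" for i j
  have Hc: "c (inv_into UNIV c x) = x" if "x \<in> carrier S" for x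
    using that cb by (simp add: bij_betw_def f_inv_into_f)
  have ki: "k x i \<in> carrier S" if "x \<in> carrier ?Sa" "i < b" for x i
    using kc[OF that(1)] that(2) by (auto simp: module_power_simps)
  have cH: "c (H i j) = k (emb (\<lambda>l. if l = j then 1 else 0)) i" if "i < b" for i j
    unfolding H_def by (rule Hc[OF ki[OF ec that]])
  \<comment> \<open>Compatibility of \<open>k\<close> with sums concerns two summands, so the
    coordinates are switched on one at a time.\<close>
  have lin: "k (emb (\<lambda>j. if j < n then v j else 0)) i = c (\<Sum>j<n. H i j * v j)"
    if "n \<le> a" "i < b" for n i v
    using that(1)
  proof (induction n)
    case 0
    \<comment> \<open>The zero vector is the scalar 0 times itself, so every coordinate of its image
      is \<open>c 0\<close>.\<close>
    have "?s 0 \<odot>\<^bsub>?Sa\<^esub> emb (\<lambda>j. 0) = emb (\<lambda>j. 0)"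
      by (auto simp: emb_def module_power_simps c_smult[OF s])
    then have "k (emb (\<lambda>j. 0)) = ?s 0 \<odot>\<^bsub>?Sb\<^esub> k (emb (\<lambda>j. 0))"
      using k_smult[OF s[of 0] ec[of "\<lambda>j. 0"]] by simp
    then have "k (emb (\<lambda>j. 0)) i = (?s 0 \<odot>\<^bsub>?Sb\<^esub> k (emb (\<lambda>j. 0))) i"
      by (rule fun_cong)
    also have "\<dots> = ?s 0 \<odot>\<^bsub>S\<^esub> k (emb (\<lambda>j. 0)) i"
      using that(2) by (simp add: module_power_simps)
    also have "\<dots> = ?s 0 \<odot>\<^bsub>S\<^esub> c (inv_into UNIV c (k (emb (\<lambda>j. 0)) i))"
      by (simp only: Hc[OF ki[OF ec that(2)]])
    also have "\<dots> = c 0"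
      by (simp only: c_smult[OF s] augmentation_scalar mult_zero_left)
    finally show ?case by simp
  next
    case (Suc n)
    let ?e = "emb (\<lambda>l. if l = n then 1 else 0)"
    have se: "?s (v n) \<odot>\<^bsub>?Sa\<^esub> ?e = emb (\<lambda>l. v n * (if l = n then 1 else 0))"
      by (rule ext) (simp add: emb_def module_power_simps c_smult[OF s] augmentation_scalar)
    have "emb (\<lambda>j. if j < n then v j else 0) \<oplus>\<^bsub>?Sa\<^esub> emb (\<lambda>l. v n * (if l = n then 1 else 0)) =
        emb (\<lambda>j. (if j < n then v j else 0) + v n * (if j = n then 1 else 0))"
      by (rule ext) (simp add: emb_def module_power_simps c_add)
    also have "(\<lambda>j. (if j < n then v j else 0) + v n * (if j = n then 1 else 0)) =
        (\<lambda>j. if j < Suc n then v j else 0)" by (auto simp: less_Suc_eq)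
    finally have "k (emb (\<lambda>j. if j < Suc n then v j else 0)) =
        k (emb (\<lambda>j. if j < n then v j else 0) \<oplus>\<^bsub>?Sa\<^esub> (?s (v n) \<odot>\<^bsub>?Sa\<^esub> ?e))"
      by (simp only: se)
    also have "\<dots> = k (emb (\<lambda>j. if j < n then v j else 0)) \<oplus>\<^bsub>?Sb\<^esub> k (?s (v n) \<odot>\<^bsub>?Sa\<^esub> ?e)"
      unfolding se by (rule k_add[OF ec ec])
    also have "k (?s (v n) \<odot>\<^bsub>?Sa\<^esub> ?e) = ?s (v n) \<odot>\<^bsub>?Sb\<^esub> k ?e" by (rule k_smult[OF s ec])
    finally have "k (emb (\<lambda>j. if j < Suc n then v j else 0)) =
        k (emb (\<lambda>j. if j < n then v j else 0)) \<oplus>\<^bsub>?Sb\<^esub> (?s (v n) \<odot>\<^bsub>?Sb\<^esub> k ?e)" .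
    then have "k (emb (\<lambda>j. if j < Suc n then v j else 0)) i =
        k (emb (\<lambda>j. if j < n then v j else 0)) i \<oplus>\<^bsub>S\<^esub> (?s (v n) \<odot>\<^bsub>S\<^esub> k ?e i)"
      using that(2) by (simp add: module_power_simps)
    also have "\<dots> = c (\<Sum>j<n. H i j * v j) \<oplus>\<^bsub>S\<^esub> (?s (v n) \<odot>\<^bsub>S\<^esub> c (H i n))"
      using Suc.IH Suc.prems by (simp only: cH[OF that(2)] Suc_leD)
    also have "\<dots> = c (\<Sum>j<Suc n. H i j * v j)"
      by (simp add: c_smult[OF s] augmentation_scalar c_add mult.commute)
    finally show ?case .
  qed
  have lin': "k (emb v) i = c (\<Sum>j<a. H i j * v j)" if "i < b" for v i
  proof -
    have "emb v = emb (\<lambda>j. if j < a then v j else 0)" by (auto simp: emb_def)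
    then show ?thesis using lin[OF order_refl that, of v] by simp
  qed
  obtain y j where y: "j < a" "y j \<noteq> 0" "\<And>i. i < b \<Longrightarrow> (\<Sum>j<a. H i j * y j) = 0"
    using wide_kernel[OF \<open>b < a\<close>, of H] by auto
  have "k (emb y) i = k (emb (\<lambda>j. 0)) i" if "i < b" for i
    using y(3)[OF that] by (simp add: lin'[OF that])
  then have "k (emb y) = k (emb (\<lambda>j. 0))"
    using kc[OF ec] unfolding module_power_simps
    by (intro PiE_ext[of "k (emb y)" "{..<b}" "\<lambda>_. carrier S" "k (emb (\<lambda>j. 0))"]) auto
  then have "emb y = emb (\<lambda>j. 0)" by (rule k_inj[OF ec ec])
  then have "c (y j) = c 0" using y(1) unfolding emb_def by (metis lessThan_iff restrict_apply)
  then show False using y(2) cb by (auto simp: bij_betw_def dest: injD)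
qed

text \<open>Modulo the image only the coordinates of \<open>g v\<close> from \<open>m\<close> on
  count. Lambda acts on them by scalars, because the rest of its action ends in the image.\<close>

lemma module_top_cosets:
  assumes A: "A \<in> Rep r d" and gh: "inv_pair d g h" and im: "lin_image r d A = flag_space d g m"
  defines "\<kappa> \<equiv> \<lambda>v. lin_image r d A +>\<^bsub>rep_module d A\<^esub> v"
    and "P \<equiv> module_top (Lambda_alg r) (rep_module d A)"
  shows "carrier P = \<kappa> ` carrier_vec d"
    and "\<And>v w. v \<in> carrier_vec d \<Longrightarrow> w \<in> carrier_vec d \<Longrightarrow>
      \<kappa> v = \<kappa> w \<longleftrightarrow> (\<forall>k. m \<le> k \<and> k < d \<longrightarrow> (g *\<^sub>v v) $ k = (g *\<^sub>v w) $ k)"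
    and "\<And>v w. v \<in> carrier_vec d \<Longrightarrow> w \<in> carrier_vec d \<Longrightarrow> \<kappa> v \<oplus>\<^bsub>P\<^esub> \<kappa> w = \<kappa> (v + w)"
    and "\<And>X v. X \<in> carrier (Lambda_alg r) \<Longrightarrow> v \<in> carrier_vec d \<Longrightarrow>
      X \<odot>\<^bsub>P\<^esub> \<kappa> v = \<kappa> (augmentation X \<cdot>\<^sub>v v)"
proof -
  let ?M = "rep_module d A" and ?N = "lin_image r d A"
  interpret M: module "Lambda_alg r" ?M by (rule rep_module_module[OF A])
  interpret N: submodule ?N "Lambda_alg r" ?M by (rule lin_image_submodule[OF A])
  interpret N: abelian_subgroup ?N ?M
    by (rule abelian_subgroupI3) (unfold_locales, simp_all add: additive_subgroup_def N.subgroup_axioms M.M.abelian_group_axioms)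
  have gc: "g \<in> carrier_mat d d" using gh by (simp add: inv_pair_def)
  have P: "P = quotient_module ?M ?N"
    unfolding P_def module_top_def radical_smult_rep_module[OF A] ..
  show 1: "carrier P = \<kappa> ` carrier_vec d"
    by (auto simp: P quotient_module_def A_RCOSETS_def' \<kappa>_def rep_module_simps)
  have mem: "w \<in> \<kappa> v \<longleftrightarrow> w - v \<in> ?N" if "v \<in> carrier_vec d" "w \<in> carrier_vec d" for v w
  proof
    assume "w \<in> \<kappa> v"
    then obtain n where n: "n \<in> ?N" "w = n + v"
      unfolding \<kappa>_def a_r_coset_def' by (auto simp: rep_module_simps)
    moreover have "n \<in> carrier_vec d" using n(1) im by (simp add: flag_space_def)
    ultimately have "w - v = n" using that by (intro eq_vecI) auto
    then show "w - v \<in> ?N" using n by simp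
  next
    assume "w - v \<in> ?N"
    moreover have "w = (w - v) + v" using that by (intro eq_vecI) auto
    ultimately show "w \<in> \<kappa> v" unfolding \<kappa>_def a_r_coset_def' by (auto simp: rep_module_simps)
  qed
  have coset_eq: "\<kappa> v = \<kappa> w \<longleftrightarrow> w \<in> \<kappa> v" if "v \<in> carrier_vec d" "w \<in> carrier_vec d" for v w
    using that N.a_repr_independence'[of w v] N.a_rcos_self[of w]
    unfolding \<kappa>_def by (auto simp: rep_module_simps)
  show 2: "\<kappa> v = \<kappa> w \<longleftrightarrow> (\<forall>k. m \<le> k \<and> k < d \<longrightarrow> (g *\<^sub>v v) $ k = (g *\<^sub>v w) $ k)"
    if "v \<in> carrier_vec d" "w \<in> carrier_vec d" for v w
  proof -
    have "g *\<^sub>v (w - v) = g *\<^sub>v w - g *\<^sub>v v"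
      by (rule mult_minus_distrib_mat_vec[OF gc that(2,1)])
    then have "(g *\<^sub>v (w - v)) $ k = (g *\<^sub>v w) $ k - (g *\<^sub>v v) $ k" if "k < d" for k
      using that \<open>v \<in> carrier_vec d\<close> gc by (metis carrier_matD(1) dim_mult_mat_vec index_minus_vec(1))
    then show ?thesis
      unfolding coset_eq[OF that] mem[OF that] im flag_space_def using that by auto
  qed
  show "\<kappa> v \<oplus>\<^bsub>P\<^esub> \<kappa> w = \<kappa> (v + w)" if "v \<in> carrier_vec d" "w \<in> carrier_vec d" for v w
    using N.a_rcos_sum[of v w] that by (simp add: P quotient_module_def \<kappa>_def rep_module_simps)
  show "X \<odot>\<^bsub>P\<^esub> \<kappa> v = \<kappa> (augmentation X \<cdot>\<^sub>v v)"
    if X: "X \<in> carrier (Lambda_alg r)" and v: "v \<in> carrier_vec d" for X v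
  proof -
    \<comment> \<open>\<open>quotient_module\<close> forms the union over all representatives of a
      coset, so each of them has to produce the same coset.\<close>
    have "\<kappa> (X \<odot>\<^bsub>?M\<^esub> x) = \<kappa> (augmentation X \<cdot>\<^sub>v v)" if x\<kappa>: "x \<in> \<kappa> v" for x
    proof -
      obtain n where n: "n \<in> ?N" "x = n + v"
        using x\<kappa> unfolding \<kappa>_def a_r_coset_def' by (auto simp: rep_module_simps)
      have nc: "n \<in> carrier_vec d" using n(1) im by (simp add: flag_space_def)
      then have x: "x \<in> carrier_vec d" using n v by simp
      obtain w where w: "w \<in> ?N" "X \<odot>\<^bsub>?M\<^esub> x = augmentation X \<cdot>\<^sub>v x + w"
        using rep_module_smult_decomp[OF A X x] by blast
      have wc: "w \<in> carrier_vec d" using w(1) im by (simp add: flag_space_def)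
      have "\<kappa> v = \<kappa> x" using coset_eq[OF v x] x\<kappa> by simp
      then have "(g *\<^sub>v v) $ k = (g *\<^sub>v x) $ k" if "m \<le> k" "k < d" for k
        using 2[OF v x] that by blast
      moreover have "(g *\<^sub>v w) $ k = 0" if "m \<le> k" "k < d" for k
        using w(1) im that by (auto simp: flag_space_def)
      moreover have "g *\<^sub>v (augmentation X \<cdot>\<^sub>v x + w) = augmentation X \<cdot>\<^sub>v (g *\<^sub>v x) + g *\<^sub>v w"
        using gc x wc by (simp add: mult_add_distrib_mat_vec[of _ d d] mult_mat_vec[of _ d d])
      moreover have "g *\<^sub>v (augmentation X \<cdot>\<^sub>v v) = augmentation X \<cdot>\<^sub>v (g *\<^sub>v v)"
        using gc v by (simp add: mult_mat_vec[of _ d d])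
      moreover have "dim_vec (g *\<^sub>v x) = d" "dim_vec (g *\<^sub>v w) = d" "dim_vec (g *\<^sub>v v) = d"
        using gc by auto
      ultimately show ?thesis
        unfolding w(2) using v x wc by (subst 2) (simp_all del: index_mult_mat_vec)
    qed
    moreover have "v \<in> \<kappa> v" using N.a_rcos_self[of v] v by (simp add: \<kappa>_def rep_module_simps)
    ultimately show ?thesis
      unfolding P quotient_module_def \<kappa>_def[symmetric]
      by (auto simp: \<kappa>_def[symmetric])
  qed
qed

text \<open>The coordinates of \<open>g v\<close> from \<open>m\<close> on identify the top with
  \<open>S^(d - m)\<close>; \<open>module_iso_module_power_le\<close>, used in both directions,
  excludes every other exponent.\<close>

lemma module_top_iso_module_power:
  fixes S :: "((nat list \<Rightarrow> 'k::field) set, 's) module" and A :: "'k mat list"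
  assumes S: "simple_module (Lambda_alg r) S" and A: "A \<in> Rep r d"
    and gh: "inv_pair d g h" and im: "lin_image r d A = flag_space d g m" and "m \<le> d"
  shows "module_iso (Lambda_alg r) (module_top (Lambda_alg r) (rep_module d A)) (module_power S t)
    \<longleftrightarrow> t = d - m"
proof -
  obtain c :: "'k \<Rightarrow> 's" where c: "simple_coordinates r S c"
    using simple_module_coordinates[OF S] unfolding simple_coordinates_def by metis
  have cb: "bij_betw c UNIV (carrier S)" and c_add: "\<And>a b. c (a + b) = c a \<oplus>\<^bsub>S\<^esub> c b"
    and c_smult: "\<And>X a. X \<in> carrier (Lambda_alg r) \<Longrightarrow> X \<odot>\<^bsub>S\<^esub> c a = c (augmentation X * a)"
    using c unfolding simple_coordinates_def by auto
  have cc: "c x \<in> carrier S" for x using cb by (auto simp: bij_betw_def)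
  have c_inj: "c x = c y \<longleftrightarrow> x = y" for x y using cb by (auto simp: bij_betw_def inj_eq)
  let ?P = "module_top (Lambda_alg r) (rep_module d A)"
  define \<kappa> where "\<kappa> v = lin_image r d A +>\<^bsub>rep_module d A\<^esub> v" for v
  note top = module_top_cosets[OF A gh im, folded \<kappa>_def]
  let ?n = "d - m"
  define \<phi> where "\<phi> v = (\<lambda>i\<in>{..<?n}. c ((g *\<^sub>v v) $ (m + i)))" for v
  \<comment> \<open>\<open>f\<close> evaluates \<open>\<phi>\<close> at a chosen representative;
    \<open>\<phi>_eq\<close> makes it independent of the choice.\<close>
  define f where "f Y = \<phi> (SOME v. v \<in> carrier_vec d \<and> Y = \<kappa> v)" for Y
  have gc: "g \<in> carrier_mat d d" "h \<in> carrier_mat d d" using gh by (auto simp: inv_pair_def)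
  have \<phi>_eq: "\<phi> v = \<phi> w \<longleftrightarrow> \<kappa> v = \<kappa> w" if "v \<in> carrier_vec d" "w \<in> carrier_vec d" for v w
  proof -
    have "\<phi> v = \<phi> w \<longleftrightarrow> (\<forall>i<?n. (g *\<^sub>v v) $ (m + i) = (g *\<^sub>v w) $ (m + i))"
      by (auto simp: \<phi>_def fun_eq_iff restrict_def c_inj)
    also have "\<dots> \<longleftrightarrow> (\<forall>k. m \<le> k \<and> k < d \<longrightarrow> (g *\<^sub>v v) $ k = (g *\<^sub>v w) $ k)"
    proof (intro iffI allI impI)
      fix k assume "\<forall>i<?n. (g *\<^sub>v v) $ (m + i) = (g *\<^sub>v w) $ (m + i)" and k: "m \<le> k \<and> k < d"
      from this(1) have "(g *\<^sub>v v) $ (m + (k - m)) = (g *\<^sub>v w) $ (m + (k - m))"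
        by (rule allE[of _ "k - m"]) (use k in \<open>simp add: diff_less_mono\<close>)
      then show "(g *\<^sub>v v) $ k = (g *\<^sub>v w) $ k" using k by simp
    qed simp
    finally show ?thesis using top(2)[OF that] by simp
  qed
  have f: "f (\<kappa> v) = \<phi> v" if v: "v \<in> carrier_vec d" for v
  proof -
    have "(SOME w. w \<in> carrier_vec d \<and> \<kappa> v = \<kappa> w) \<in> carrier_vec d \<and>
        \<kappa> v = \<kappa> (SOME w. w \<in> carrier_vec d \<and> \<kappa> v = \<kappa> w)"
      by (rule someI[of "\<lambda>w. w \<in> carrier_vec d \<and> \<kappa> v = \<kappa> w" v]) (use v in simp)
    then show ?thesis unfolding f_def using \<phi>_eq[OF _ v] by metis
  qed
  have iso: "module_iso (Lambda_alg r) ?P (module_power S ?n)"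
    unfolding module_iso_def
  proof (intro bexI[of _ f] ballI)
    fix X :: "(nat list \<Rightarrow> 'k) set" and Y assume X: "X \<in> carrier (Lambda_alg r)" and "Y \<in> carrier ?P"
    then obtain v where v: "v \<in> carrier_vec d" "Y = \<kappa> v" using top(1) by auto
    have "g *\<^sub>v (augmentation X \<cdot>\<^sub>v v) = augmentation X \<cdot>\<^sub>v (g *\<^sub>v v)"
      using gc v by (simp add: mult_mat_vec[of _ d d])
    then show "f (X \<odot>\<^bsub>?P\<^esub> Y) = X \<odot>\<^bsub>module_power S ?n\<^esub> f Y"
      using gc v by (auto simp: top(4)[OF X] f \<phi>_def module_power_simps c_smult[OF X]
          simp del: index_mult_mat_vec)
  next
    have hom: "f (x \<oplus>\<^bsub>?P\<^esub> y) = f x \<oplus>\<^bsub>module_power S ?n\<^esub> f y"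
      if xy: "x \<in> carrier ?P" "y \<in> carrier ?P" for x y
    proof -
      obtain v w where v: "v \<in> carrier_vec d" "x = \<kappa> v" and w: "w \<in> carrier_vec d" "y = \<kappa> w"
        using xy top(1) by auto
      have "g *\<^sub>v (v + w) = g *\<^sub>v v + g *\<^sub>v w"
        using gc v w by (simp add: mult_add_distrib_mat_vec[of _ d d])
      then show ?thesis
        using gc v w by (auto simp: top(3) f \<phi>_def module_power_simps c_add simp del: index_mult_mat_vec)
    qed
    have "inj_on f (carrier ?P)"
      by (rule inj_onI) (use top(1) \<phi>_eq f in auto)
    moreover have "f ` carrier ?P = carrier (module_power S ?n)"
    proof (intro equalityI subsetI)
      have "\<phi> v \<in> carrier (module_power S ?n)" for v by (auto simp: \<phi>_def module_power_simps cc)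
      then show "x \<in> carrier (module_power S ?n)" if "x \<in> f ` carrier ?P" for x
        using that top(1) f by auto
    next
      fix x assume x: "x \<in> carrier (module_power S ?n)"
      \<comment> \<open>For \<open>k < m\<close> the difference \<open>k - m\<close> is 0, so these
        coordinates hold an arbitrary value, which \<open>\<phi>\<close> never reads.\<close>
      define v where "v = h *\<^sub>v vec d (\<lambda>k. inv_into UNIV c (x (k - m)))"
      have vc: "v \<in> carrier_vec d" using gc by (simp add: v_def)
      have "g *\<^sub>v v = vec d (\<lambda>k. inv_into UNIV c (x (k - m)))"
        unfolding v_def by (rule inv_pair_mult_vec(1)[OF gh]) simp
      moreover have "c (inv_into UNIV c (x i)) = x i" if "i < ?n" for i
      proof -
        have "x i \<in> carrier S" using x that by (auto simp: module_power_simps)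
        then show ?thesis using cb by (simp add: bij_betw_def f_inv_into_f)
      qed
      ultimately have "\<phi> v = x"
        using x by (auto simp: \<phi>_def module_power_simps fun_eq_iff PiE_def extensional_def restrict_def)
      then show "x \<in> f ` carrier ?P" using f[OF vc] top(1) vc by (metis imageI)
    qed
    ultimately show "f \<in> iso (add_monoid ?P) (add_monoid (module_power S ?n))"
      using hom by (auto simp: iso_def hom_def bij_betw_def)
  qed
  have add: "x \<oplus>\<^bsub>?P\<^esub> y \<in> carrier ?P" if "x \<in> carrier ?P" "y \<in> carrier ?P" for x y
    using that unfolding top(1) by (auto simp only: top(3) image_iff intro: add_carrier_vec)
  have smult: "X \<odot>\<^bsub>?P\<^esub> x \<in> carrier ?P" if "X \<in> carrier (Lambda_alg r)" "x \<in> carrier ?P" for X x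
  proof -
    obtain v where v: "v \<in> carrier_vec d" "x = \<kappa> v" using \<open>x \<in> carrier ?P\<close> top(1) by auto
    show ?thesis unfolding v(2) top(4)[OF that(1) v(1)] top(1) using v(1) by simp
  qed
  note le = module_iso_module_power_le[OF c add smult]
  show ?thesis
    using iso le[of ?n t] le[of t ?n] by (auto intro: le_antisym)
qed

section \<open>Irreducibility\<close>

definition polynomial_fun :: "('k::field \<Rightarrow> 'k) \<Rightarrow> bool" where
  "polynomial_fun f \<longleftrightarrow> (\<exists>p. \<forall>s. f s = poly p s)"

lemma polynomial_fun_const: "polynomial_fun (\<lambda>s. c)"
  unfolding polynomial_fun_def by (intro exI[of _ "[:c:]"]) simp

lemma polynomial_fun_id: "polynomial_fun (\<lambda>s. s)"
  unfolding polynomial_fun_def by (intro exI[of _ "[:0, 1:]"]) simp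

lemma polynomial_fun_add:
  assumes "polynomial_fun f" "polynomial_fun g"
  shows "polynomial_fun (\<lambda>s. f s + g s)"
  using assms unfolding polynomial_fun_def by (metis poly_add)

lemma polynomial_fun_diff:
  assumes "polynomial_fun f" "polynomial_fun g"
  shows "polynomial_fun (\<lambda>s. f s - g s)"
  using assms unfolding polynomial_fun_def by (metis poly_diff)

lemma polynomial_fun_mult:
  assumes "polynomial_fun f" "polynomial_fun g"
  shows "polynomial_fun (\<lambda>s. f s * g s)"
  using assms unfolding polynomial_fun_def by (metis poly_mult)

lemma polynomial_fun_sum:
  "(\<And>i. i \<in> I \<Longrightarrow> polynomial_fun (f i)) \<Longrightarrow> polynomial_fun (\<lambda>s. \<Sum>i\<in>I. f i s)"
  by (induction I rule: infinite_finite_induct)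
     (simp_all add: polynomial_fun_const polynomial_fun_add)

lemma polynomial_fun_prod:
  "(\<And>i. i \<in> I \<Longrightarrow> polynomial_fun (f i)) \<Longrightarrow> polynomial_fun (\<lambda>s. \<Prod>i\<in>I. f i s)"
  by (induction I rule: infinite_finite_induct)
     (simp_all add: polynomial_fun_const polynomial_fun_mult)

lemma polynomial_fun_det:
  assumes "\<And>s. M s \<in> carrier_mat n n"
    and "\<And>i j. i < n \<Longrightarrow> j < n \<Longrightarrow> polynomial_fun (\<lambda>s. M s $$ (i, j))"
  shows "polynomial_fun (\<lambda>s. det (M s))"
proof -
  have "polynomial_fun (\<lambda>s. \<Sum>p\<in>{p. p permutes {0..<n}}. signof p * (\<Prod>i = 0..<n. M s $$ (i, p i)))"
    by (intro polynomial_fun_sum polynomial_fun_mult polynomial_fun_const polynomial_fun_prod assms(2))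
       (auto simp: permutes_in_image)
  then show ?thesis by (simp add: det_def'[OF assms(1)])
qed

lemma polynomial_fun_adj_mat:
  assumes M: "\<And>s. M s \<in> carrier_mat n n"
    and e: "\<And>i j. i < n \<Longrightarrow> j < n \<Longrightarrow> polynomial_fun (\<lambda>s. M s $$ (i, j))"
    and "i < n" "j < n"
  shows "polynomial_fun (\<lambda>s. adj_mat (M s) $$ (i, j))"
proof -
  have d: "dim_row (M s) = n" "dim_col (M s) = n" for s using M[of s] by auto
  have "polynomial_fun (\<lambda>s. (- 1) ^ (j + i) * det (mat_delete (M s) j i))"
    by (intro polynomial_fun_mult polynomial_fun_const polynomial_fun_det[of _ "n - 1"])
       (auto simp: mat_delete_def d intro!: e)
  then show ?thesis using assms(3,4) by (simp add: adj_mat_def cofactor_def d)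
qed

lemma polynomial_fun_mat_mult:
  assumes "\<And>s. M s \<in> carrier_mat n n" "\<And>s. N s \<in> carrier_mat n n"
    and "\<And>i j. i < n \<Longrightarrow> j < n \<Longrightarrow> polynomial_fun (\<lambda>s. M s $$ (i, j))"
    and "\<And>i j. i < n \<Longrightarrow> j < n \<Longrightarrow> polynomial_fun (\<lambda>s. N s $$ (i, j))"
    and "i < n" "j < n"
  shows "polynomial_fun (\<lambda>s. (M s * N s) $$ (i, j))"
  unfolding mat_mult_entry[OF assms(1,2,5,6)]
  by (intro polynomial_fun_sum polynomial_fun_mult assms) auto

lemma polynomial_fun_poly_fun:
  assumes "f \<in> poly_fun r d"
    and "\<And>i p q. i < r \<Longrightarrow> p < d \<Longrightarrow> q < d \<Longrightarrow> polynomial_fun (\<lambda>s. A s ! i $$ (p, q))"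
  shows "polynomial_fun (\<lambda>s. f (A s))"
  using assms(1)
  by induction (simp_all add: polynomial_fun_const polynomial_fun_add polynomial_fun_mult assms(2))

text \<open>Over a finite field, 1 plus the product of all x - a would be a nonconstant polynomial
  with constant value 1, hence without a root.\<close>

lemma infinite_UNIV_alg_closed: "infinite (UNIV :: 'k::alg_closed_field set)"
proof
  assume fin: "finite (UNIV :: 'k set)"
  define p where "p = (\<Prod>a\<in>UNIV. [:- a, 1 :: 'k:])"
  have "degree p = card (UNIV :: 'k set)"
    unfolding p_def by (subst degree_prod_eq_sum_degree) auto
  then have "degree p > 0" using fin by (simp add: card_gt_0_iff)
  then have "degree (p + 1) > 0" by (simp add: degree_add_eq_left)
  then obtain x where "poly (p + 1) x = 0" using alg_closed_imp_poly_has_root by blast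
  moreover have "poly p x = 0" unfolding p_def using fin by (simp add: poly_prod)
  ultimately show False by simp
qed

text \<open>The product of three nonzero polynomials has only finitely many roots. Three are needed
  because two test functions have to be nonzero where \<open>det g\<close> is.\<close>

lemma polynomial_fun_common_nonzero:
  fixes f g h :: "'k::alg_closed_field \<Rightarrow> 'k"
  assumes "polynomial_fun f" "polynomial_fun g" "polynomial_fun h"
    and "f a \<noteq> 0" "g b \<noteq> 0" "h c \<noteq> 0"
  obtains s where "f s \<noteq> 0" "g s \<noteq> 0" "h s \<noteq> 0"
proof -
  obtain p q w where e: "\<And>s. f s = poly p s" "\<And>s. g s = poly q s" "\<And>s. h s = poly w s"
    using assms(1-3) unfolding polynomial_fun_def by blast
  have "p \<noteq> 0" "q \<noteq> 0" "w \<noteq> 0" using assms(4-6) e by auto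
  then have "finite {s. poly (p * q * w) s = 0}" by (intro poly_roots_finite) simp
  then obtain s where "poly (p * q * w) s \<noteq> 0"
    using infinite_UNIV_alg_closed[where 'k = 'k] by (metis (mono_tags, lifting) UNIV_eq_I mem_Collect_eq)
  then show ?thesis by (intro that[of s]) (simp_all add: e)
qed

text \<open>
  Replacing \<open>g\<inverse>\<close> by the adjugate makes the orbit parametrisation of \<^term>\<open>block_rep r d m\<close>
  polynomial in the entries of \<open>g\<close> and \<open>B\<close>; the scalar \<open>det g\<close> is absorbed by \<open>B\<close>.
\<close>

definition block_param :: "nat \<Rightarrow> 'k::field mat \<Rightarrow> (nat \<Rightarrow> 'k mat) \<Rightarrow> 'k mat list" where
  "block_param r g B = map (\<lambda>i. adj_mat g * B i * g) [0..<r]"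

lemma block_param_in_block_rep:
  assumes g: "g \<in> carrier_mat d d" "det g \<noteq> 0" and B: "\<And>i. i < r \<Longrightarrow> B i \<in> carrier_mat d d"
    and z: "\<And>i p q. i < r \<Longrightarrow> p < d \<Longrightarrow> q < d \<Longrightarrow> \<not> (p < m \<and> m \<le> q) \<Longrightarrow> B i $$ (p, q) = 0"
  shows "block_param r g B \<in> block_rep r d m"
proof -
  obtain h where gh: "inv_pair d g h" using inv_pair_exists[OF g] by blast
  then have h: "h \<in> carrier_mat d d" "g * h = 1\<^sub>m d" by (auto simp: inv_pair_def)
  note adj = adj_mat[OF g(1)]
  have e: "g * (adj_mat g * B i * g) * h = det g \<cdot>\<^sub>m B i" if i: "i < r" for i
  proof -
    have "g * (adj_mat g * B i * g) * h = (g * adj_mat g) * B i * (g * h)"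
      using g h adj(1) B[OF i] by (simp add: assoc_mult_mat[of _ d d _ d _ d])
    then show ?thesis using adj(2) h B[OF i] by (simp add: mult_smult_assoc_mat[of _ d d _ d])
  qed
  have "block_param r g B ! i = adj_mat g * B i * g" if "i < r" for i
    using that by (simp add: block_param_def)
  then have "(g * block_param r g B ! i * h) $$ (p, q) = 0"
    if "i < r" "p < d" "q < d" "\<not> (p < m \<and> m \<le> q)" for i p q
    using that(1-3) z[OF that] B[OF that(1)] by (simp add: e)
  moreover have "block_param r g B \<in> mat_tuples r d"
    using g adj(1) B by (auto simp: block_param_def mat_tuples_def)
  ultimately show ?thesis unfolding block_rep_def using gh by blast
qed

lemma block_rep_paramE:
  assumes "A \<in> block_rep r d m"
  obtains g B where "g \<in> carrier_mat d d" "det g \<noteq> 0" "\<And>i. i < r \<Longrightarrow> B i \<in> carrier_mat d d"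
    "\<And>i p q. i < r \<Longrightarrow> p < d \<Longrightarrow> q < d \<Longrightarrow> \<not> (p < m \<and> m \<le> q) \<Longrightarrow> B i $$ (p, q) = 0"
    "A = block_param r g B"
proof -
  obtain g h where A: "A \<in> mat_tuples r d" and gh: "inv_pair d g h"
    and z: "\<And>i p q. i < r \<Longrightarrow> p < d \<Longrightarrow> q < d \<Longrightarrow> \<not> (p < m \<and> m \<le> q) \<Longrightarrow> (g * A ! i * h) $$ (p, q) = 0"
    using assms unfolding block_rep_def by blast
  have gc: "g \<in> carrier_mat d d" "h \<in> carrier_mat d d" "g * h = 1\<^sub>m d" using gh by (auto simp: inv_pair_def)
  have "det g * det h = 1" using det_mult[OF gc(1,2)] gc(3) by simp
  then have dg: "det g \<noteq> 0" by auto
  note adj = adj_mat[OF gc(1)]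
  have "adj_mat g = adj_mat g * g * h"
    using adj(1) gc by (simp add: assoc_mult_mat[of _ d d _ d _ d])
  then have ah: "adj_mat g = det g \<cdot>\<^sub>m h"
    using adj(3) gc by (simp add: mult_smult_assoc_mat[of _ d d _ d])
  \<comment> \<open>The factor \<open>1 / det g\<close> cancels the determinant in
    \<open>adj_mat g = det g \<cdot>\<^sub>m h\<close>.\<close>
  define B where "B i = (1 / det g) \<cdot>\<^sub>m (g * A ! i * h)" for i
  have C: "g * A ! i * h \<in> carrier_mat d d" if "i < r" for i
    using gc mat_tuples_D[OF A that] by simp
  have "adj_mat g * B i * g = A ! i" if i: "i < r" for i
  proof -
    have "adj_mat g * B i = h * (g * A ! i * h)"
      unfolding ah B_def using gc(2) C[OF i] dg
      by (simp add: mult_smult_assoc_mat[of _ d d _ d] mult_smult_distrib[of _ d d _ d])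
         (auto intro!: eq_matI)
    then show ?thesis using conj_mult_conj[OF gh mat_tuples_D[OF A i]] by simp
  qed
  then have "A = block_param r g B"
    using A by (intro nth_equalityI) (auto simp: block_param_def mat_tuples_def)
  moreover have "B i $$ (p, q) = 0" if "i < r" "p < d" "q < d" "\<not> (p < m \<and> m \<le> q)" for i p q
    unfolding B_def
    by (subst index_smult_mat(1)) (use carrier_matD[OF C[OF that(1)]] z[OF that] that(2,3) in auto)
  moreover have "B i \<in> carrier_mat d d" if "i < r" for i using C[OF that] by (simp add: B_def)
  ultimately show ?thesis using that gc(1) dg by blast
qed

text \<open>The parameters of \<open>A1\<close> and \<open>A2\<close> are joined by an affine line.
  The zero pattern of the \<open>B i\<close> is a linear condition and persists along it, while
  invertibility of \<open>g\<close> and non-vanishing of \<open>f1\<close> and \<open>f2\<close>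
  exclude only finitely many points.\<close>

lemma block_rep_common_nonzero:
  fixes A1 A2 :: "'k::alg_closed_field mat list"
  assumes "A1 \<in> block_rep r d m" "A2 \<in> block_rep r d m" "f1 \<in> poly_fun r d" "f2 \<in> poly_fun r d"
    and "f1 A1 \<noteq> 0" "f2 A2 \<noteq> 0"
  shows "\<exists>A\<in>block_rep r d m. f1 A \<noteq> 0 \<and> f2 A \<noteq> 0"
proof -
  obtain g1 B1 where 1: "g1 \<in> carrier_mat d d" "det g1 \<noteq> 0" "\<And>i. i < r \<Longrightarrow> B1 i \<in> carrier_mat d d"
    "\<And>i p q. i < r \<Longrightarrow> p < d \<Longrightarrow> q < d \<Longrightarrow> \<not> (p < m \<and> m \<le> q) \<Longrightarrow> B1 i $$ (p, q) = 0"
    "A1 = block_param r g1 B1" using block_rep_paramE[OF assms(1)] by blast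
  obtain g2 B2 where 2: "g2 \<in> carrier_mat d d" "det g2 \<noteq> 0" "\<And>i. i < r \<Longrightarrow> B2 i \<in> carrier_mat d d"
    "\<And>i p q. i < r \<Longrightarrow> p < d \<Longrightarrow> q < d \<Longrightarrow> \<not> (p < m \<and> m \<le> q) \<Longrightarrow> B2 i $$ (p, q) = 0"
    "A2 = block_param r g2 B2" using block_rep_paramE[OF assms(2)] by blast
  define line where "line M N s = mat d d (\<lambda>(p, q). (1 - s) * M $$ (p, q) + s * N $$ (p, q))"
    for M N :: "'k mat" and s
  define g where "g = line g1 g2"
  define B where "B s i = line (B1 i) (B2 i) s" for s i
  have line_c: "line M N s \<in> carrier_mat d d" for M N s by (simp add: line_def)
  have line_p: "polynomial_fun (\<lambda>s. line M N s $$ (p, q))" if "p < d" "q < d" for M N p q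
    using that unfolding line_def
    by (auto intro!: polynomial_fun_add polynomial_fun_mult polynomial_fun_diff polynomial_fun_const polynomial_fun_id)
  have ends: "line M N 0 = M" "line M N 1 = N" if "M \<in> carrier_mat d d" "N \<in> carrier_mat d d" for M N
    using that by (auto simp: line_def intro!: eq_matI)
  have ac: "adj_mat (g s) \<in> carrier_mat d d" for s unfolding g_def using adj_mat(1)[OF line_c] .
  define A where "A s = block_param r (g s) (B s)" for s
  have e: "polynomial_fun (\<lambda>s. A s ! i $$ (p, q))" if "i < r" "p < d" "q < d" for i p q
  proof -
    have "polynomial_fun (\<lambda>s. (adj_mat (g s) * B s i * g s) $$ (p, q))"
      by (intro polynomial_fun_mat_mult[of _ d] polynomial_fun_adj_mat[of _ d] that mult_carrier_mat[of _ d d])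
         (auto simp: g_def B_def line_c line_p intro: adj_mat(1))
    then show ?thesis using that by (simp add: A_def block_param_def)
  qed
  have "A 0 = A1"
    unfolding A_def 1(5) block_param_def g_def B_def
    by (intro map_cong refl) (simp add: ends(1)[OF 1(1) 2(1)] ends(1)[OF 1(3) 2(3)])
  moreover have "A 1 = A2"
    unfolding A_def 2(5) block_param_def g_def B_def
    by (intro map_cong refl) (simp add: ends(2)[OF 1(1) 2(1)] ends(2)[OF 1(3) 2(3)])
  moreover have "polynomial_fun (\<lambda>s. det (g s))"
    by (rule polynomial_fun_det[of _ d]) (auto simp: g_def line_c line_p)
  moreover have "det (g 0) \<noteq> 0" using ends(1)[OF 1(1) 2(1)] 1(2) by (simp add: g_def)
  \<comment> \<open>The endpoints show that no function vanishes identically: \<open>f1\<close> at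
    0, \<open>f2\<close> at 1, the determinant at 0.\<close>
  ultimately obtain s where s: "f1 (A s) \<noteq> 0" "f2 (A s) \<noteq> 0" "det (g s) \<noteq> 0"
    using polynomial_fun_common_nonzero[OF polynomial_fun_poly_fun[OF assms(3) e]
        polynomial_fun_poly_fun[OF assms(4) e], of "\<lambda>s. det (g s)" 0 1 0] assms(5,6) by auto
  have "A s \<in> block_rep r d m"
    unfolding A_def
    by (rule block_param_in_block_rep) (use s(3) 1(4) 2(4) in \<open>auto simp: g_def B_def line_c, auto simp: line_def\<close>)
  then show ?thesis using s by blast
qed

lemma closedin_Rep_zariski:
  assumes "closedin (Rep_zariski r d) C"
  obtains F where "F \<subseteq> poly_fun r d" "C = zero_locus r d F \<inter> Rep r d"
  using assms unfolding Rep_zariski_def closedin_subtopology closedin_zariski by blast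

lemma irreducible_in_block_rep:
  assumes "block_rep r d m \<noteq> ({} :: 'k::alg_closed_field mat list set)"
  shows "irreducible_in (Rep_zariski r d) (block_rep r d m :: 'k mat list set)"
  unfolding irreducible_in_def topspace_Rep_zariski
proof (intro conjI allI impI)
  let ?Y = "block_rep r d m :: 'k mat list set"
  show "?Y \<subseteq> Rep r d" by (rule block_rep_subset_Rep)
  show "?Y \<noteq> {}" by (rule assms)
  fix F G :: "'k mat list set"
  assume FG: "closedin (Rep_zariski r d) F \<and> closedin (Rep_zariski r d) G \<and> ?Y \<subseteq> F \<union> G"
  obtain P where P: "P \<subseteq> poly_fun r d" "F = zero_locus r d P \<inter> Rep r d"
    using FG closedin_Rep_zariski by metis
  obtain Q where Q: "Q \<subseteq> poly_fun r d" "G = zero_locus r d Q \<inter> Rep r d"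
    using FG closedin_Rep_zariski by metis
  have YT: "A \<in> mat_tuples r d \<and> A \<in> Rep r d" if "A \<in> ?Y" for A
    using that block_rep_subset_Rep Rep_subset_mat_tuples by blast
  show "?Y \<subseteq> F \<or> ?Y \<subseteq> G"
  proof (rule ccontr)
    assume "\<not> (?Y \<subseteq> F \<or> ?Y \<subseteq> G)"
    then obtain A1 A2 where A: "A1 \<in> ?Y" "A1 \<notin> F" "A2 \<in> ?Y" "A2 \<notin> G" by blast
    obtain f1 where f1: "f1 \<in> P" "f1 A1 \<noteq> 0" using A(1,2) YT[OF A(1)] P(2) by (auto simp: zero_locus_def)
    obtain f2 where f2: "f2 \<in> Q" "f2 A2 \<noteq> 0" using A(3,4) YT[OF A(3)] Q(2) by (auto simp: zero_locus_def)
    obtain B where "B \<in> ?Y" "f1 B \<noteq> 0" "f2 B \<noteq> 0"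
      using block_rep_common_nonzero[OF A(1,3)] f1 f2 P(1) Q(1) by blast
    then show False using FG f1(1) f2(1) P(2) Q(2) by (auto simp: zero_locus_def)
  qed
qed

section \<open>Openness of the rank conditions\<close>

lemma poly_fun_sum:
  "(\<And>i. i \<in> I \<Longrightarrow> f i \<in> poly_fun r d) \<Longrightarrow> (\<lambda>A. \<Sum>i\<in>I. f i A) \<in> poly_fun r d"
  by (induction I rule: infinite_finite_induct) (auto intro: poly_fun.intros)

lemma poly_fun_prod:
  "(\<And>i. i \<in> I \<Longrightarrow> f i \<in> poly_fun r d) \<Longrightarrow> (\<lambda>A. \<Prod>i\<in>I. f i A) \<in> poly_fun r d"
  by (induction I rule: infinite_finite_induct) (auto intro: poly_fun.intros)

lemma poly_fun_det_contraction:
  "(\<lambda>A. det (mat n n (\<lambda>(a, b). contraction r d P Q A a b))) \<in> poly_fun r d"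
proof -
  have "(\<lambda>A. contraction r d P Q A a b) \<in> poly_fun r d" for a b
    unfolding contraction_def
    by (intro poly_fun_sum poly_fun.mult poly_fun.const poly_fun.coord) auto
  then have *: "(\<lambda>A. \<Sum>p\<in>{p. p permutes {0..<n}}. signof p * (\<Prod>i = 0..<n. contraction r d P Q A i (p i)))
      \<in> poly_fun r d"
    by (intro poly_fun_sum poly_fun.mult poly_fun.const poly_fun_prod)
  have "det (mat n n (\<lambda>(a, b). contraction r d P Q A a b)) =
      (\<Sum>p\<in>{p. p permutes {0..<n}}. signof p * (\<Prod>i = 0..<n. contraction r d P Q A i (p i)))" for A
    by (subst det_def'[of _ n]) (auto intro!: sum.cong prod.cong simp: permutes_in_image)
  with * show ?thesis by presburger
qed

text \<open>The index set may be infinite, as the rank conditions quantify over all coefficients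
  \<open>P\<close> and \<open>Q\<close>.\<close>

lemma openin_Rep_nonvanishing:
  assumes "\<And>i. i \<in> I \<Longrightarrow> f i \<in> poly_fun r d"
  shows "openin (Rep_zariski r d) {A \<in> Rep r d. \<exists>i\<in>I. f i A \<noteq> 0}"
proof -
  have "openin (zariski r d) (mat_tuples r d - zero_locus r d (f ` I))"
    unfolding openin_zariski using assms by blast
  moreover have "{A \<in> Rep r d. \<exists>i\<in>I. f i A \<noteq> 0} = (mat_tuples r d - zero_locus r d (f ` I)) \<inter> Rep r d"
    using Rep_subset_mat_tuples by (auto simp: zero_locus_def)
  ultimately show ?thesis unfolding Rep_zariski_def openin_subtopology by blast
qed

lemma openin_hrank_ge: "openin (Rep_zariski r d) {A \<in> Rep r d. hrank_ge r d n A}"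
proof -
  have "openin (Rep_zariski r d) {A \<in> Rep r d. \<exists>(P, Q)\<in>UNIV.
      det (mat n n (\<lambda>(a, b). contraction r d (\<lambda>i. P) Q A a b)) \<noteq> 0}"
    using openin_Rep_nonvanishing[of UNIV "\<lambda>(P, Q) A.
      det (mat n n (\<lambda>(a, b). contraction r d (\<lambda>i. P) Q A a b))" r d]
    by (simp add: poly_fun_det_contraction split_beta)
  then show ?thesis by (simp add: hrank_ge_def)
qed

lemma openin_vrank_ge: "openin (Rep_zariski r d) {A \<in> Rep r d. vrank_ge r d n A}"
proof -
  have "openin (Rep_zariski r d) {A \<in> Rep r d. \<exists>(P, Q)\<in>UNIV.
      det (mat n n (\<lambda>(a, b). contraction r d P (\<lambda>i. Q) A a b)) \<noteq> 0}"
    using openin_Rep_nonvanishing[of UNIV "\<lambda>(P, Q) A.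
      det (mat n n (\<lambda>(a, b). contraction r d P (\<lambda>i. Q) A a b))" r d]
    by (simp add: poly_fun_det_contraction split_beta)
  then show ?thesis by (simp add: vrank_ge_def)
qed

section \<open>Irreducible sets in a topological space\<close>

lemma irreducible_in_closure_of:
  assumes "irreducible_in X C"
  shows "irreducible_in X (X closure_of C)"
proof -
  have C: "C \<subseteq> topspace X" "C \<noteq> {}" using assms by (auto simp: irreducible_in_def)
  then have sub: "C \<subseteq> X closure_of C" by (simp add: closure_of_subset)
  have "X closure_of C \<subseteq> F \<or> X closure_of C \<subseteq> G"
    if "closedin X F" "closedin X G" "X closure_of C \<subseteq> F \<union> G" for F G
  proof -
    have "C \<subseteq> F \<or> C \<subseteq> G" using that sub assms unfolding irreducible_in_def by blast
    then show ?thesis using that closure_of_minimal by metis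
  qed
  then show ?thesis
    unfolding irreducible_in_def using C sub closure_of_subset_topspace by (metis subset_empty)
qed

text \<open>\<open>C\<close> is covered by the closure of \<open>U \<inter> C\<close> and the
  complement of \<open>U\<close>. The complement cannot contain \<open>C\<close>, since
  \<open>U\<close> meets \<open>C\<close>.\<close>

lemma irreducible_in_open_dense:
  assumes "irreducible_in X C" "openin X U" "U \<inter> C \<noteq> {}"
  shows "C \<subseteq> X closure_of (U \<inter> C)"
proof -
  have C: "C \<subseteq> topspace X" using assms by (auto simp: irreducible_in_def)
  then have "U \<inter> C \<subseteq> X closure_of (U \<inter> C)" by (intro closure_of_subset) blast
  then have "C \<subseteq> X closure_of (U \<inter> C) \<union> (topspace X - U)" using C by blast
  moreover have "closedin X (topspace X - U)" using assms(2) by blast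
  ultimately have "C \<subseteq> X closure_of (U \<inter> C) \<or> C \<subseteq> topspace X - U"
    using assms(1) closedin_closure_of[of X "U \<inter> C"] unfolding irreducible_in_def by blast
  then show ?thesis using assms(3) by blast
qed

lemma irreducible_in_subset_Union:
  assumes "finite I" "irreducible_in X D" "\<And>i. i \<in> I \<Longrightarrow> closedin X (C i)" "D \<subseteq> (\<Union>i\<in>I. C i)"
  shows "\<exists>i\<in>I. D \<subseteq> C i"
  using assms(1,3,4)
proof (induction I rule: finite_induct)
  case empty
  then show ?case using assms(2) by (auto simp: irreducible_in_def)
next
  case (insert i I)
  have "closedin X (C i)" "closedin X (\<Union>i\<in>I. C i)" "D \<subseteq> C i \<union> (\<Union>i\<in>I. C i)"
    using insert.prems insert.hyps(1) by (auto intro!: closedin_Union)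
  then have "D \<subseteq> C i \<or> D \<subseteq> (\<Union>i\<in>I. C i)" using assms(2) unfolding irreducible_in_def by blast
  then show ?case using insert by blast
qed

text \<open>Every irreducible set lies in a single member of a finite closed cover. So an
  irreducible set above \<open>C i\<close> lies below some \<open>C j\<close>, and incomparability
  gives \<open>i = j\<close>.\<close>

lemma irreducible_components_of_cover:
  assumes "finite I" "\<And>i. i \<in> I \<Longrightarrow> irreducible_in X (C i)" "\<And>i. i \<in> I \<Longrightarrow> closedin X (C i)"
    and "topspace X = (\<Union>i\<in>I. C i)" and incomparable: "\<And>i j. i \<in> I \<Longrightarrow> j \<in> I \<Longrightarrow> C i \<subseteq> C j \<Longrightarrow> i = j"
  shows "{D. irreducible_component X D} = C ` I"
proof (intro equalityI subsetI)
  fix D assume "D \<in> {D. irreducible_component X D}"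
  then have D: "irreducible_in X D" "\<And>E. irreducible_in X E \<Longrightarrow> D \<subseteq> E \<Longrightarrow> E = D"
    by (auto simp: irreducible_component_def)
  then obtain i where "i \<in> I" "D \<subseteq> C i"
    using irreducible_in_subset_Union[OF assms(1) D(1), of C] assms(3,4) by (auto simp: irreducible_in_def)
  then show "D \<in> C ` I" using D(2)[OF assms(2)] by blast
next
  fix D assume "D \<in> C ` I"
  then obtain i where i: "i \<in> I" "D = C i" by blast
  have "E = C i" if E: "irreducible_in X E" "C i \<subseteq> E" for E
  proof -
    obtain j where j: "j \<in> I" "E \<subseteq> C j"
      using irreducible_in_subset_Union[OF assms(1) E(1), of C] E(1) assms(3,4)
      by (auto simp: irreducible_in_def)
    then have "i = j" using incomparable i E(2) by blast
    then show ?thesis using j E(2) by blast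
  qed
  then show "D \<in> {D. irreducible_component X D}"
    using assms(2) i by (auto simp: irreducible_component_def)
qed

section \<open>The irreducible components\<close>

text \<open>The subspace \<open>W = JM\<close> is admissible, and it has dimension
  \<open>d - t\<close> when the top is \<open>S^t\<close>.\<close>

lemma Rep_top_subset_block_rep:
  fixes S :: "((nat list \<Rightarrow> 'k::field) set, 's) module"
  assumes "simple_module (Lambda_alg r) S" "t \<le> d"
  shows "Rep_top r d (module_power S t) \<subseteq> block_rep r d (d - t)"
proof
  fix A assume "A \<in> Rep_top r d (module_power S t)"
  then have A: "A \<in> Rep r d"
    and iso: "module_iso (Lambda_alg r) (module_top (Lambda_alg r) (rep_module d A)) (module_power S t)"
    by (auto simp: Rep_top_def)
  obtain g h \<rho> \<sigma> where gh: "inv_pair d g h" "\<rho> \<le> \<sigma>" "\<sigma> \<le> d"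
    "lin_image r d A = flag_space d g \<rho>" "lin_socle r d A = flag_space d g \<sigma>"
    using Rep_normal_form[OF A] by blast
  have "t = d - \<rho>"
    using iso module_top_iso_module_power[OF assms(1) A gh(1,4)] gh(2,3) by simp
  then have "\<rho> = d - t" using gh(2,3) by simp
  moreover have "A \<in> block_rep r d \<rho>"
    using subsetD[OF Rep_subset_mat_tuples A] gh(1,2)
    by (intro block_repI[of _ _ _ g h]) (simp_all add: gh(4,5) flag_space_mono)
  ultimately show "A \<in> block_rep r d (d - t)" by simp
qed

text \<open>By \<open>rank_conditions_normal_form\<close> image and socle coincide here and have
  dimension \<open>m\<close>. Lower rank bounds suffice to express this, which keeps the set visibly
  open.\<close>

definition full_rank_reps :: "nat \<Rightarrow> nat \<Rightarrow> nat \<Rightarrow> 'k::field mat list set" where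
  "full_rank_reps r d m = {A \<in> Rep r d. hrank_ge r d m A} \<inter> {A \<in> Rep r d. vrank_ge r d (d - m) A}"

lemma openin_full_rank_reps: "openin (Rep_zariski r d) (full_rank_reps r d m)"
  unfolding full_rank_reps_def by (intro openin_Int openin_hrank_ge openin_vrank_ge)

lemma full_rank_reps_subset_Rep_top:
  fixes S :: "((nat list \<Rightarrow> 'k::field) set, 's) module"
  assumes "simple_module (Lambda_alg r) S" "m \<le> d"
  shows "full_rank_reps r d m \<subseteq> Rep_top r d (module_power S (d - m))"
proof
  fix A :: "'k mat list" assume "A \<in> full_rank_reps r d m"
  then have A: "A \<in> Rep r d" "hrank_ge r d m A" "vrank_ge r d (d - m) A"
    by (auto simp: full_rank_reps_def)
  obtain g h where gh: "inv_pair d g h" "lin_image r d A = flag_space d g m"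
    "lin_socle r d A = flag_space d g m"
    by (rule rank_conditions_normal_form[OF A(1) assms(2) A(2,3)])
  show "A \<in> Rep_top r d (module_power S (d - m))"
    using module_top_iso_module_power[OF assms(1) A(1) gh(1,2) assms(2)] A(1) by (simp add: Rep_top_def)
qed

lemma full_rank_reps_no_simple_direct_summand:
  assumes "A \<in> full_rank_reps r d m" "m \<le> d"
  shows "\<not> has_simple_direct_summand (Lambda_alg r) (rep_module d A)"
proof -
  have A: "A \<in> Rep r d" "hrank_ge r d m A" "vrank_ge r d (d - m) A"
    using assms(1) by (auto simp: full_rank_reps_def)
  obtain g h where "lin_image r d A = flag_space d g m" "lin_socle r d A = flag_space d g m"
    by (rule rank_conditions_normal_form[OF A(1) assms(2) A(2,3)])
  then show ?thesis by (intro no_simple_direct_summand[OF A(1)]) simp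
qed

section \<open>The stratum with top \<open>S^t\<close> for a fixed admissible
  \<open>t\<close>\<close>

context
  fixes r d t :: nat and S :: "((nat list \<Rightarrow> 'k::alg_closed_field) set, 's) module"
  assumes r: "0 < r" and S: "simple_module (Lambda_alg r) S"
    and t: "t \<le> d" "d - t \<le> r * t" "t \<le> r * (d - t)"
begin

text \<open>The assumptions on \<open>t\<close> are those of
  \<open>block_rep_full_rank_exists\<close> for \<open>m = d - t\<close>. The common point is what
  makes the open full rank locus dense in the irreducible block set.\<close>

lemma full_rank_reps_meet_block_rep:
  "full_rank_reps r d (d - t) \<inter> (block_rep r d (d - t) :: 'k mat list set) \<noteq> {}"
proof -
  obtain A :: "'k mat list" where A: "A \<in> block_rep r d (d - t)" "hrank_ge r d (d - t) A"
    "vrank_ge r d (d - (d - t)) A"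
    using block_rep_full_rank_exists[where 'k = 'k, OF r, of "d - t" d] t by auto
  then have "A \<in> full_rank_reps r d (d - t)"
    using subsetD[OF block_rep_subset_Rep A(1)] unfolding full_rank_reps_def by simp
  then show ?thesis using A(1) by blast
qed

lemma irreducible_in_block_rep_complement:
  "irreducible_in (Rep_zariski r d) (block_rep r d (d - t) :: 'k mat list set)"
  using full_rank_reps_meet_block_rep by (intro irreducible_in_block_rep) blast

text \<open>Half of a sandwich: \<open>Rep_top\<close> lies between \<open>full_rank_reps\<close>
  and \<open>block_rep\<close>, so equal closures of the outer two determine that of
  \<open>Rep_top\<close>.\<close>

lemma closure_of_block_rep:
  "Rep_zariski r d closure_of block_rep r d (d - t) =
     Rep_zariski r d closure_of (full_rank_reps r d (d - t) :: 'k mat list set)" (is "?X closure_of ?Y = ?X closure_of ?U")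
proof
  have "?U \<subseteq> ?Y"
    using full_rank_reps_subset_Rep_top[OF S, of "d - t" d] Rep_top_subset_block_rep[OF S t(1)] t(1) by auto
  then show "?X closure_of ?U \<subseteq> ?X closure_of ?Y" by (rule closure_of_mono)
  have "?Y \<subseteq> ?X closure_of (?U \<inter> ?Y)"
    by (rule irreducible_in_open_dense[OF irreducible_in_block_rep_complement openin_full_rank_reps
          full_rank_reps_meet_block_rep])
  also have "\<dots> \<subseteq> ?X closure_of ?U" by (intro closure_of_mono) blast
  finally show "?X closure_of ?Y \<subseteq> ?X closure_of ?U" by (rule closure_of_minimal) simp
qed

lemma closure_of_Rep_top:
  "Rep_zariski r d closure_of Rep_top r d (module_power S t) =
     Rep_zariski r d closure_of (full_rank_reps r d (d - t))"
proof
  show "Rep_zariski r d closure_of Rep_top r d (module_power S t) \<subseteq>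
      Rep_zariski r d closure_of full_rank_reps r d (d - t)"
    unfolding closure_of_block_rep[symmetric]
    by (rule closure_of_mono[OF Rep_top_subset_block_rep[OF S t(1)]])
  show "Rep_zariski r d closure_of full_rank_reps r d (d - t) \<subseteq>
      Rep_zariski r d closure_of Rep_top r d (module_power S t)"
    using full_rank_reps_subset_Rep_top[OF S, of "d - t" d] t(1) by (intro closure_of_mono) simp
qed

lemma irreducible_in_closure_of_Rep_top:
  "irreducible_in (Rep_zariski r d) (Rep_zariski r d closure_of Rep_top r d (module_power S t))"
  unfolding closure_of_Rep_top closure_of_block_rep[symmetric]
  by (rule irreducible_in_closure_of[OF irreducible_in_block_rep_complement])

lemma generically_no_simple_direct_summand:
  "generically (Rep_zariski r d) (Rep_zariski r d closure_of Rep_top r d (module_power S t))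
     (\<lambda>A. \<not> has_simple_direct_summand (Lambda_alg r) (rep_module d A))"
proof -
  let ?X = "Rep_zariski r d" and ?U = "full_rank_reps r d (d - t) :: 'k mat list set"
  have sub: "?U \<subseteq> ?X closure_of ?U"
    by (intro closure_of_subset) (auto simp: topspace_Rep_zariski full_rank_reps_def)
  show ?thesis
    unfolding generically_def closure_of_Rep_top
  proof (intro exI[of _ ?U] conjI ballI)
    show "openin (subtopology ?X (?X closure_of ?U)) ?U"
      unfolding openin_subtopology
      using openin_full_rank_reps sub by (intro exI[of _ ?U]) (simp add: Int_absorb2)
    show "subtopology ?X (?X closure_of ?U) closure_of ?U = ?X closure_of ?U"
      using sub by (auto simp: closure_of_subtopology Int_absorb1)
    show "\<not> has_simple_direct_summand (Lambda_alg r) (rep_module d A)" if "A \<in> ?U" for A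
      using full_rank_reps_no_simple_direct_summand[OF that] by simp
  qed
qed

text \<open>The open full rank locus for \<open>t\<close> meets the closure for \<open>t'\<close>,
  hence \<open>Rep_top\<close> for \<open>t'\<close> itself. At a common point the ranks are at
  least \<open>d - t\<close> and \<open>t\<close>, while its membership in the block set for
  \<open>d - t'\<close> bounds them by \<open>d - t'\<close> and \<open>t'\<close>; this gives both
  inequalities.\<close>

lemma closure_of_Rep_top_incomparable:
  assumes "simple_module (Lambda_alg r) S'" "t' \<le> d"
    and sub: "Rep_zariski r d closure_of Rep_top r d (module_power S t) \<subseteq>
      Rep_zariski r d closure_of Rep_top r d (module_power S' t')"
  shows "t = t'"
proof -
  let ?X = "Rep_zariski r d"
  obtain A :: "'k mat list" where A: "A \<in> full_rank_reps r d (d - t)"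
    using full_rank_reps_meet_block_rep by blast
  have "full_rank_reps r d (d - t) \<subseteq> ?X closure_of (full_rank_reps r d (d - t) :: 'k mat list set)"
    by (intro closure_of_subset) (auto simp: topspace_Rep_zariski full_rank_reps_def)
  then have "A \<in> ?X closure_of Rep_top r d (module_power S' t')"
    using A sub closure_of_Rep_top by blast
  then obtain A' where A': "A' \<in> Rep_top r d (module_power S' t')" "A' \<in> full_rank_reps r d (d - t)"
    using A openin_full_rank_reps[of r d "d - t"] by (auto simp: in_closure_of)
  then have B: "A' \<in> block_rep r d (d - t')" using Rep_top_subset_block_rep[OF assms(1,2)] by blast
  have "d - t \<le> d - t'"
    by (rule block_rep_hrank[OF B]) (use A'(2) in \<open>auto simp: full_rank_reps_def\<close>)
  moreover have "d - (d - t) \<le> d - (d - t')"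
    by (rule block_rep_vrank[OF B]) (use A'(2) in \<open>auto simp: full_rank_reps_def\<close>)
  ultimately show ?thesis using t(1) assms(2) by simp
qed

end

theorem theorem3p12:
  fixes r d u :: nat
    and S :: "((nat list \<Rightarrow> 'k::alg_closed_field) set, 's) module"
  assumes "r \<ge> 2" and "d \<ge> 2"
    and "simple_module (Lambda_alg r) S"
    and "u = (LEAST u. int r * int u \<ge> int d - int u)"
  shows "{C :: 'k mat list set. irreducible_component (Rep_zariski r d) C} =
           {Rep_zariski r d closure_of Rep_top r d (module_power S t) |t. u \<le> t \<and> t \<le> d - u}
       \<and> (\<forall>C :: 'k mat list set. irreducible_component (Rep_zariski r d) C \<longrightarrow>
             generically (Rep_zariski r d) C
               (\<lambda>A. \<not> has_simple_direct_summand (Lambda_alg r) (rep_module d A)))"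
proof -
  have iff: "int r * int v \<ge> int d - int v \<longleftrightarrow> d \<le> (r + 1) * v" for v
  proof -
    have "int r * int v + int v = int ((r + 1) * v)" by (simp add: algebra_simps)
    then show ?thesis by linarith
  qed
  have u_eq: "u = (LEAST u. d \<le> (r + 1) * u)" using assms(4) by (simp only: iff)
  have "d \<le> (r + 1) * d" by simp
  then have u: "d \<le> (r + 1) * u" unfolding u_eq by (rule LeastI)
  have u_least: "u \<le> v" if "d \<le> (r + 1) * v" for v unfolding u_eq by (rule Least_le) (rule that)
  \<comment> \<open>With \<open>d \<ge> 2\<close> and \<open>r + 1 \<ge> 3\<close>, the number
    \<open>d div 2\<close> satisfies the inequality that defines \<open>u\<close>; hence
    \<open>u \<le> d - u\<close> and the range of \<open>t\<close> is not empty.\<close>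
  have "d \<le> 3 * (d div 2)" using assms(2) by presburger
  also have "\<dots> \<le> (r + 1) * (d div 2)" using assms(1) by (intro mult_le_mono1) simp
  finally have "u \<le> d div 2" by (rule u_least)
  then have ud: "u \<le> d - u" by simp
  have range: "t \<le> d \<and> d - t \<le> r * t" if "u \<le> t" "t \<le> d - u" for t
  proof -
    have "d \<le> (r + 1) * t" using u that(1) by (meson le_trans mult_le_mono2)
    then have "d \<le> r * t + t" by simp
    then show ?thesis using that(2) by linarith
  qed
  \<comment> \<open>The interval is symmetric under passing from \<open>t\<close> to
    \<open>d - t\<close>, so this is \<open>range\<close> for \<open>d - t\<close>.\<close>
  have range': "t \<le> r * (d - t)" if "u \<le> t" "t \<le> d - u" for t
    using range[of "d - t"] that ud by simp
  let ?X = "Rep_zariski r d :: 'k mat list topology"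
  let ?C = "\<lambda>t. ?X closure_of Rep_top r d (module_power S t)"
  have r: "0 < r" using assms(1) by simp
  note ctx = r assms(3)
  have comps: "{C. irreducible_component ?X C} = ?C ` {u..d - u}"
  proof (rule irreducible_components_of_cover)
    show "irreducible_in ?X (?C t)" if "t \<in> {u..d - u}" for t
      using that range[of t] range'[of t] by (intro irreducible_in_closure_of_Rep_top[OF ctx]) auto
    show "topspace ?X = (\<Union>t\<in>{u..d - u}. ?C t)"
    proof
      show "topspace ?X \<subseteq> (\<Union>t\<in>{u..d - u}. ?C t)"
      proof
        fix A :: "'k mat list" assume "A \<in> topspace ?X"
        then have "A \<in> Rep r d" by (simp add: topspace_Rep_zariski)
        then obtain m where m: "u \<le> m" "m \<le> d - u" "A \<in> block_rep r d m"
          using Rep_covered_by_block_reps[OF _ u_least ud] by blast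
        define t where "t = d - m"
        have t: "u \<le> t" "t \<le> d - u" "m = d - t" using m ud by (auto simp: t_def)
        have "block_rep r d m \<subseteq> ?X closure_of block_rep r d m"
          by (intro closure_of_subset) (simp add: topspace_Rep_zariski block_rep_subset_Rep)
        also have "\<dots> = ?C t"
          using closure_of_block_rep[OF ctx, of t d] closure_of_Rep_top[OF ctx, of t d]
            range[OF t(1,2)] range'[OF t(1,2)] t(3) by simp
        finally show "A \<in> (\<Union>t\<in>{u..d - u}. ?C t)" using m(3) t by auto
      qed
    qed (use closure_of_subset_topspace in fast)
    show "t = t'" if "t \<in> {u..d - u}" "t' \<in> {u..d - u}" "?C t \<subseteq> ?C t'" for t t'
      using that range[of t] range'[of t] range[of t']
      by (intro closure_of_Rep_top_incomparable[OF ctx _ _ _ assms(3)]) auto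
  qed auto
  have generic: "generically ?X (?C t) (\<lambda>A. \<not> has_simple_direct_summand (Lambda_alg r) (rep_module d A))"
    if "t \<in> {u..d - u}" for t
    using that range[of t] range'[of t] by (intro generically_no_simple_direct_summand[OF ctx]) auto
  show ?thesis
  proof (intro conjI allI impI)
    show "{C. irreducible_component ?X C} = {?C t |t. u \<le> t \<and> t \<le> d - u}"
      unfolding comps by auto
    fix C assume "irreducible_component ?X C"
    then have "C \<in> ?C ` {u..d - u}" unfolding comps[symmetric] by simp
    then show "generically ?X C
        (\<lambda>A. \<not> has_simple_direct_summand (Lambda_alg r) (rep_module d A))"
      using generic by blast
  qed
qed

end
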